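(* For every cardinal number $\tau$, let $\mathbb{T}^\tau=(\mathbb{S}^1)^\tau$ (product topology; $\mathbb{S}^1$ the circle). Then the complete normal contact algebra $(RC(\mathbb{T}^\tau),\rho_{\mathbb{T}^\tau})$ is CA-isomorphic to the $\mathbf{DHC}$-sum (coproduct in the category $\mathbf{DHC}$) of $\tau$ copies of the complete normal contact algebra $(\tilde{A},C_{\tilde{\sigma},\widetilde{\mathbb{B}}})$, where $(\tilde{A},\tilde{\sigma},\widetilde{\mathbb{B}})$ is the complete local contact algebra constructed in the context and $C_{\tilde{\sigma},\widetilde{\mathbb{B}}}$ is the Alexandroff extension of $\tilde{\sigma}$. Therefore this $\mathbf{DHC}$-sum completely determines the space $\mathbb{T}^\tau$: every compact Hausdorff space $Y$ with $(RC(Y),\rho_Y)$ CA-isomorphic to this sum is homeomorphic to $\mathbb{T}^\tau$.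
   Context: **Contact algebras.** A contact algebra $(B,C)$ is a Boolean algebra $B$ (complement $a^*$) with a binary relation $C$ such that: (C1) $a\neq 0\Rightarrow aCa$; (C2) $aCb\Rightarrow a\neq 0$ and $b\ne 0$; (C3) $aCb\Rightarrow bCa$; (C4) $aC(b\vee c)$ iff $aCb$ or $aCc$. Write $a(-C)b$ for "not $aCb$", and $a\ll_C b$ iff $a(-C)b^*$. It is a normal contact algebra (NCA) if also (C5) $a(-C)b$ implies $a(-C)c$ and $b(-C)c^*$ for some $c\in B$; (C6) if $a\neq 1$ there is $b\neq 0$ with $b(-C)a$. It is a complete normal contact algebra (CNCA) if moreover $B$ is complete. $(B_1,C_1)$ and $(B_2,C_2)$ are CA-isomorphic if there is a Boolean isomorphism $\varphi:B_1\to B_2$ with $aC_1b\iff\varphi(a)C_2\varphi(b)$. **Local contact algebras.** A local contact algebra (LCA) $(B,\rho,\mathbb{B})$ is a contact algebra $(B,\rho)$ with an ideal $\mathbb{B}$ of $B$ (possibly $\mathbb B=B$) such that: (BC1) if $a\in\mathbb{B}$, $c\in B$, $a\ll_\rho c$, then $a\ll_\rho b\ll_\rho c$ for some $b\in\mathbb{B}$; (BC2) if $a\rho b$ then $a\rho(c\wedge b)$ for some $c\in\mathbb{B}$; (BC3) if $a\neq 0$ there is $b\in\mathbb{B}\setminus\{0\}$ with $b\ll_\rho a$. It is complete (CLCA) if $B$ is a complete Boolean algebra. The Alexandroff extension of $\rho$ is the relation $C_{\rho,\mathbb{B}}$ on $B$: $aC_{\rho,\mathbb{B}}b$ iff $a\rho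 b$ or ($a\notin\mathbb{B}$ and $b\notin\mathbb{B}$); $(B,C_{\rho,\mathbb{B}})$ is then a normal contact algebra. **Standard algebras.** For a topological space $X$: $RC(X)$ is the complete Boolean algebra of regular closed subsets ($F=\mathrm{cl}(\mathrm{int}F)$), with $F\vee G=F\cup G$, $F\wedge G=\mathrm{cl}(\mathrm{int}(F\cap G))$, $F^*=\mathrm{cl}(X\setminus F)$; $F\rho_X G$ iff $F\cap G\neq\emptyset$. For $X$ compact Hausdorff, $(RC(X),\rho_X)$ is a CNCA. **The category $\mathbf{DHC}$.** Objects: CNCAs. Morphisms $\varphi:(A,C)\to(B,C')$: functions $\varphi:A\to B$ such that (DVAL1) $\varphi(0)=0$; (DVAL2) $\varphi(a\wedge b)=\varphi(a)\wedge\varphi(b)$; (DVAL3) $a\ll_C b$ implies $(\varphi(a^* ))^*\ll_{C'}\varphi(b)$; (DVAL4) $\varphi(a)=\bigvee\{\varphi(b): b\ll_C a\}$ for all $a\in A$. Composition: $\varphi_2\diamond\varphi_1=(\varphi_2\circ\varphi_1)\check{}$, where for a function $\psi$ from $(A,C)$ one sets $\psi\check{}(a)=\bigvee\{\psi(b): b\ll_C a\}$. **Construction of $(\tilde{A},\tilde{\sigma},\widetilde{\mathbb{B}})$.** Let $\mathbb{Z}_0=\mathbb{Z}\setminus\{0\}$ with the usual order; for $p\in\mathbb{Z}_0$ let $p^-,p^+$ be its immediate predecessor and successor in $\mathbb{Z}_0$ (so $1^-=-1$, $(-1)^+=1$), $succ(p)=\{q\in\mathbb{Z}_0: q>p\}$,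 $pred(p)=\{q\in\mathbb{Z}_0: q<p\}$. For $i\in\mathbb{N}^+$ let $A_i=P(\mathbb{Z}_0)$ (power set Boolean algebra). Let $(A,(\varphi_i)_{i\in\mathbb{N}^+})$ be the sum (coproduct, free product) of the Boolean algebras $A_i$, with canonical monomorphisms $\varphi_i:A_i\to A$, and let $\tilde{A}\supseteq A$ be the (MacNeille) completion of $A$. Let $B_0$ be the set of all elements $b=\varphi_1(\{n_1\})\wedge\dots\wedge\varphi_k(\{n_k\})$, $k\in\mathbb{N}^+$, $n_1,\dots,n_k\in\mathbb{Z}_0$. For such $b$ put $b_-=\varphi_1(\{n_1\})\wedge\dots\wedge\varphi_{k-1}(\{n_{k-1}\})\wedge\varphi_k(\{n_k^-\})$ and, for $r\in\mathbb{N}^+$, $q_{br}=(b_-\wedge\varphi_{k+1}(succ(r)))\vee(b\wedge\varphi_{k+1}(pred(-r)))$. Let $B_1=\{q_{br}: b\in B_0, r\in\mathbb{N}^+\}$ and let $\widetilde{\mathbb{B}}$ be the ideal of $\tilde{A}$ generated by $B_0\cup B_1$. The relation $\tilde{\sigma}$ on $\tilde{A}$ is symmetric and defined as follows. Let $b=\bigwedge_{i=1}^k\varphi_i(\{n_i\})$, $b'=\bigwedge_{i=1}^l\varphi_i(\{n'_i\})$ be in $B_0$ and $r,r'\in\mathbb{N}^+$. (i) If $k\le l$: $b\tilde{\sigma}b'$ iff $n_i=n'_i$ for all $i<k$ and [$n'_k\in\{n_k^-,n_k,n_k^+\}$ if $k=l$; $n'_k=n_k$ if $k<l$]. (ii)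 If $k\le l$: $q_{br}\tilde{\sigma}q_{b'r'}$ iff $n_i=n'_i$ for all $i<k$ and [$n'_k=n_k$ if $l=k$; ($n'_k=n_k$ and $n'_{k+1}\le -r$) or ($n'_k=n_k^-$ and $n'_{k+1}>r$) if $l=k+1$; ($n'_k=n_k$ and $n'_{k+1}<-r$) or ($n'_k=n_k^-$ and $n'_{k+1}>r$) if $l>k+1$]. (iii) If $k>l$: $q_{br}\tilde{\sigma}b'$ iff $n_i=n'_i$ for all $i\in\{1,\dots,l\}$. If $k\le l$: $q_{br}\tilde{\sigma}b'$ iff $n_i=n'_i$ for all $i<k$ and [$n'_k\in\{n_k^-,n_k\}$ if $l=k$; ($n'_{k+1}\ge r$ and $n'_k=n_k^-$) or ($n'_{k+1}\le -r$ and $n'_k=n_k$) if $l=k+1$; ($n'_{k+1}>r$ and $n'_k=n_k^-$) or ($n'_{k+1}<-r$ and $n'_k=n_k$) if $l>k+1$]. (iv) For $c,d\in\widetilde{\mathbb{B}}$: $c(-\tilde{\sigma})d$ iff there are $k,l\in\mathbb{N}^+$ and $c_1,\dots,c_k,d_1,\dots,d_l\in B_0\cup B_1$ with $c\le\bigvee_i c_i$, $d\le\bigvee_j d_j$ and $c_i(-\tilde{\sigma})d_j$ for all $i,j$. (v) For $a,b\in\tilde{A}$: $a\tilde{\sigma}b$ iff there are $c,d\in\widetilde{\mathbb{B}}$ with $c\le a$, $d\le b$, $c\tilde{\sigma}d$. *)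

theory Defs
  imports "HOL-Analysis.Analysis" "HOL-Algebra.Complete_Lattice"
begin

section \<open>Boolean algebras\<close>

text \<open>Boolean algebras, like all structures below, have explicit carriers, because the categorical
  notions quantify over them.  Only the order is stored; joins, meets and bounds are those of
  \<^theory>\<open>HOL-Algebra.Lattice\<close>.  The one-element algebra is allowed.\<close>

locale boolean_alg = bounded_lattice B for B (structure) +
  assumes distrib: "\<lbrakk>a \<in> carrier B; b \<in> carrier B; c \<in> carrier B\<rbrakk> \<Longrightarrow>
      a \<sqinter> (b \<squnion> c) = (a \<sqinter> b) \<squnion> (a \<sqinter> c)"
    and compl_exists: "a \<in> carrier B \<Longrightarrow> \<exists>b\<in>carrier B. a \<sqinter> b = \<bottom> \<and> a \<squnion> b = \<top>"

definition compl :: "('a, 'm) gorder_scheme \<Rightarrow> 'a \<Rightarrow> 'a" where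
  "compl B a = (THE b. b \<in> carrier B \<and> a \<sqinter>\<^bsub>B\<^esub> b = \<bottom>\<^bsub>B\<^esub> \<and> a \<squnion>\<^bsub>B\<^esub> b = \<top>\<^bsub>B\<^esub>)"

definition bool_hom :: "('a, 'm) gorder_scheme \<Rightarrow> ('b, 'n) gorder_scheme \<Rightarrow> ('a \<Rightarrow> 'b) set" where
  "bool_hom A B = {f \<in> carrier A \<rightarrow> carrier B.
     f \<bottom>\<^bsub>A\<^esub> = \<bottom>\<^bsub>B\<^esub> \<and> f \<top>\<^bsub>A\<^esub> = \<top>\<^bsub>B\<^esub> \<and>
     (\<forall>x\<in>carrier A. \<forall>y\<in>carrier A. f (x \<squnion>\<^bsub>A\<^esub> y) = f x \<squnion>\<^bsub>B\<^esub> f y) \<and>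
     (\<forall>x\<in>carrier A. \<forall>y\<in>carrier A. f (x \<sqinter>\<^bsub>A\<^esub> y) = f x \<sqinter>\<^bsub>B\<^esub> f y) \<and>
     (\<forall>x\<in>carrier A. f (compl A x) = compl B (f x))}"

definition bool_iso :: "('a, 'm) gorder_scheme \<Rightarrow> ('b, 'n) gorder_scheme \<Rightarrow> ('a \<Rightarrow> 'b) set" where
  "bool_iso A B = {f \<in> bool_hom A B. bij_betw f (carrier A) (carrier B)}"

definition pow_alg :: "'a set \<Rightarrow> 'a set gorder" where
  "pow_alg S = \<lparr>carrier = Pow S, eq = (=), le = (\<subseteq>)\<rparr>"

text \<open>The sum (coproduct, free product) of a family of Boolean algebras, given by its universal
  property; the test algebras range over all Boolean algebras on subsets of the type \<open>'t\<close>.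
  (As soon as \<open>'t\<close> has two elements, the two-element algebra is among them, and then by Stone
  duality the property already holds for test algebras on every type.)\<close>

definition bool_sum ::
  "'t itself \<Rightarrow> 'j set \<Rightarrow> ('j \<Rightarrow> 'b gorder) \<Rightarrow> 'a gorder \<Rightarrow> ('j \<Rightarrow> 'b \<Rightarrow> 'a) \<Rightarrow> bool" where
  "bool_sum _ J Ai A e \<longleftrightarrow>
     boolean_alg A \<and> (\<forall>j\<in>J. boolean_alg (Ai j) \<and> e j \<in> bool_hom (Ai j) A) \<and>
     (\<forall>(D :: 't gorder) f. boolean_alg D \<and> (\<forall>j\<in>J. f j \<in> bool_hom (Ai j) D) \<longrightarrow>
        (\<exists>!h. h \<in> bool_hom A D \<inter> extensional (carrier A) \<and>
              (\<forall>j\<in>J. \<forall>x\<in>carrier (Ai j). h (e j x) = f j x)))"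

text \<open>\<open>At\<close> is a complete Boolean algebra that contains \<open>A\<close> as a join- and meet-dense suborder; then
  \<open>A\<close> is automatically a Boolean subalgebra.\<close>

definition macneille_completion :: "'a gorder \<Rightarrow> 'a gorder \<Rightarrow> bool" where
  "macneille_completion A At \<longleftrightarrow>
     boolean_alg A \<and> boolean_alg At \<and> complete_lattice At \<and> carrier A \<subseteq> carrier At \<and>
     (\<forall>x\<in>carrier A. \<forall>y\<in>carrier A. x \<sqsubseteq>\<^bsub>A\<^esub> y \<longleftrightarrow> x \<sqsubseteq>\<^bsub>At\<^esub> y) \<and>
     (\<forall>x\<in>carrier At. x = \<Squnion>\<^bsub>At\<^esub> {a \<in> carrier A. a \<sqsubseteq>\<^bsub>At\<^esub> x} \<and>
                     x = \<Sqinter>\<^bsub>At\<^esub> {a \<in> carrier A. x \<sqsubseteq>\<^bsub>At\<^esub> a})"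

definition bool_ideal :: "('a, 'm) gorder_scheme \<Rightarrow> 'a set \<Rightarrow> bool" where
  "bool_ideal B J \<longleftrightarrow> J \<subseteq> carrier B \<and> \<bottom>\<^bsub>B\<^esub> \<in> J \<and> (\<forall>x\<in>J. \<forall>y\<in>J. x \<squnion>\<^bsub>B\<^esub> y \<in> J) \<and>
     (\<forall>x\<in>J. \<forall>y\<in>carrier B. y \<sqsubseteq>\<^bsub>B\<^esub> x \<longrightarrow> y \<in> J)"

definition ideal_gen :: "('a, 'm) gorder_scheme \<Rightarrow> 'a set \<Rightarrow> 'a set" where
  "ideal_gen B S = \<Inter>{J. bool_ideal B J \<and> S \<subseteq> J}"


section \<open>Contact algebras and local contact algebras\<close>

record 'a contact_alg = "'a gorder" +
  contact :: "'a \<Rightarrow> 'a \<Rightarrow> bool"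

definition well_inside :: "('a, 'm) contact_alg_scheme \<Rightarrow> 'a \<Rightarrow> 'a \<Rightarrow> bool" (infix \<open>\<lless>\<index>\<close> 50) where
  "a \<lless>\<^bsub>B\<^esub> b \<longleftrightarrow> \<not> contact B a (compl B b)"

locale contact_algebra = boolean_alg B for B (structure) +
  assumes C1: "\<lbrakk>a \<in> carrier B; a \<noteq> \<bottom>\<rbrakk> \<Longrightarrow> contact B a a"
    and C2: "\<lbrakk>a \<in> carrier B; b \<in> carrier B; contact B a b\<rbrakk> \<Longrightarrow> a \<noteq> \<bottom> \<and> b \<noteq> \<bottom>"
    and C3: "\<lbrakk>a \<in> carrier B; b \<in> carrier B; contact B a b\<rbrakk> \<Longrightarrow> contact B b a"
    and C4: "\<lbrakk>a \<in> carrier B; b \<in> carrier B; c \<in> carrier B\<rbrakk> \<Longrightarrow>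
      contact B a (b \<squnion> c) \<longleftrightarrow> contact B a b \<or> contact B a c"

locale NCA = contact_algebra +
  assumes C5: "\<lbrakk>a \<in> carrier B; b \<in> carrier B; \<not> contact B a b\<rbrakk> \<Longrightarrow>
      \<exists>c\<in>carrier B. \<not> contact B a c \<and> \<not> contact B b (compl B c)"
    and C6: "\<lbrakk>a \<in> carrier B; a \<noteq> \<top>\<rbrakk> \<Longrightarrow> \<exists>b\<in>carrier B. b \<noteq> \<bottom> \<and> \<not> contact B b a"

locale CNCA = NCA B + complete_lattice B for B (structure)

record 'a local_contact_alg = "'a contact_alg" +
  bounded_elems :: "'a set"

locale LCA = contact_algebra B for B :: "('a, 'm) local_contact_alg_scheme" (structure) +
  assumes ideal: "bool_ideal B (bounded_elems B)"
    and BC1: "\<lbrakk>a \<in> bounded_elems B; c \<in> carrier B; a \<lless> c\<rbrakk> \<Longrightarrow>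
      \<exists>b\<in>bounded_elems B. a \<lless> b \<and> b \<lless> c"
    and BC2: "\<lbrakk>a \<in> carrier B; b \<in> carrier B; contact B a b\<rbrakk> \<Longrightarrow>
      \<exists>c\<in>bounded_elems B. contact B a (c \<sqinter> b)"
    and BC3: "\<lbrakk>a \<in> carrier B; a \<noteq> \<bottom>\<rbrakk> \<Longrightarrow> \<exists>b\<in>bounded_elems B. b \<noteq> \<bottom> \<and> b \<lless> a"

locale CLCA = LCA B + complete_lattice B for B (structure)

definition alexandroff_ext :: "('a, 'm) local_contact_alg_scheme \<Rightarrow> 'a contact_alg" where
  "alexandroff_ext B = \<lparr>carrier = carrier B, eq = eq B, le = le B,
     contact = (\<lambda>a b. contact B a b \<or> (a \<notin> bounded_elems B \<and> b \<notin> bounded_elems B))\<rparr>"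

definition CA_isomorphic ::
  "('a, 'm) contact_alg_scheme \<Rightarrow> ('b, 'n) contact_alg_scheme \<Rightarrow> bool" where
  "CA_isomorphic A B \<longleftrightarrow> (\<exists>f\<in>bool_iso A B.
     \<forall>a\<in>carrier A. \<forall>b\<in>carrier A. contact A a b \<longleftrightarrow> contact B (f a) (f b))"

text \<open>The operations of the Boolean algebra of regular closed sets are determined by inclusion:
  see \<open>RC_join\<close>, \<open>RC_meet\<close> and \<open>RC_compl\<close> below.\<close>

definition RC :: "'a topology \<Rightarrow> 'a set contact_alg" where
  "RC X = \<lparr>carrier = {F. F \<subseteq> topspace X \<and> F = X closure_of (X interior_of F)},
     eq = (=), le = (\<subseteq>), contact = (\<lambda>F G. F \<inter> G \<noteq> {})\<rparr>"


section \<open>The category DHC\<close>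

text \<open>Morphisms are extensional functions, so that equality of morphisms is equality on the carrier.\<close>

definition DHC_hom :: "'a contact_alg \<Rightarrow> 'b contact_alg \<Rightarrow> ('a \<Rightarrow> 'b) set" where
  "DHC_hom A B = {\<phi> \<in> carrier A \<rightarrow>\<^sub>E carrier B.
     \<phi> \<bottom>\<^bsub>A\<^esub> = \<bottom>\<^bsub>B\<^esub> \<and>
     (\<forall>a\<in>carrier A. \<forall>b\<in>carrier A. \<phi> (a \<sqinter>\<^bsub>A\<^esub> b) = \<phi> a \<sqinter>\<^bsub>B\<^esub> \<phi> b) \<and>
     (\<forall>a\<in>carrier A. \<forall>b\<in>carrier A. a \<lless>\<^bsub>A\<^esub> b \<longrightarrow> compl B (\<phi> (compl A a)) \<lless>\<^bsub>B\<^esub> \<phi> b) \<and>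
     (\<forall>a\<in>carrier A. \<phi> a = \<Squnion>\<^bsub>B\<^esub> {\<phi> b |b. b \<in> carrier A \<and> b \<lless>\<^bsub>A\<^esub> a})}"

definition DHC_check :: "'a contact_alg \<Rightarrow> 'b contact_alg \<Rightarrow> ('a \<Rightarrow> 'b) \<Rightarrow> 'a \<Rightarrow> 'b" where
  "DHC_check A B \<psi> = (\<lambda>a\<in>carrier A. \<Squnion>\<^bsub>B\<^esub> {\<psi> b |b. b \<in> carrier A \<and> b \<lless>\<^bsub>A\<^esub> a})"

definition DHC_comp :: "'a contact_alg \<Rightarrow> 'c contact_alg \<Rightarrow> ('b \<Rightarrow> 'c) \<Rightarrow> ('a \<Rightarrow> 'b) \<Rightarrow> 'a \<Rightarrow> 'c" where
  "DHC_comp A D \<phi>2 \<phi>1 = DHC_check A D (\<phi>2 \<circ> \<phi>1)"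

text \<open>\<open>S\<close> with the injections \<open>\<iota> i\<close> is a coproduct of the family \<open>(K i)\<^sub>i\<close>, where the test objects
  range over all CNCAs on subsets of the type \<open>'t\<close>.\<close>

definition DHC_sum ::
  "'t itself \<Rightarrow> 'i set \<Rightarrow> ('i \<Rightarrow> 'a contact_alg) \<Rightarrow> 's contact_alg \<Rightarrow> ('i \<Rightarrow> 'a \<Rightarrow> 's) \<Rightarrow> bool" where
  "DHC_sum _ I K S \<iota> \<longleftrightarrow>
     CNCA S \<and> (\<forall>i\<in>I. CNCA (K i) \<and> \<iota> i \<in> DHC_hom (K i) S) \<and>
     (\<forall>(D :: 't contact_alg) f. CNCA D \<and> (\<forall>i\<in>I. f i \<in> DHC_hom (K i) D) \<longrightarrow>
        (\<exists>!h. h \<in> DHC_hom S D \<and> (\<forall>i\<in>I. DHC_comp (K i) D h (\<iota> i) = f i)))"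


section \<open>The local contact algebra on the completed free product\<close>

definition Z0 :: "int set" where
  "Z0 = UNIV - {0}"

definition pr :: "int \<Rightarrow> int" where
  "pr p = (if p = 1 then -1 else p - 1)"

definition nx :: "int \<Rightarrow> int" where
  "nx p = (if p = -1 then 1 else p + 1)"

definition succ_set :: "int \<Rightarrow> int set" where
  "succ_set p = {q \<in> Z0. q > p}"

definition pred_set :: "int \<Rightarrow> int set" where
  "pred_set p = {q \<in> Z0. q < p}"

text \<open>A finite sequence \<open>n\<^sub>1, \<dots>, n\<^sub>k\<close> is given by \<open>k\<close> and a function \<open>n\<close> of which only the values on
  \<open>{1..k}\<close> matter.  Throughout, \<open>At\<close> is the completion and \<open>\<phi>\<close> the family of canonical
  monomorphisms \<open>\<phi> i\<close>, \<open>i \<ge> 1\<close>.\<close>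

definition is_seq :: "nat \<Rightarrow> (nat \<Rightarrow> int) \<Rightarrow> bool" where
  "is_seq k n \<longleftrightarrow> 1 \<le> k \<and> (\<forall>i\<in>{1..k}. n i \<in> Z0)"

definition b_elem :: "'a gorder \<Rightarrow> (nat \<Rightarrow> int set \<Rightarrow> 'a) \<Rightarrow> nat \<Rightarrow> (nat \<Rightarrow> int) \<Rightarrow> 'a" where
  "b_elem At \<phi> k n = \<Sqinter>\<^bsub>At\<^esub> {\<phi> i {n i} |i. i \<in> {1..k}}"

definition q_elem :: "'a gorder \<Rightarrow> (nat \<Rightarrow> int set \<Rightarrow> 'a) \<Rightarrow> nat \<Rightarrow> (nat \<Rightarrow> int) \<Rightarrow> int \<Rightarrow> 'a" where
  "q_elem At \<phi> k n r =
     (b_elem At \<phi> k (n(k := pr (n k))) \<sqinter>\<^bsub>At\<^esub> \<phi> (k + 1) (succ_set r)) \<squnion>\<^bsub>At\<^esub>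
     (b_elem At \<phi> k n \<sqinter>\<^bsub>At\<^esub> \<phi> (k + 1) (pred_set (- r)))"

definition B0 :: "'a gorder \<Rightarrow> (nat \<Rightarrow> int set \<Rightarrow> 'a) \<Rightarrow> 'a set" where
  "B0 At \<phi> = {b_elem At \<phi> k n |k n. is_seq k n}"

definition B1 :: "'a gorder \<Rightarrow> (nat \<Rightarrow> int set \<Rightarrow> 'a) \<Rightarrow> 'a set" where
  "B1 At \<phi> = {q_elem At \<phi> k n r |k n r. is_seq k n \<and> 0 < r}"

definition Bt :: "'a gorder \<Rightarrow> (nat \<Rightarrow> int set \<Rightarrow> 'a) \<Rightarrow> 'a set" where
  "Bt At \<phi> = ideal_gen At (B0 At \<phi> \<union> B1 At \<phi>)"

text \<open>Contact between generators.  Every element of \<open>B0 \<union> B1\<close> comes from exactly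
  one \<open>(k, n\<^sub>1, \<dots>, n\<^sub>k)\<close> resp. \<open>(k, n\<^sub>1, \<dots>, n\<^sub>k, r)\<close>, so the rules amount to equivalences.\<close>

inductive sigma_gen :: "'a gorder \<Rightarrow> (nat \<Rightarrow> int set \<Rightarrow> 'a) \<Rightarrow> 'a \<Rightarrow> 'a \<Rightarrow> bool"
  for At :: "'a gorder" and \<phi> :: "nat \<Rightarrow> int set \<Rightarrow> 'a" where
  sym: "sigma_gen At \<phi> x y \<Longrightarrow> sigma_gen At \<phi> y x"
| bb: "\<lbrakk>is_seq k n; is_seq l n'; k \<le> l; \<forall>i\<in>{1..<k}. n i = n' i;
    k = l \<longrightarrow> n' k \<in> {pr (n k), n k, nx (n k)};
    k < l \<longrightarrow> n' k = n k\<rbrakk>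
    \<Longrightarrow> sigma_gen At \<phi> (b_elem At \<phi> k n) (b_elem At \<phi> l n')"
| qq: "\<lbrakk>is_seq k n; is_seq l n'; 0 < r; 0 < r'; k \<le> l; \<forall>i\<in>{1..<k}. n i = n' i;
    l = k \<longrightarrow> n' k = n k;
    l = k + 1 \<longrightarrow> (n' k = n k \<and> n' (k + 1) \<le> - r) \<or> (n' k = pr (n k) \<and> n' (k + 1) > r);
    l > k + 1 \<longrightarrow> (n' k = n k \<and> n' (k + 1) < - r) \<or> (n' k = pr (n k) \<and> n' (k + 1) > r)\<rbrakk>
    \<Longrightarrow> sigma_gen At \<phi> (q_elem At \<phi> k n r) (q_elem At \<phi> l n' r')"
| qb_gt: "\<lbrakk>is_seq k n; is_seq l n'; 0 < r; k > l; \<forall>i\<in>{1..l}. n i = n' i\<rbrakk>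
    \<Longrightarrow> sigma_gen At \<phi> (q_elem At \<phi> k n r) (b_elem At \<phi> l n')"
| qb_le: "\<lbrakk>is_seq k n; is_seq l n'; 0 < r; k \<le> l; \<forall>i\<in>{1..<k}. n i = n' i;
    l = k \<longrightarrow> n' k \<in> {pr (n k), n k};
    l = k + 1 \<longrightarrow> (n' (k + 1) \<ge> r \<and> n' k = pr (n k)) \<or> (n' (k + 1) \<le> - r \<and> n' k = n k);
    l > k + 1 \<longrightarrow> (n' (k + 1) > r \<and> n' k = pr (n k)) \<or> (n' (k + 1) < - r \<and> n' k = n k)\<rbrakk>
    \<Longrightarrow> sigma_gen At \<phi> (q_elem At \<phi> k n r) (b_elem At \<phi> l n')"

text \<open>Contact between bounded elements; \<open>F\<close> and \<open>G\<close> are the sets of the \<open>c\<^sub>i\<close> and of the \<open>d\<^sub>j\<close>.\<close>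

definition sigma_bounded :: "'a gorder \<Rightarrow> (nat \<Rightarrow> int set \<Rightarrow> 'a) \<Rightarrow> 'a \<Rightarrow> 'a \<Rightarrow> bool" where
  "sigma_bounded At \<phi> c d \<longleftrightarrow> \<not> (\<exists>F G. finite F \<and> F \<noteq> {} \<and> F \<subseteq> B0 At \<phi> \<union> B1 At \<phi> \<and>
     finite G \<and> G \<noteq> {} \<and> G \<subseteq> B0 At \<phi> \<union> B1 At \<phi> \<and>
     c \<sqsubseteq>\<^bsub>At\<^esub> \<Squnion>\<^bsub>At\<^esub> F \<and> d \<sqsubseteq>\<^bsub>At\<^esub> \<Squnion>\<^bsub>At\<^esub> G \<and> (\<forall>x\<in>F. \<forall>y\<in>G. \<not> sigma_gen At \<phi> x y))"

definition sigma :: "'a gorder \<Rightarrow> (nat \<Rightarrow> int set \<Rightarrow> 'a) \<Rightarrow> 'a \<Rightarrow> 'a \<Rightarrow> bool" where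
  "sigma At \<phi> a b \<longleftrightarrow> (\<exists>c\<in>Bt At \<phi>. \<exists>d\<in>Bt At \<phi>.
     c \<sqsubseteq>\<^bsub>At\<^esub> a \<and> d \<sqsubseteq>\<^bsub>At\<^esub> b \<and> sigma_bounded At \<phi> c d)"

definition tilde_LCA :: "'a gorder \<Rightarrow> (nat \<Rightarrow> int set \<Rightarrow> 'a) \<Rightarrow> 'a local_contact_alg" where
  "tilde_LCA At \<phi> = \<lparr>carrier = carrier At, eq = eq At, le = le At,
     contact = sigma At \<phi>, bounded_elems = Bt At \<phi>\<rparr>"

text \<open>The power \<open>(S\<^sup>1)\<^sup>\<tau>\<close>, for \<open>\<tau>\<close> the cardinality of \<open>I\<close>.\<close>

definition torus :: "'i set \<Rightarrow> ('i \<Rightarrow> complex) topology" where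
  "torus I = product_topology (\<lambda>_. top_of_set (sphere 0 1)) I"


section \<open>The Boolean operations on regular closed sets\<close>

lemma RC_iff: "F \<in> carrier (RC X) \<longleftrightarrow> F \<subseteq> topspace X \<and> F = X closure_of (X interior_of F)"
  by (simp add: RC_def)

lemma RC_le: "F \<sqsubseteq>\<^bsub>RC X\<^esub> G \<longleftrightarrow> F \<subseteq> G"
  by (simp add: RC_def)

lemma RC_partial_order: "partial_order (RC X)"
  by unfold_locales (auto simp: RC_def)

lemma RC_closedin: "F \<in> carrier (RC X) \<Longrightarrow> closedin X F"
  unfolding RC_iff by (metis closedin_closure_of)

lemma RC_closure_open: "openin X U \<Longrightarrow> X closure_of U \<in> carrier (RC X)"
  unfolding RC_iff
  by (metis closure_of_mono closure_of_subset_topspace closure_of_closure_of interior_of_maximal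
      closure_of_subset interior_of_subset openin_subset subset_antisym)

lemma RC_Un:
  assumes "F \<in> carrier (RC X)" "G \<in> carrier (RC X)"
  shows "F \<union> G \<in> carrier (RC X)"
proof -
  have "F \<union> G = X closure_of (X interior_of F \<union> X interior_of G)"
    using assms unfolding RC_iff by (metis closure_of_Un)
  then show ?thesis
    using RC_closure_open[of X "X interior_of F \<union> X interior_of G"] by (simp add: openin_Un)
qed

lemma RC_subset_iff:
  assumes "F \<in> carrier (RC X)" "closedin X C"
  shows "F \<subseteq> C \<longleftrightarrow> X interior_of F \<subseteq> C"
  using assms unfolding RC_iff by (metis closure_of_minimal interior_of_subset subset_trans)

lemma RC_join:
  assumes F: "F \<in> carrier (RC X)" and G: "G \<in> carrier (RC X)"
  shows "F \<squnion>\<^bsub>RC X\<^esub> G = F \<union> G"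
proof -
  interpret partial_order "RC X" by (rule RC_partial_order)
  have l: "least (RC X) (F \<union> G) (Upper (RC X) {F, G})"
    using RC_Un[OF F G] F G by (auto simp: least_def Upper_def RC_le)
  then show ?thesis
    unfolding join_def sup_def by (meson least_unique someI)
qed

lemma RC_meet:
  assumes F: "F \<in> carrier (RC X)" and G: "G \<in> carrier (RC X)"
  shows "F \<sqinter>\<^bsub>RC X\<^esub> G = X closure_of (X interior_of (F \<inter> G))"
proof -
  interpret partial_order "RC X" by (rule RC_partial_order)
  let ?M = "X closure_of (X interior_of (F \<inter> G))"
  have M: "?M \<in> carrier (RC X)" by (simp add: RC_closure_open)
  have sub: "?M \<subseteq> F" "?M \<subseteq> G"
    using F G by (meson RC_closedin closure_of_minimal interior_of_subset le_infE)+
  have "H \<subseteq> ?M" if "H \<in> carrier (RC X)" "H \<subseteq> F" "H \<subseteq> G" for H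
    using that unfolding RC_iff by (metis closure_of_mono interior_of_mono le_inf_iff)
  then have l: "greatest (RC X) ?M (Lower (RC X) {F, G})"
    using M F G sub by (auto simp: greatest_def Lower_def RC_le)
  then show ?thesis
    unfolding meet_def inf_def by (meson greatest_unique someI)
qed

lemma RC_bottom: "\<bottom>\<^bsub>RC X\<^esub> = {}"
proof -
  interpret partial_order "RC X" by (rule RC_partial_order)
  have "least (RC X) {} (carrier (RC X))"
    by (auto simp: least_def RC_iff RC_le)
  then show ?thesis unfolding bottom_def by (meson least_unique someI)
qed

lemma RC_top: "\<top>\<^bsub>RC X\<^esub> = topspace X"
proof -
  interpret partial_order "RC X" by (rule RC_partial_order)
  have "greatest (RC X) (topspace X) (carrier (RC X))"
    by (auto simp: greatest_def RC_iff RC_le)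
  then show ?thesis unfolding top_def by (meson greatest_unique someI)
qed

lemma RC_compl:
  assumes F: "F \<in> carrier (RC X)"
  shows "compl (RC X) F = X closure_of (topspace X - F)"
  unfolding compl_def
proof (rule the_equality)
  let ?K = "X closure_of (topspace X - F)"
  have K: "?K \<in> carrier (RC X)"
    using F by (simp add: RC_closure_open RC_closedin openin_diff)
  have int: "X interior_of F = topspace X - ?K"
    by (simp add: interior_of_closure_of)
  have "X interior_of (F \<inter> ?K) = {}"
    using int interior_of_subset[of X ?K] by (auto simp: interior_of_Int)
  moreover have "F \<union> ?K = topspace X"
    using F closure_of_subset[of "topspace X - F" X] closure_of_subset_topspace[of X "topspace X - F"]
    by (auto simp: RC_iff)
  ultimately show "?K \<in> carrier (RC X) \<and> F \<sqinter>\<^bsub>RC X\<^esub> ?K = \<bottom>\<^bsub>RC X\<^esub> \<and> F \<squnion>\<^bsub>RC X\<^esub> ?K = \<top>\<^bsub>RC X\<^esub>"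
    using F K by (simp add: RC_meet RC_join RC_bottom RC_top)
next
  fix b
  assume "b \<in> carrier (RC X) \<and> F \<sqinter>\<^bsub>RC X\<^esub> b = \<bottom>\<^bsub>RC X\<^esub> \<and> F \<squnion>\<^bsub>RC X\<^esub> b = \<top>\<^bsub>RC X\<^esub>"
  then have b: "b \<in> carrier (RC X)" and m: "X closure_of (X interior_of (F \<inter> b)) = {}"
    and j: "F \<union> b = topspace X"
    using F by (auto simp: RC_meet RC_join RC_bottom RC_top)
  have "X interior_of (F \<inter> b) = {}"
    using m by (metis closure_of_eq_empty interior_of_subset_topspace)
  then have "X interior_of b \<inter> X interior_of F = {}"
    by (auto simp: interior_of_Int)
  then have "X interior_of b \<inter> X closure_of (X interior_of F) = {}"
    by (simp add: openin_Int_closure_of_eq_empty)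
  then have "X interior_of b \<subseteq> topspace X - F"
    using F interior_of_subset_topspace[of X b] unfolding RC_iff by blast
  then have "b \<subseteq> X closure_of (topspace X - F)"
    using b unfolding RC_iff by (metis closure_of_mono)
  moreover have "X closure_of (topspace X - F) \<subseteq> b"
    using j b by (intro closure_of_minimal RC_closedin) auto
  ultimately show "b = X closure_of (topspace X - F)" by blast
qed

end

theory Submission
  imports Defs
begin

text \<open>A CNCA is realized by a compact Hausdorff space \<open>X\<close> when it is CA-isomorphic to
  \<open>RC X\<close>; every CNCA is realized by its maximal round filters, and DHC-morphisms correspond
  contravariantly to continuous maps between realizing spaces.  Hence a DHC-sum of copies of an
  algebra realized by \<open>X\<close> is realized by the power of \<open>X\<close>.  That the Alexandroff extension of the
  given local contact algebra is realized by the circle comes from cutting the open unit interval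
  (the circle without the point 1) into pieces indexed by \<open>Z0\<close> in their order type, each piece
  again in the same way, and so on: the \<open>B0\<close> elements and the pieces are dense families with the
  same compatibility relation, and the rules for \<open>\<sigma>\<close> say when the closed intervals meet.\<close>

section \<open>Boolean algebras\<close>

text \<open>The Boolean algebra alone sees only a tree: a complete Boolean algebra is determined by
  a dense family and its incompatibility relation, so the \<open>B0\<close> elements already yield
  \<open>RC circ\<close>. What the pieces miss is small neighbourhoods of a cut point, which is
  interior only to pieces of smaller level. The elements \<open>q_elem\<close> repair this:
  subpieces accumulate exactly at the two ends of their piece, so the subpieces with index above
  \<open>r\<close> to the left of a cut point and below \<open>- r\<close> to its right make up a
  neighbourhood. The two ends of the unit interval get no such neighbourhood; they are glued to one
  point, the infinity of the local contact algebra. Compactness then lets finitely many generators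
  decide boundedness and contact of all elements.

  A second obstacle is that a universal property can be tested only on algebras over one type at a
  time. Hence a realizing space is built from sets of elements of the algebra itself, and uniqueness
  of the sum uses only targets that exist on the test type.\<close>

definition ultrafilters :: "('a, 'm) gorder_scheme \<Rightarrow> 'a set set" where
  "ultrafilters B = {u. u \<subseteq> carrier B \<and> \<top>\<^bsub>B\<^esub> \<in> u \<and> \<bottom>\<^bsub>B\<^esub> \<notin> u \<and>
     (\<forall>x\<in>carrier B. compl B x \<in> u \<longleftrightarrow> x \<notin> u) \<and>
     (\<forall>x\<in>carrier B. \<forall>y\<in>carrier B. (x \<sqinter>\<^bsub>B\<^esub> y \<in> u \<longleftrightarrow> x \<in> u \<and> y \<in> u) \<and>
                                     (x \<squnion>\<^bsub>B\<^esub> y \<in> u \<longleftrightarrow> x \<in> u \<or> y \<in> u))}"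

text \<open>Membership in an ultrafilter turns every operation into a connective. With
  \<open>le_iff_ultra\<close> and \<open>eq_iff_ultra\<close>, Boolean identities and inequalities
  reduce to propositional logic.\<close>

lemma ultra_simps:
  assumes "u \<in> ultrafilters B"
  shows "\<top>\<^bsub>B\<^esub> \<in> u" "\<bottom>\<^bsub>B\<^esub> \<notin> u"
    "x \<in> carrier B \<Longrightarrow> compl B x \<in> u \<longleftrightarrow> x \<notin> u"
    "x \<in> carrier B \<Longrightarrow> y \<in> carrier B \<Longrightarrow> x \<sqinter>\<^bsub>B\<^esub> y \<in> u \<longleftrightarrow> x \<in> u \<and> y \<in> u"
    "x \<in> carrier B \<Longrightarrow> y \<in> carrier B \<Longrightarrow> x \<squnion>\<^bsub>B\<^esub> y \<in> u \<longleftrightarrow> x \<in> u \<or> y \<in> u"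
  using assms by (simp_all add: ultrafilters_def)

context boolean_alg
begin

lemma bottom_join_eq: "x \<in> carrier B \<Longrightarrow> \<bottom> \<squnion> x = x"
  using bottom_join eq_is_equal by simp

lemma top_meet_eq: "x \<in> carrier B \<Longrightarrow> \<top> \<sqinter> x = x"
  using top_meet eq_is_equal by simp

lemma compl_unique:
  assumes "a \<in> carrier B" "b \<in> carrier B" "c \<in> carrier B"
    "a \<sqinter> b = \<bottom>" "a \<squnion> b = \<top>" "a \<sqinter> c = \<bottom>" "a \<squnion> c = \<top>"
  shows "b = c"
proof -
  have "x = x \<sqinter> y" if "x \<in> carrier B" "y \<in> carrier B" "a \<sqinter> x = \<bottom>" "a \<squnion> y = \<top>" for x y
  proof -
    have "x = x \<sqinter> (a \<squnion> y)" using that top_meet_eq by (metis meet_comm)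
    also have "\<dots> = (x \<sqinter> a) \<squnion> (x \<sqinter> y)" using that assms distrib by blast
    also have "\<dots> = x \<sqinter> y" using that meet_comm[of B x a] by (simp add: bottom_join_eq)
    finally show ?thesis .
  qed
  then show ?thesis using assms meet_comm[of B b c] by metis
qed

lemma compl_is:
  assumes "a \<in> carrier B"
  shows "compl B a \<in> carrier B \<and> a \<sqinter> compl B a = \<bottom> \<and> a \<squnion> compl B a = \<top>"
  unfolding compl_def
proof (rule theI')
  show "\<exists>!b. b \<in> carrier B \<and> a \<sqinter> b = \<bottom> \<and> a \<squnion> b = \<top>"
    using compl_exists[OF assms] compl_unique[OF assms] by blast
qed

lemma compl_closed [simp]: "a \<in> carrier B \<Longrightarrow> compl B a \<in> carrier B"
  and meet_compl: "a \<in> carrier B \<Longrightarrow> a \<sqinter> compl B a = \<bottom>"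
  and join_compl: "a \<in> carrier B \<Longrightarrow> a \<squnion> compl B a = \<top>"
  using compl_is by blast+

text \<open>An ideal maximal among those that contain \<open>J\<close> and avoid \<open>a\<close> is
  prime, and the complement of a prime ideal is an ultrafilter.\<close>

lemma prime_ideal:
  assumes J: "bool_ideal B J" and a: "a \<in> carrier B" "a \<notin> J"
  shows "\<exists>u\<in>ultrafilters B. a \<in> u \<and> u \<inter> J = {}"
proof -
  define S where "S = {K. bool_ideal B K \<and> J \<subseteq> K \<and> a \<notin> K}"
  have "\<exists>M\<in>S. \<forall>X\<in>S. M \<subseteq> X \<longrightarrow> X = M"
  proof (rule subset_Zorn_nonempty)
    show "S \<noteq> {}" using assms by (auto simp: S_def)
  next
    fix C assume C: "C \<noteq> {}" "subset.chain S C"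
    then have CS: "\<And>K. K \<in> C \<Longrightarrow> bool_ideal B K \<and> J \<subseteq> K \<and> a \<notin> K"
      by (auto simp: S_def subset_chain_def)
    have "x \<squnion> y \<in> \<Union>C" if xy: "x \<in> \<Union>C" "y \<in> \<Union>C" for x y
    proof -
      obtain K L where "K \<in> C" "x \<in> K" "L \<in> C" "y \<in> L" using xy by blast
      moreover have "K \<subseteq> L \<or> L \<subseteq> K" using C calculation by (auto simp: subset_chain_def)
      ultimately show ?thesis using CS unfolding bool_ideal_def by blast
    qed
    moreover have "\<bottom> \<in> \<Union>C" using C CS by (auto simp: bool_ideal_def)
    moreover have "\<forall>x\<in>\<Union>C. \<forall>y\<in>carrier B. y \<sqsubseteq> x \<longrightarrow> y \<in> \<Union>C"
      using CS unfolding bool_ideal_def by blast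
    moreover have "\<Union>C \<subseteq> carrier B" using CS unfolding bool_ideal_def by blast
    ultimately have "bool_ideal B (\<Union>C)" unfolding bool_ideal_def by blast
    moreover have "J \<subseteq> \<Union>C" using C CS by blast
    moreover have "a \<notin> \<Union>C" using CS by blast
    ultimately show "\<Union>C \<in> S" by (simp add: S_def)
  qed
  then obtain M where MS: "M \<in> S" and max: "\<And>X. X \<in> S \<Longrightarrow> M \<subseteq> X \<Longrightarrow> X = M" by blast
  have M: "M \<subseteq> carrier B" "\<bottom> \<in> M" "\<And>x y. x \<in> M \<Longrightarrow> y \<in> M \<Longrightarrow> x \<squnion> y \<in> M"
    "\<And>x y. x \<in> M \<Longrightarrow> y \<in> carrier B \<Longrightarrow> y \<sqsubseteq> x \<Longrightarrow> y \<in> M" "J \<subseteq> M" "a \<notin> M"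
    using MS unfolding S_def bool_ideal_def by blast+
  note [simp] = join_left join_right meet_left meet_right
  \<comment> \<open>Otherwise the ideal generated by \<open>M\<close> and \<open>x\<close> would
    still avoid \<open>a\<close>, against maximality.\<close>
  have ext: "\<exists>m\<in>M. a \<sqsubseteq> m \<squnion> x" if x: "x \<in> carrier B" "x \<notin> M" for x
  proof (rule ccontr)
    assume no: "\<not> ?thesis"
    define K where "K = {z \<in> carrier B. \<exists>m\<in>M. z \<sqsubseteq> m \<squnion> x}"
    have "bool_ideal B K" unfolding bool_ideal_def
    proof (intro conjI ballI impI)
      show "K \<subseteq> carrier B" by (auto simp: K_def)
      show "\<bottom> \<in> K" using M(2) x unfolding K_def by (metis (mono_tags, lifting) bottom_closed bottom_lower join_closed mem_Collect_eq)
      fix y z assume "y \<in> K" "z \<in> K"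
      then obtain m m' where m: "m \<in> M" "m' \<in> M" "y \<sqsubseteq> m \<squnion> x" "z \<sqsubseteq> m' \<squnion> x"
        and yz: "y \<in> carrier B" "z \<in> carrier B" by (auto simp: K_def)
      have mc: "m \<in> carrier B" "m' \<in> carrier B" using m M by auto
      have "m \<squnion> x \<sqsubseteq> (m \<squnion> m') \<squnion> x" "m' \<squnion> x \<sqsubseteq> (m \<squnion> m') \<squnion> x"
        by (meson join_closed join_le join_left join_right le_trans mc x)+
      then have "y \<squnion> z \<sqsubseteq> (m \<squnion> m') \<squnion> x"
        by (meson join_closed join_le le_trans mc x m yz)
      then show "y \<squnion> z \<in> K" using m M yz by (auto simp: K_def)
    next
      fix y z assume yz: "y \<in> K" "z \<in> carrier B" "z \<sqsubseteq> y"
      then obtain m where "m \<in> M" "y \<sqsubseteq> m \<squnion> x" "y \<in> carrier B" by (auto simp: K_def)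
      moreover have "m \<in> carrier B" using calculation M by auto
      ultimately have "z \<sqsubseteq> m \<squnion> x" using yz x le_trans[of z y "m \<squnion> x"] by simp
      then show "z \<in> K" using \<open>m \<in> M\<close> yz by (auto simp: K_def)
    qed
    moreover have "M \<subseteq> K"
      using M(1) x join_left unfolding K_def by blast
    moreover have "a \<notin> K" using no by (auto simp: K_def)
    ultimately have "K = M" using M by (intro max) (auto simp: S_def)
    moreover have "x \<in> K" using M(1,2) x join_right[of \<bottom> x] unfolding K_def by blast
    ultimately show False using x by simp
  qed
  \<comment> \<open>By distributivity, an \<open>a\<close> below both \<open>n \<squnion> x\<close>
    and \<open>n \<squnion> y\<close> is below \<open>n \<squnion> (x \<sqinter> y)\<close>, which
    would belong to \<open>M\<close>.\<close>
  have prime: "x \<sqinter> y \<notin> M" if x: "x \<in> carrier B" "x \<notin> M" and y: "y \<in> carrier B" "y \<notin> M" for x y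
  proof
    assume xy: "x \<sqinter> y \<in> M"
    obtain m m' where m: "m \<in> M" "m' \<in> M" "a \<sqsubseteq> m \<squnion> x" "a \<sqsubseteq> m' \<squnion> y"
      using ext x y by meson
    define n where "n = m \<squnion> m'"
    have mc: "m \<in> carrier B" "m' \<in> carrier B" using m M by auto
    then have n: "n \<in> M" "n \<in> carrier B" using m M by (auto simp: n_def)
    have "m \<squnion> x \<sqsubseteq> n \<squnion> x" "m' \<squnion> y \<sqsubseteq> n \<squnion> y"
      unfolding n_def by (meson join_closed join_le join_left join_right le_trans mc x y)+
    then have ax: "a \<sqsubseteq> n \<squnion> x" and ay: "a \<sqsubseteq> n \<squnion> y"
      by (meson join_closed le_trans mc x y m n a)+
    have "a = a \<sqinter> (n \<squnion> x)" using ax le_iff_join a n x by simp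
    also have "\<dots> = (a \<sqinter> n) \<squnion> (a \<sqinter> x)" using distrib a n x by blast
    finally have a1: "a = (a \<sqinter> n) \<squnion> (a \<sqinter> x)" .
    have "a \<sqinter> x \<sqsubseteq> x \<sqinter> (n \<squnion> y)"
      by (meson ay a(1) join_closed le_trans meet_closed meet_le meet_left meet_right n(2) x(1) y(1))
    also have e: "x \<sqinter> (n \<squnion> y) = (x \<sqinter> n) \<squnion> (x \<sqinter> y)" using distrib n x y by blast
    finally have a2: "a \<sqinter> x \<sqsubseteq> (x \<sqinter> n) \<squnion> (x \<sqinter> y)" .
    have "x \<sqinter> n \<in> M" "a \<sqinter> n \<in> M" using M(4)[OF n(1)] n x a by simp_all
    then have "(x \<sqinter> n) \<squnion> (x \<sqinter> y) \<in> M" using xy M by blast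
    then have "a \<sqinter> x \<in> M" using a2 M(4) a x by simp
    then have "a \<in> M" using a1 \<open>a \<sqinter> n \<in> M\<close> M(3) by metis
    then show False using M by blast
  qed
  define u where "u = carrier B - M"
  have topM: "\<top> \<notin> M" using M a top_higher by blast
  have cm: "compl B x \<in> M \<longleftrightarrow> x \<notin> M" if "x \<in> carrier B" for x
    using that M(2) prime[of x "compl B x"] topM M(3)[of x "compl B x"]
    by (auto simp: meet_compl join_compl)
  have "u \<in> ultrafilters B"
    unfolding ultrafilters_def u_def mem_Collect_eq
  proof (intro conjI ballI)
    fix x y assume xy: "x \<in> carrier B" "y \<in> carrier B"
    show "(x \<sqinter> y \<in> carrier B - M) = (x \<in> carrier B - M \<and> y \<in> carrier B - M)"
      using xy prime M(4)[of x "x \<sqinter> y"] M(4)[of y "x \<sqinter> y"] by auto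
    show "(x \<squnion> y \<in> carrier B - M) = (x \<in> carrier B - M \<or> y \<in> carrier B - M)"
      using xy M(3)[of x y] M(4)[of "x \<squnion> y" x] M(4)[of "x \<squnion> y" y] by auto
  qed (use M(1,2) topM cm in auto)
  then show ?thesis using a M(5,6) by (auto simp: u_def)
qed

text \<open>For the converse, the ideal of elements below \<open>y\<close> does not contain
  \<open>x\<close>, and \<open>prime_ideal\<close> yields a separating ultrafilter.\<close>

lemma le_iff_ultra:
  assumes "x \<in> carrier B" "y \<in> carrier B"
  shows "x \<sqsubseteq> y \<longleftrightarrow> (\<forall>u\<in>ultrafilters B. x \<in> u \<longrightarrow> y \<in> u)"
proof
  assume "x \<sqsubseteq> y"
  then have "x = x \<sqinter> y" using assms le_iff_join by blast
  then show "\<forall>u\<in>ultrafilters B. x \<in> u \<longrightarrow> y \<in> u"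
    using assms ultra_simps(4) by metis
next
  assume r: "\<forall>u\<in>ultrafilters B. x \<in> u \<longrightarrow> y \<in> u"
  show "x \<sqsubseteq> y"
  proof (rule ccontr)
    assume n: "\<not> x \<sqsubseteq> y"
    have "bool_ideal B {z \<in> carrier B. z \<sqsubseteq> y}"
      unfolding bool_ideal_def using assms join_le le_trans by auto
    from prime_ideal[OF this assms(1)] n assms r show False by auto
  qed
qed

lemma eq_iff_ultra:
  assumes "x \<in> carrier B" "y \<in> carrier B"
  shows "x = y \<longleftrightarrow> (\<forall>u\<in>ultrafilters B. x \<in> u \<longleftrightarrow> y \<in> u)"
  using assms le_iff_ultra[of x y] le_iff_ultra[of y x] le_antisym le_refl by blast

lemma compl_compl [simp]: "x \<in> carrier B \<Longrightarrow> compl B (compl B x) = x"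
  by (simp add: eq_iff_ultra ultra_simps)

lemma compl_le_compl: "\<lbrakk>x \<in> carrier B; y \<in> carrier B\<rbrakk> \<Longrightarrow> compl B x \<sqsubseteq> compl B y \<longleftrightarrow> y \<sqsubseteq> x"
  by (auto simp add: le_iff_ultra ultra_simps)

lemma meet_bot_iff: "\<lbrakk>x \<in> carrier B; y \<in> carrier B\<rbrakk> \<Longrightarrow> x \<sqinter> y = \<bottom> \<longleftrightarrow> x \<sqsubseteq> compl B y"
  by (auto simp add: le_iff_ultra eq_iff_ultra ultra_simps)

lemma le_iff_meet_compl: "\<lbrakk>x \<in> carrier B; y \<in> carrier B\<rbrakk> \<Longrightarrow> x \<sqsubseteq> y \<longleftrightarrow> x \<sqinter> compl B y = \<bottom>"
  by (simp add: meet_bot_iff)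

lemma compl_bottom [simp]: "compl B \<bottom> = \<top>" and compl_top [simp]: "compl B \<top> = \<bottom>"
  by (simp_all add: eq_iff_ultra ultra_simps)

lemma compl_eqI: "\<lbrakk>x \<in> carrier B; y \<in> carrier B; x \<sqinter> y = \<bottom>; x \<squnion> y = \<top>\<rbrakk> \<Longrightarrow> compl B x = y"
  using compl_is compl_unique by blast

end

lemma order_iso_sup:
  assumes "complete_lattice A" "complete_lattice B"
    and bij: "bij_betw f (carrier A) (carrier B)"
    and le: "\<And>x y. x \<in> carrier A \<Longrightarrow> y \<in> carrier A \<Longrightarrow> x \<sqsubseteq>\<^bsub>A\<^esub> y \<longleftrightarrow> f x \<sqsubseteq>\<^bsub>B\<^esub> f y"
    and S: "S \<subseteq> carrier A"
  shows "f (\<Squnion>\<^bsub>A\<^esub> S) = \<Squnion>\<^bsub>B\<^esub> (f ` S)"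
proof -
  interpret A: complete_lattice A by fact
  interpret B: complete_lattice B by fact
  have fc: "f x \<in> carrier B" if "x \<in> carrier A" for x
    using bij that by (auto simp: bij_betw_def)
  have fS: "f ` S \<subseteq> carrier B" using fc S by auto
  obtain b where b: "b \<in> carrier A" "f b = \<Squnion>\<^bsub>B\<^esub> (f ` S)"
    using bij B.sup_closed[OF fS] by (metis bij_betw_imp_surj_on imageE)
  have "b = \<Squnion>\<^bsub>A\<^esub> S"
  proof (rule A.le_antisym)
    show "\<Squnion>\<^bsub>A\<^esub> S \<sqsubseteq>\<^bsub>A\<^esub> b"
      using S b le B.sup_upper[OF fS] by (intro A.sup_least) auto
    have "f b \<sqsubseteq>\<^bsub>B\<^esub> f (\<Squnion>\<^bsub>A\<^esub> S)"
      unfolding b(2)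
    proof (rule B.sup_least[OF fS])
      show "f (\<Squnion>\<^bsub>A\<^esub> S) \<in> carrier B" using fc A.sup_closed[OF S] by blast
      fix y assume "y \<in> f ` S"
      then show "y \<sqsubseteq>\<^bsub>B\<^esub> f (\<Squnion>\<^bsub>A\<^esub> S)"
        using le A.sup_closed[OF S] A.sup_upper[OF S] S by blast
    qed
    then show "b \<sqsubseteq>\<^bsub>A\<^esub> \<Squnion>\<^bsub>A\<^esub> S" using le b S by simp
  qed (use b S in auto)
  then show ?thesis using b by simp
qed

lemma order_iso_bool_iso:
  assumes "boolean_alg A" "boolean_alg B"
    and bij: "bij_betw f (carrier A) (carrier B)"
    and le: "\<And>x y. x \<in> carrier A \<Longrightarrow> y \<in> carrier A \<Longrightarrow> x \<sqsubseteq>\<^bsub>A\<^esub> y \<longleftrightarrow> f x \<sqsubseteq>\<^bsub>B\<^esub> f y"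
  shows "f \<in> bool_iso A B"
proof -
  interpret A: boolean_alg A by fact
  interpret B: boolean_alg B by fact
  have fc [simp]: "f x \<in> carrier B" if "x \<in> carrier A" for x
    using bij that by (auto simp: bij_betw_def)
  have surj: "\<exists>x\<in>carrier A. f x = y" if "y \<in> carrier B" for y
    using bij that by (metis bij_betw_imp_surj_on imageE)
  have bot: "f \<bottom>\<^bsub>A\<^esub> = \<bottom>\<^bsub>B\<^esub>"
    by (rule B.bottom_eq) (use le surj A.bottom_lower in force)+
  have top: "f \<top>\<^bsub>A\<^esub> = \<top>\<^bsub>B\<^esub>"
    by (rule B.top_eq) (use le surj A.top_higher in force)+
  have join: "f (x \<squnion>\<^bsub>A\<^esub> y) = f x \<squnion>\<^bsub>B\<^esub> f y" if xy: "x \<in> carrier A" "y \<in> carrier A" for x y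
  proof -
    obtain z where z: "z \<in> carrier A" "f z = f x \<squnion>\<^bsub>B\<^esub> f y" using surj xy by (meson B.join_closed fc)
    have "x \<sqsubseteq>\<^bsub>A\<^esub> z" "y \<sqsubseteq>\<^bsub>A\<^esub> z" using le xy z B.join_left B.join_right by auto
    then have "x \<squnion>\<^bsub>A\<^esub> y \<sqsubseteq>\<^bsub>A\<^esub> z" using xy z A.join_le by blast
    moreover have "f z \<sqsubseteq>\<^bsub>B\<^esub> f (x \<squnion>\<^bsub>A\<^esub> y)"
      unfolding z(2) using xy le A.join_left A.join_right by (intro B.join_le) (simp_all flip: le)
    ultimately have "z = x \<squnion>\<^bsub>A\<^esub> y" using le xy z by (intro A.le_antisym) auto
    then show ?thesis using z by simp
  qed
  have meet: "f (x \<sqinter>\<^bsub>A\<^esub> y) = f x \<sqinter>\<^bsub>B\<^esub> f y" if xy: "x \<in> carrier A" "y \<in> carrier A" for x y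
  proof -
    obtain z where z: "z \<in> carrier A" "f z = f x \<sqinter>\<^bsub>B\<^esub> f y" using surj xy by (meson B.meet_closed fc)
    have "z \<sqsubseteq>\<^bsub>A\<^esub> x" "z \<sqsubseteq>\<^bsub>A\<^esub> y" using le xy z B.meet_left B.meet_right by auto
    then have "z \<sqsubseteq>\<^bsub>A\<^esub> x \<sqinter>\<^bsub>A\<^esub> y" using xy z A.meet_le by blast
    moreover have "f (x \<sqinter>\<^bsub>A\<^esub> y) \<sqsubseteq>\<^bsub>B\<^esub> f z"
      unfolding z(2) using xy le A.meet_left A.meet_right by (intro B.meet_le) (simp_all flip: le)
    ultimately have "z = x \<sqinter>\<^bsub>A\<^esub> y" using le xy z by (intro A.le_antisym) auto
    then show ?thesis using z by simp
  qed
  have "f (compl A x) = compl B (f x)" if "x \<in> carrier A" for x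
    using that by (intro B.compl_eqI[symmetric])
      (simp_all flip: join meet add: A.meet_compl A.join_compl bot top)
  then show ?thesis
    unfolding bool_iso_def bool_hom_def using bij bot top join meet by auto
qed

lemma bool_iso_le:
  assumes "boolean_alg A" "boolean_alg B" and f: "f \<in> bool_iso A B"
    and xy: "x \<in> carrier A" "y \<in> carrier A"
  shows "x \<sqsubseteq>\<^bsub>A\<^esub> y \<longleftrightarrow> f x \<sqsubseteq>\<^bsub>B\<^esub> f y"
proof -
  interpret A: boolean_alg A by fact
  interpret B: boolean_alg B by fact
  have m: "f (x \<sqinter>\<^bsub>A\<^esub> y) = f x \<sqinter>\<^bsub>B\<^esub> f y" and inj: "inj_on f (carrier A)"
    and c: "f x \<in> carrier B" "f y \<in> carrier B"
    using f xy by (auto simp: bool_iso_def bool_hom_def bij_betw_def)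
  show ?thesis
    using inj_onD[OF inj, of x "x \<sqinter>\<^bsub>A\<^esub> y"] xy c m
    by (auto simp add: A.le_iff_join B.le_iff_join)
qed

section \<open>Regular closed sets\<close>

lemma RC_interior_meet:
  assumes "F \<in> carrier (RC X)" "G \<in> carrier (RC X)"
  shows "X interior_of (F \<sqinter>\<^bsub>RC X\<^esub> G) = X interior_of F \<inter> X interior_of G"
proof
  have "X interior_of (F \<inter> G) \<subseteq> X interior_of (X closure_of (X interior_of (F \<inter> G)))"
    by (meson closure_of_subset interior_of_maximal interior_of_subset_topspace openin_interior_of)
  then show "X interior_of F \<inter> X interior_of G \<subseteq> X interior_of (F \<sqinter>\<^bsub>RC X\<^esub> G)"
    by (simp add: RC_meet assms interior_of_Int)
  have "X closure_of (X interior_of (F \<inter> G)) \<subseteq> F \<inter> G"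
    using assms by (meson RC_closedin closedin_Int closure_of_minimal interior_of_subset)
  then show "X interior_of (F \<sqinter>\<^bsub>RC X\<^esub> G) \<subseteq> X interior_of F \<inter> X interior_of G"
    unfolding RC_meet[OF assms] interior_of_Int[symmetric] by (rule interior_of_mono)
qed

lemma RC_interior_compl:
  assumes "F \<in> carrier (RC X)"
  shows "X interior_of (compl (RC X) F) = topspace X - F"
proof -
  have "X interior_of (X closure_of (topspace X - F)) = topspace X - X closure_of (topspace X - X closure_of (topspace X - F))"
    by (simp add: interior_of_closure_of)
  also have "topspace X - X closure_of (topspace X - F) = X interior_of F"
    by (simp add: interior_of_closure_of)
  finally show ?thesis using assms RC_iff[of F X] by (simp add: RC_compl)
qed

lemma RC_sup_least:
  assumes S: "S \<subseteq> carrier (RC X)"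
  shows "least (RC X) (X closure_of \<Union>S) (Upper (RC X) S)"
proof -
  \<comment> \<open>Passing to interiors makes the union open, and closures of open sets are regular
    closed.\<close>
  have eq: "X closure_of \<Union>S = X closure_of \<Union>((\<lambda>F. X interior_of F) ` S)"
  proof
    have "F \<subseteq> X closure_of \<Union>((\<lambda>F. X interior_of F) ` S)" if "F \<in> S" for F
      using that S RC_iff[of F X] closure_of_mono[of "X interior_of F" "\<Union>((\<lambda>F. X interior_of F) ` S)" X]
      by auto
    then show "X closure_of \<Union>S \<subseteq> X closure_of \<Union>((\<lambda>F. X interior_of F) ` S)"
      by (intro closure_of_minimal) auto
    show "X closure_of \<Union>((\<lambda>F. X interior_of F) ` S) \<subseteq> X closure_of \<Union>S"
      by (intro closure_of_mono) (use interior_of_subset in fastforce)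
  qed
  have c: "X closure_of \<Union>S \<in> carrier (RC X)"
    unfolding eq by (intro RC_closure_open openin_Union) auto
  have "F \<subseteq> X closure_of \<Union>S" if "F \<in> S" for F
    using that S RC_iff[of _ X] by (intro order_trans[OF _ closure_of_subset]) auto
  moreover have "X closure_of \<Union>S \<subseteq> G" if "G \<in> carrier (RC X)" "\<forall>F\<in>S. F \<subseteq> G" for G
    using that by (intro closure_of_minimal RC_closedin) auto
  ultimately show ?thesis
    using c S by (simp add: least_def Upper_def RC_le) blast
qed

lemma RC_complete: "complete_lattice (RC X)"
proof -
  interpret partial_order "RC X" by (rule RC_partial_order)
  show ?thesis
  proof (rule complete_latticeI)
    fix S assume S: "S \<subseteq> carrier (RC X)"
    show "\<exists>s. least (RC X) s (Upper (RC X) S)" using RC_sup_least[OF S] by blast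
    define L where "L = Lower (RC X) S"
    have L: "L \<subseteq> carrier (RC X)" by (auto simp: L_def)
    have "greatest (RC X) (X closure_of \<Union>L) L"
      using RC_sup_least[OF L] S unfolding least_def greatest_def L_def Upper_def Lower_def by auto
    then show "\<exists>i. greatest (RC X) i (Lower (RC X) S)" by (auto simp: L_def)
  qed
qed

lemma RC_sup:
  assumes S: "S \<subseteq> carrier (RC X)"
  shows "\<Squnion>\<^bsub>RC X\<^esub> S = X closure_of \<Union>S"
proof -
  interpret complete_lattice "RC X" by (rule RC_complete)
  show ?thesis using RC_sup_least[OF S] sup_lub[OF S] least_unique by blast
qed

lemma RC_boolean_alg: "boolean_alg (RC X)"
proof -
  interpret complete_lattice "RC X" by (rule RC_complete)
  show ?thesis
  proof
    fix F G H assume FGH: "F \<in> carrier (RC X)" "G \<in> carrier (RC X)" "H \<in> carrier (RC X)"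
    let ?i = "\<lambda>F. X interior_of F"
    \<comment> \<open>The point of distributivity: the intersection of an open set with a closure
      lies in the closure of the intersection, so the interior of \<open>F\<close> can be moved
      inside both closures.\<close>
    have "?i F \<inter> ?i (G \<union> H) \<subseteq> ?i F \<inter> (X closure_of ?i G \<union> X closure_of ?i H)"
      using FGH(2,3) interior_of_subset[of X "G \<union> H"] unfolding RC_iff by auto
    also have "\<dots> \<subseteq> X closure_of (?i F \<inter> ?i G) \<union> X closure_of (?i F \<inter> ?i H)"
      using openin_Int_closure_of_subset[OF openin_interior_of, of X F "?i G"]
        openin_Int_closure_of_subset[OF openin_interior_of, of X F "?i H"] by blast
    finally have "X closure_of (?i F \<inter> ?i (G \<union> H)) \<subseteq> X closure_of (?i F \<inter> ?i G) \<union> X closure_of (?i F \<inter> ?i H)"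
      by (intro closure_of_minimal closedin_Un) auto
    moreover have "X closure_of (?i F \<inter> ?i G) \<union> X closure_of (?i F \<inter> ?i H) \<subseteq> X closure_of (?i F \<inter> ?i (G \<union> H))"
      by (intro Un_least closure_of_mono Int_mono interior_of_mono) auto
    ultimately show "F \<sqinter>\<^bsub>RC X\<^esub> (G \<squnion>\<^bsub>RC X\<^esub> H) = F \<sqinter>\<^bsub>RC X\<^esub> G \<squnion>\<^bsub>RC X\<^esub> (F \<sqinter>\<^bsub>RC X\<^esub> H)"
      using RC_join[OF meet_closed[OF FGH(1,2)] meet_closed[OF FGH(1,3)]] FGH
      by (simp add: RC_join RC_Un RC_meet interior_of_Int)
  next
    fix F assume F: "F \<in> carrier (RC X)"
    let ?K = "X closure_of (topspace X - F)"
    have K: "?K \<in> carrier (RC X)"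
      using F by (simp add: RC_closure_open RC_closedin openin_diff)
    have int: "X interior_of F = topspace X - ?K"
      by (simp add: interior_of_closure_of)
    have "X interior_of (F \<inter> ?K) = {}"
      using int interior_of_subset[of X ?K] by (auto simp: interior_of_Int)
    moreover have "F \<union> ?K = topspace X"
      using F closure_of_subset[of "topspace X - F" X] closure_of_subset_topspace[of X "topspace X - F"]
      by (auto simp: RC_iff)
    ultimately show "\<exists>b\<in>carrier (RC X). F \<sqinter>\<^bsub>RC X\<^esub> b = \<bottom>\<^bsub>RC X\<^esub> \<and> F \<squnion>\<^bsub>RC X\<^esub> b = \<top>\<^bsub>RC X\<^esub>"
      using F K by (auto simp: RC_meet RC_join RC_bottom RC_top intro!: bexI[of _ ?K])
  qed
qed

section \<open>Realizations by compact Hausdorff spaces\<close>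

text \<open>Only order and contact are transported; Boolean operations and suprema follow from the
  order. The type of points is free, so that one algebra can be realized both by its own point space
  and by a geometric space.\<close>

locale realization =
  fixes K :: "'a contact_alg" and X :: "'x topology" and f :: "'a \<Rightarrow> 'x set"
  assumes boolean: "boolean_alg K" and complete: "complete_lattice K"
    and compact: "compact_space X" and Hausdorff: "Hausdorff_space X"
    and bij: "bij_betw f (carrier K) (carrier (RC X))"
    and le_iff: "\<lbrakk>a \<in> carrier K; b \<in> carrier K\<rbrakk> \<Longrightarrow> a \<sqsubseteq>\<^bsub>K\<^esub> b \<longleftrightarrow> f a \<subseteq> f b"
    and contact_iff: "\<lbrakk>a \<in> carrier K; b \<in> carrier K\<rbrakk> \<Longrightarrow> contact K a b \<longleftrightarrow> f a \<inter> f b \<noteq> {}"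
begin

sublocale K: complete_lattice K by (rule complete)
sublocale K: boolean_alg K by (rule boolean)

text \<open>The regular open counterpart of \<open>f a\<close>: meets are intersections of these
  sets, joins are unions of the \<open>f a\<close>, and complementation exchanges the two
  families.\<close>

definition op :: "'a \<Rightarrow> 'x set" where
  "op a = X interior_of f a"

lemma iso: "f \<in> bool_iso K (RC X)"
  by (rule order_iso_bool_iso[OF boolean RC_boolean_alg bij]) (simp add: le_iff RC_le)

lemma RC: "a \<in> carrier K \<Longrightarrow> f a \<in> carrier (RC X)"
  using bij by (auto simp: bij_betw_def)

lemma eq_iff: "\<lbrakk>a \<in> carrier K; b \<in> carrier K\<rbrakk> \<Longrightarrow> a = b \<longleftrightarrow> f a = f b"
  using bij by (auto simp: bij_betw_def inj_on_def)

lemma surj: "F \<in> carrier (RC X) \<Longrightarrow> \<exists>a\<in>carrier K. f a = F"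
  using bij by (metis bij_betw_imp_surj_on imageE)

lemma surj_open: "openin X U \<Longrightarrow> \<exists>a\<in>carrier K. f a = X closure_of U"
  by (simp add: RC_closure_open surj)

lemma open_op [simp]: "openin X (op a)" and op_subset: "op a \<subseteq> f a"
  by (simp_all add: op_def interior_of_subset)

lemma closure_op: "a \<in> carrier K \<Longrightarrow> X closure_of op a = f a"
  using RC RC_iff[of _ X] by (auto simp: op_def)

lemma closed [simp]: "a \<in> carrier K \<Longrightarrow> closedin X (f a)"
  using RC RC_closedin by blast

lemma subset: "a \<in> carrier K \<Longrightarrow> f a \<subseteq> topspace X"
  by (simp add: closedin_subset)

lemma op_max: "openin X U \<Longrightarrow> U \<subseteq> f a \<Longrightarrow> U \<subseteq> op a"
  by (simp add: op_def interior_of_maximal)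

lemma f_bottom [simp]: "f \<bottom>\<^bsub>K\<^esub> = {}"
  and f_top [simp]: "f \<top>\<^bsub>K\<^esub> = topspace X"
  and f_meet: "\<lbrakk>a \<in> carrier K; b \<in> carrier K\<rbrakk> \<Longrightarrow> f (a \<sqinter>\<^bsub>K\<^esub> b) = f a \<sqinter>\<^bsub>RC X\<^esub> f b"
  and f_join [simp]: "\<lbrakk>a \<in> carrier K; b \<in> carrier K\<rbrakk> \<Longrightarrow> f (a \<squnion>\<^bsub>K\<^esub> b) = f a \<union> f b"
  and f_compl_RC: "a \<in> carrier K \<Longrightarrow> f (compl K a) = compl (RC X) (f a)"
  using iso RC RC_join[of _ X] by (auto simp: bool_iso_def bool_hom_def RC_bottom RC_top)

lemma op_bottom [simp]: "op \<bottom>\<^bsub>K\<^esub> = {}" and op_top [simp]: "op \<top>\<^bsub>K\<^esub> = topspace X"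
  by (simp_all add: op_def)

lemma op_meet [simp]: "\<lbrakk>a \<in> carrier K; b \<in> carrier K\<rbrakk> \<Longrightarrow> op (a \<sqinter>\<^bsub>K\<^esub> b) = op a \<inter> op b"
  by (simp add: op_def f_meet RC_interior_meet RC)

lemma op_compl [simp]: "a \<in> carrier K \<Longrightarrow> op (compl K a) = topspace X - f a"
  by (simp add: op_def f_compl_RC RC_interior_compl RC)

lemma f_compl [simp]: "a \<in> carrier K \<Longrightarrow> f (compl K a) = topspace X - op a"
  using op_compl[of "compl K a"] subset[of "compl K a"] by auto

lemma f_eq_empty: "a \<in> carrier K \<Longrightarrow> op a = {} \<longleftrightarrow> a = \<bottom>\<^bsub>K\<^esub>"
  using closure_op[of a] eq_iff[of a "\<bottom>\<^bsub>K\<^esub>"] by auto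

lemma well_inside_iff:
  "\<lbrakk>a \<in> carrier K; b \<in> carrier K\<rbrakk> \<Longrightarrow> a \<lless>\<^bsub>K\<^esub> b \<longleftrightarrow> f a \<subseteq> op b"
  using subset[of a] by (auto simp: well_inside_def contact_iff)

text \<open>Each \<open>f a\<close> is the closure of \<open>op a\<close>, so the closure of the
  union does not change when the members are replaced by their interiors.\<close>

lemma f_sup:
  assumes "S \<subseteq> carrier K"
  shows "f (\<Squnion>\<^bsub>K\<^esub> S) = X closure_of \<Union>(op ` S)"
proof -
  have "f (\<Squnion>\<^bsub>K\<^esub> S) = \<Squnion>\<^bsub>RC X\<^esub> (f ` S)"
    by (rule order_iso_sup[OF complete RC_complete bij]) (simp_all add: le_iff RC_le assms)
  also have "\<dots> = X closure_of \<Union>(f ` S)" using RC assms by (intro RC_sup) auto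
  also have "\<dots> = X closure_of \<Union>(op ` S)"
  proof
    have "f a \<subseteq> X closure_of \<Union>(op ` S)" if "a \<in> S" for a
      using that assms closure_op[of a] closure_of_mono[of "op a" "\<Union>(op ` S)" X] by auto
    then show "X closure_of \<Union>(f ` S) \<subseteq> X closure_of \<Union>(op ` S)"
      by (intro closure_of_minimal) auto
    show "X closure_of \<Union>(op ` S) \<subseteq> X closure_of \<Union>(f ` S)"
      by (intro closure_of_mono) (use op_subset in fastforce)
  qed
  finally show ?thesis .
qed

text \<open>Compact Hausdorff spaces are normal, and the closure of the open set supplied by
  normality is regular closed, hence of the form \<open>f a\<close>.\<close>

lemma normal_interpolate:
  assumes "closedin X C" "openin X U" "C \<subseteq> U"
  shows "\<exists>a\<in>carrier K. C \<subseteq> op a \<and> f a \<subseteq> U"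
proof -
  have "normal_space X"
    using compact Hausdorff by (simp add: compact_Hausdorff_or_regular_imp_normal_space)
  then obtain V where V: "openin X V" "C \<subseteq> V" "X closure_of V \<subseteq> U"
    using assms unfolding normal_space_alt by meson
  obtain a where a: "a \<in> carrier K" "f a = X closure_of V" using surj_open[OF V(1)] by blast
  have "V \<subseteq> op a" using V a by (intro op_max) (auto simp: closure_of_subset openin_subset)
  then show ?thesis using a V by blast
qed

lemma regular_interpolate:
  assumes "openin X U" "x \<in> U"
  shows "\<exists>a\<in>carrier K. x \<in> op a \<and> f a \<subseteq> U"
proof -
  have "closedin X {x}"
    using Hausdorff assms openin_subset by (intro closedin_Hausdorff_sing_eq[THEN iffD2]) auto
  then show ?thesis using normal_interpolate[of "{x}" U] assms by simp
qed

lemma separate: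
  assumes "x \<in> topspace X" "y \<in> topspace X" "x \<noteq> y"
  shows "\<exists>a\<in>carrier K. x \<in> op a \<and> y \<notin> f a"
proof -
  have "closedin X {y}" using Hausdorff assms by (simp add: closedin_Hausdorff_sing_eq)
  then show ?thesis using regular_interpolate[of "topspace X - {y}" x] assms by auto
qed

text \<open>C5 is normality and C6 is regularity of the space.\<close>

lemma CNCA: "CNCA K"
proof
  fix a assume "a \<in> carrier K" "a \<noteq> \<bottom>\<^bsub>K\<^esub>"
  then show "contact K a a" using eq_iff[of a "\<bottom>\<^bsub>K\<^esub>"] by (simp add: contact_iff)
next
  fix a b assume ab: "a \<in> carrier K" "b \<in> carrier K"
  show "a \<noteq> \<bottom>\<^bsub>K\<^esub> \<and> b \<noteq> \<bottom>\<^bsub>K\<^esub>" if "contact K a b"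
    using that ab by (auto simp: contact_iff)
  show "contact K b a" if "contact K a b"
    using that ab by (auto simp: contact_iff)
  show "\<exists>c\<in>carrier K. \<not> contact K a c \<and> \<not> contact K b (compl K c)" if "\<not> contact K a b"
  proof -
    have "\<exists>c\<in>carrier K. f b \<subseteq> op c \<and> f c \<subseteq> topspace X - f a"
      using ab that subset[of b] by (intro normal_interpolate) (auto simp: contact_iff)
    then show ?thesis using ab by (auto simp: contact_iff)
  qed
  fix c assume "c \<in> carrier K"
  then show "contact K a (b \<squnion>\<^bsub>K\<^esub> c) = (contact K a b \<or> contact K a c)"
    using ab by (auto simp: contact_iff)
next
  fix a assume a: "a \<in> carrier K" "a \<noteq> \<top>\<^bsub>K\<^esub>"
  then obtain x where x: "x \<in> topspace X - f a"
    using eq_iff[of a "\<top>\<^bsub>K\<^esub>"] subset[of a] by auto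
  obtain b where "b \<in> carrier K" "x \<in> op b" "f b \<subseteq> topspace X - f a"
    using regular_interpolate[OF openin_diff[OF openin_topspace closed[OF a(1)]] x] by blast
  then show "\<exists>b\<in>carrier K. b \<noteq> \<bottom>\<^bsub>K\<^esub> \<and> \<not> contact K b a"
    using a f_eq_empty by (auto simp: contact_iff intro!: bexI[of _ b])
qed

end

lemma RC_realization:
  "\<lbrakk>compact_space X; Hausdorff_space X\<rbrakk> \<Longrightarrow> realization (RC X) X (\<lambda>F. F)"
  by (rule realization.intro[OF RC_boolean_alg RC_complete]) (simp_all add: bij_betw_def RC_def)

section \<open>De Vries duality for realizations\<close>

lemma closure_of_eqI: "\<lbrakk>A \<subseteq> B; B \<subseteq> X closure_of A\<rbrakk> \<Longrightarrow> X closure_of A = X closure_of B"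
  by (simp add: closure_of_minimal closure_of_mono subset_antisym)

text \<open>The de Vries dual of a continuous map: a regular closed set goes to the closure of the
  preimage of its interior. A relation is used because \<open>u\<close> matters only on
  \<open>topspace Y\<close> and because each side is obtained from the other merely by
  existence.\<close>

definition dualizes ::
  "'a contact_alg \<Rightarrow> 'x topology \<Rightarrow> ('a \<Rightarrow> 'x set) \<Rightarrow> 'b contact_alg \<Rightarrow> 'y topology \<Rightarrow> ('b \<Rightarrow> 'y set) \<Rightarrow>
   ('y \<Rightarrow> 'x) \<Rightarrow> ('a \<Rightarrow> 'b) \<Rightarrow> bool" where
  "dualizes K X f D Y g u \<phi> \<longleftrightarrow> continuous_map Y X u \<and> \<phi> \<in> carrier K \<rightarrow>\<^sub>E carrier D \<and>
     (\<forall>a\<in>carrier K. g (\<phi> a) = Y closure_of {y \<in> topspace Y. u y \<in> X interior_of f a})"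

locale realization_pair = K: realization K X f + D: realization D Y g
  for K :: "'a contact_alg" and X :: "'x topology" and f
    and D :: "'b contact_alg" and Y :: "'y topology" and g
begin

abbreviation "dual \<equiv> dualizes K X f D Y g"

lemma dual_unique_hom:
  assumes "dual u \<phi>" "dual u' \<phi>'" "\<And>y. y \<in> topspace Y \<Longrightarrow> u y = u' y"
  shows "\<phi> = \<phi>'"
proof -
  have fE: "\<phi> \<in> carrier K \<rightarrow>\<^sub>E carrier D" "\<phi>' \<in> carrier K \<rightarrow>\<^sub>E carrier D"
    using assms by (auto simp: dualizes_def)
  show ?thesis
  proof (rule PiE_ext[OF fE])
    fix a assume a: "a \<in> carrier K"
    have "{y \<in> topspace Y. u y \<in> X interior_of f a} = {y \<in> topspace Y. u' y \<in> X interior_of f a}"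
      using assms(3) by auto
    then have "g (\<phi> a) = g (\<phi>' a)" using assms(1,2) a by (simp add: dualizes_def)
    then show "\<phi> a = \<phi>' a" using D.eq_iff fE a by (metis PiE_mem)
  qed
qed

lemma dual_exists:
  assumes "continuous_map Y X u"
  shows "\<exists>\<phi>. dual u \<phi>"
proof -
  have "\<forall>a\<in>carrier K. \<exists>d\<in>carrier D. g d = Y closure_of {y \<in> topspace Y. u y \<in> X interior_of f a}"
    using assms by (intro ballI D.surj_open) (auto intro: openin_continuous_map_preimage)
  then obtain h where h: "\<And>a. a \<in> carrier K \<Longrightarrow> h a \<in> carrier D \<and>
      g (h a) = Y closure_of {y \<in> topspace Y. u y \<in> X interior_of f a}" by metis
  have "dual u (restrict h (carrier K))"
    using h assms by (auto simp: dualizes_def)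
  then show ?thesis by blast
qed

text \<open>If the values differed, some \<open>a\<close> would have \<open>u y\<close> in its
  interior and \<open>u' y\<close> outside. But \<open>y\<close> lies in the closure of the first
  preimage, which equals that of the second and is contained in the closed preimage of
  \<open>f a\<close>.\<close>

lemma dual_unique_map:
  assumes "dual u \<phi>" "dual u' \<phi>" "y \<in> topspace Y"
  shows "u y = u' y"
proof (rule ccontr)
  assume ne: "u y \<noteq> u' y"
  have cu: "continuous_map Y X u" "continuous_map Y X u'" using assms by (auto simp: dualizes_def)
  have t: "u y \<in> topspace X" "u' y \<in> topspace X" using cu assms(3) by (auto simp: continuous_map_def)
  obtain a where a: "a \<in> carrier K" "u y \<in> K.op a" "u' y \<notin> f a" using K.separate[OF t ne] by blast
  have "y \<in> Y closure_of {y \<in> topspace Y. u y \<in> X interior_of f a}"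
    using assms(3) a by (intro subsetD[OF closure_of_subset]) (auto simp: K.op_def)
  also have "\<dots> = Y closure_of {y \<in> topspace Y. u' y \<in> X interior_of f a}"
    using assms(1,2)[unfolded dualizes_def, THEN conjunct2, THEN conjunct2, rule_format, OF a(1)] by simp
  also have "\<dots> \<subseteq> {y \<in> topspace Y. u' y \<in> f a}"
    using a cu interior_of_subset[of X "f a"]
    by (intro closure_of_minimal closedin_continuous_map_preimage[OF cu(2)]) auto
  finally show False using a by simp
qed

lemma dual_hom:
  assumes "dual u \<phi>"
  shows "\<phi> \<in> DHC_hom K D"
proof -
  define V where "V a = {y \<in> topspace Y. u y \<in> K.op a}" for a
  have cu: "continuous_map Y X u" and \<phi>: "\<phi> \<in> carrier K \<rightarrow>\<^sub>E carrier D"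
    and g: "\<And>a. a \<in> carrier K \<Longrightarrow> g (\<phi> a) = Y closure_of V a"
    using assms by (auto simp: dualizes_def V_def K.op_def)
  have uX: "u y \<in> topspace X" if "y \<in> topspace Y" for y
    using cu that by (auto simp: continuous_map_def)
  have c [simp]: "\<phi> a \<in> carrier D" if "a \<in> carrier K" for a
    using \<phi> that by auto
  have Vo: "openin Y (V a)" for a
    unfolding V_def using cu by (intro openin_continuous_map_preimage) auto
  have Vop: "V a \<subseteq> D.op (\<phi> a)" if "a \<in> carrier K" for a
    using that Vo g by (intro D.op_max) (auto simp: closure_of_subset openin_subset)
  have opV: "D.op (\<phi> a) \<subseteq> Y closure_of V a" if "a \<in> carrier K" for a
    using D.op_subset g[OF that] by auto
  have 1: "\<phi> \<bottom>\<^bsub>K\<^esub> = \<bottom>\<^bsub>D\<^esub>"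
    by (simp add: D.eq_iff g V_def)
  have 2: "\<phi> (a \<sqinter>\<^bsub>K\<^esub> b) = \<phi> a \<sqinter>\<^bsub>D\<^esub> \<phi> b" if ab: "a \<in> carrier K" "b \<in> carrier K" for a b
  proof -
    have Vm: "V (a \<sqinter>\<^bsub>K\<^esub> b) = V a \<inter> V b" using ab by (auto simp: V_def)
    have "g (\<phi> a \<sqinter>\<^bsub>D\<^esub> \<phi> b) = Y closure_of (D.op (\<phi> a) \<inter> D.op (\<phi> b))"
      using ab D.closure_op[of "\<phi> a \<sqinter>\<^bsub>D\<^esub> \<phi> b"] by simp
    \<comment> \<open>\<open>V a\<close> and \<open>V b\<close> are open and dense in the two sets
      on the left, and density survives intersection with an open set.\<close>
    moreover have "D.op (\<phi> a) \<inter> D.op (\<phi> b) \<subseteq> Y closure_of (V a \<inter> V b)"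
    proof -
      have "D.op (\<phi> a) \<inter> D.op (\<phi> b) \<subseteq> D.op (\<phi> a) \<inter> Y closure_of (V b)" using opV ab by auto
      also have "\<dots> \<subseteq> Y closure_of (D.op (\<phi> a) \<inter> V b)" by (rule openin_Int_closure_of_subset) simp
      also have "\<dots> \<subseteq> Y closure_of (Y closure_of (V b \<inter> V a))"
      proof (rule closure_of_mono)
        have "D.op (\<phi> a) \<inter> V b \<subseteq> V b \<inter> Y closure_of (V a)" using opV ab by auto
        also have "\<dots> \<subseteq> Y closure_of (V b \<inter> V a)" by (rule openin_Int_closure_of_subset) (rule Vo)
        finally show "D.op (\<phi> a) \<inter> V b \<subseteq> Y closure_of (V b \<inter> V a)" .
      qed
      finally show ?thesis by (simp add: Int_commute)
    qed
    moreover have "V a \<inter> V b \<subseteq> D.op (\<phi> a) \<inter> D.op (\<phi> b)" using Vop ab by auto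
    ultimately have "g (\<phi> a \<sqinter>\<^bsub>D\<^esub> \<phi> b) = Y closure_of (V a \<inter> V b)"
      using closure_of_eqI[of "V a \<inter> V b" "D.op (\<phi> a) \<inter> D.op (\<phi> b)" Y] by simp
    then show ?thesis using ab by (simp add: D.eq_iff g Vm)
  qed
  have 3: "compl D (\<phi> (compl K a)) \<lless>\<^bsub>D\<^esub> \<phi> b"
    if ab: "a \<in> carrier K" "b \<in> carrier K" "a \<lless>\<^bsub>K\<^esub> b" for a b
  proof -
    \<comment> \<open>A point not mapped into \<open>K.op (compl K a)\<close> is mapped into
      \<open>f a\<close>, hence into \<open>K.op b\<close>.\<close>
    have "topspace Y - D.op (\<phi> (compl K a)) \<subseteq> V b"
      using Vop[of "compl K a"] ab(1,2) ab(3)[unfolded K.well_inside_iff[OF ab(1,2)]] uX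
      by (auto simp: V_def)
    then have "topspace Y - D.op (\<phi> (compl K a)) \<subseteq> D.op (\<phi> b)" using Vop ab by blast
    then show ?thesis using ab by (simp add: D.well_inside_iff)
  qed
  have 4: "\<phi> a = \<Squnion>\<^bsub>D\<^esub> {\<phi> b |b. b \<in> carrier K \<and> b \<lless>\<^bsub>K\<^esub> a}" if a: "a \<in> carrier K" for a
  proof -
    let ?S = "{\<phi> b |b. b \<in> carrier K \<and> b \<lless>\<^bsub>K\<^esub> a}"
    have S: "?S \<subseteq> carrier D" by auto
    \<comment> \<open>By regularity, the open set \<open>K.op a\<close> is the union of the
      \<open>K.op b\<close> with \<open>b\<close> well inside \<open>a\<close>; the same then holds
      for preimages.\<close>
    have sub: "V a \<subseteq> \<Union>(D.op ` ?S)"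
    proof
      fix y assume "y \<in> V a"
      then obtain b where b: "b \<in> carrier K" "u y \<in> K.op b" "f b \<subseteq> K.op a" "y \<in> topspace Y"
        using K.regular_interpolate[of "K.op a" "u y"] by (auto simp: V_def)
      then have "y \<in> D.op (\<phi> b)" using Vop by (auto simp: V_def)
      moreover have "b \<lless>\<^bsub>K\<^esub> a" using b a by (simp add: K.well_inside_iff)
      ultimately show "y \<in> \<Union>(D.op ` ?S)" using b by blast
    qed
    have ub: "D.op (\<phi> b) \<subseteq> Y closure_of V a" if "b \<in> carrier K" "f b \<subseteq> K.op a" for b
    proof -
      have "V b \<subseteq> V a" using K.op_subset that by (auto simp: V_def)
      then show ?thesis using opV that closure_of_mono by (metis order_trans)
    qed
    have "\<Union>(D.op ` ?S) \<subseteq> Y closure_of V a"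
    proof
      fix y assume "y \<in> \<Union>(D.op ` ?S)"
      then obtain b where b: "b \<in> carrier K" "b \<lless>\<^bsub>K\<^esub> a" "y \<in> D.op (\<phi> b)" by blast
      show "y \<in> Y closure_of V a"
        by (rule subsetD[OF ub b(3)]) (use a b in \<open>simp_all add: K.well_inside_iff\<close>)
    qed
    with sub have "Y closure_of V a = Y closure_of \<Union>(D.op ` ?S)"
      by (rule closure_of_eqI)
    then show ?thesis using a S D.K.sup_closed[OF S] by (simp add: D.eq_iff g D.f_sup[OF S])
  qed
  show ?thesis unfolding DHC_hom_def using \<phi> 1 2 3 4 by blast
qed

text \<open>The point of \<open>X\<close> assigned to \<open>y\<close> is the one lying in all \<open>f a\<close> with \<open>y\<close> interior to \<open>g (\<phi> a)\<close>;
  it is unique because \<open>a \<lless> b\<close> forces \<open>y\<close> to be interior to \<open>g (\<phi> (a\<^sup>*))\<close> or to \<open>g (\<phi> b)\<close>.\<close>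

lemma hom_dual:
  assumes "\<phi> \<in> DHC_hom K D"
  shows "\<exists>u. dual u \<phi>"
proof -
  have \<phi>: "\<phi> \<in> carrier K \<rightarrow>\<^sub>E carrier D" and bot: "\<phi> \<bottom>\<^bsub>K\<^esub> = \<bottom>\<^bsub>D\<^esub>"
    and meet: "\<And>a b. a \<in> carrier K \<Longrightarrow> b \<in> carrier K \<Longrightarrow> \<phi> (a \<sqinter>\<^bsub>K\<^esub> b) = \<phi> a \<sqinter>\<^bsub>D\<^esub> \<phi> b"
    and wi: "\<And>a b. a \<in> carrier K \<Longrightarrow> b \<in> carrier K \<Longrightarrow> a \<lless>\<^bsub>K\<^esub> b \<Longrightarrow>
      compl D (\<phi> (compl K a)) \<lless>\<^bsub>D\<^esub> \<phi> b"
    and sup: "\<And>a. a \<in> carrier K \<Longrightarrow> \<phi> a = \<Squnion>\<^bsub>D\<^esub> {\<phi> b |b. b \<in> carrier K \<and> b \<lless>\<^bsub>K\<^esub> a}"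
    using assms unfolding DHC_hom_def by blast+
  have c [simp]: "\<phi> a \<in> carrier D" if "a \<in> carrier K" for a
    using \<phi> that by auto
  have key: "y \<in> D.op (\<phi> (compl K a)) \<or> y \<in> D.op (\<phi> b)"
    if "a \<in> carrier K" "b \<in> carrier K" "f a \<subseteq> K.op b" "y \<in> topspace Y" for a b y
  proof -
    have "compl D (\<phi> (compl K a)) \<lless>\<^bsub>D\<^esub> \<phi> b" using wi that by (simp add: K.well_inside_iff)
    then show ?thesis using that by (auto simp: D.well_inside_iff)
  qed
  have "\<exists>x\<in>topspace X. \<forall>a\<in>carrier K. y \<in> D.op (\<phi> a) \<longrightarrow> x \<in> f a" if y: "y \<in> topspace Y" for y
  proof -
    define P where "P = {a \<in> carrier K. y \<in> D.op (\<phi> a)}"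
    have nb: "f a \<noteq> {}" if "a \<in> P" for a
    proof
      assume "f a = {}"
      then have "a = \<bottom>\<^bsub>K\<^esub>" using that K.eq_iff[of a "\<bottom>\<^bsub>K\<^esub>"] by (auto simp: P_def)
      then show False using that bot by (simp add: P_def)
    qed
    have top: "\<top>\<^bsub>K\<^esub> \<in> P"
      using key[of "\<top>\<^bsub>K\<^esub>" "\<top>\<^bsub>K\<^esub>" y] y bot by (auto simp: P_def)
    \<comment> \<open>\<phi> preserves meets, so \<open>P\<close> is closed under them; this gives
      the finite intersection property.\<close>
    have fin: "\<exists>b\<in>P. f b \<subseteq> \<Inter>(f ` Q)" if "finite Q" "Q \<subseteq> P" for Q
      using that
    proof (induction Q rule: finite_induct)
      case empty then show ?case using top by blast
    next
      case (insert a Q)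
      then obtain b where b: "b \<in> P" "f b \<subseteq> \<Inter>(f ` Q)" by auto
      have ab: "a \<in> carrier K" "b \<in> carrier K" using insert b by (auto simp: P_def)
      have "f (a \<sqinter>\<^bsub>K\<^esub> b) \<subseteq> f a \<inter> f b"
        using ab K.K.meet_left K.K.meet_right K.le_iff by (metis Int_subset_iff K.K.meet_closed)
      moreover have "a \<sqinter>\<^bsub>K\<^esub> b \<in> P" using ab insert b by (auto simp: P_def meet)
      ultimately show ?case using b by (intro bexI[of _ "a \<sqinter>\<^bsub>K\<^esub> b"]) auto
    qed
    have "\<Inter>(f ` P) \<noteq> {}"
    proof (rule compact_space_fip[THEN iffD1, rule_format, OF K.compact], intro conjI ballI allI impI)
      fix C assume "C \<in> f ` P" then show "closedin X C" by (auto simp: P_def)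
    next
      fix \<F> assume "finite \<F> \<and> \<F> \<subseteq> f ` P"
      then obtain Q where "finite Q" "Q \<subseteq> P" "\<F> = f ` Q" by (meson finite_subset_image)
      then show "\<Inter>\<F> \<noteq> {}" using fin nb by fastforce
    qed
    moreover have "\<Inter>(f ` P) \<subseteq> topspace X" using top by auto
    ultimately show ?thesis by (auto simp: P_def)
  qed
  then obtain u where uX: "\<And>y. y \<in> topspace Y \<Longrightarrow> u y \<in> topspace X"
    and u: "\<And>y a. y \<in> topspace Y \<Longrightarrow> a \<in> carrier K \<Longrightarrow> y \<in> D.op (\<phi> a) \<Longrightarrow> u y \<in> f a"
    by metis
  \<comment> \<open>The converse of the property defining \<open>u\<close>: a smaller
    \<open>b\<close> around \<open>u y\<close> keeps \<open>y\<close> out of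
    \<open>D.op (\<phi> (compl K b))\<close>, and \<open>key\<close> leaves only
    \<open>a\<close>.\<close>
  have uop: "y \<in> D.op (\<phi> a)" if a: "a \<in> carrier K" and y: "y \<in> topspace Y" "u y \<in> K.op a" for a y
  proof -
    obtain b where b: "b \<in> carrier K" "u y \<in> K.op b" "f b \<subseteq> K.op a"
      using K.regular_interpolate[of "K.op a" "u y"] y by auto
    have "y \<notin> D.op (\<phi> (compl K b))" using u[of y "compl K b"] b y by auto
    then show ?thesis using key b a y by blast
  qed
  have cont: "continuous_map Y X u"
    unfolding continuous_map_def
  proof (intro conjI allI impI)
    show "u \<in> topspace Y \<rightarrow> topspace X" using uX by auto
    fix U assume U: "openin X U"
    show "openin Y {y \<in> topspace Y. u y \<in> U}"
    proof (subst openin_subopen, intro ballI)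
      fix y assume "y \<in> {y \<in> topspace Y. u y \<in> U}"
      then obtain a where a: "a \<in> carrier K" "u y \<in> K.op a" "f a \<subseteq> U" "y \<in> topspace Y"
        using K.regular_interpolate[OF U] by auto
      have "D.op (\<phi> a) \<subseteq> {y \<in> topspace Y. u y \<in> U}"
      proof
        fix z assume z: "z \<in> D.op (\<phi> a)"
        then have "z \<in> topspace Y" using D.op_subset[of "\<phi> a"] D.subset[OF c[OF a(1)]] by blast
        then show "z \<in> {y \<in> topspace Y. u y \<in> U}" using u[OF _ a(1) z] a(3) by blast
      qed
      then show "\<exists>T. openin Y T \<and> y \<in> T \<and> T \<subseteq> {y \<in> topspace Y. u y \<in> U}"
        using uop a by (intro exI[of _ "D.op (\<phi> a)"]) auto
    qed
  qed
  have "g (\<phi> a) = Y closure_of {y \<in> topspace Y. u y \<in> K.op a}" if a: "a \<in> carrier K" for a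
  proof
    let ?S = "{\<phi> b |b. b \<in> carrier K \<and> b \<lless>\<^bsub>K\<^esub> a}"
    have "?S \<subseteq> carrier D" by auto
    from D.f_sup[OF this] have "g (\<phi> a) = Y closure_of \<Union>(D.op ` ?S)"
      by (subst sup[OF a])
    also have "\<dots> \<subseteq> Y closure_of {y \<in> topspace Y. u y \<in> K.op a}"
    proof (rule closure_of_mono)
      show "\<Union>(D.op ` ?S) \<subseteq> {y \<in> topspace Y. u y \<in> K.op a}"
      proof
        fix y assume "y \<in> \<Union>(D.op ` ?S)"
        then obtain b where b: "b \<in> carrier K" "f b \<subseteq> K.op a" "y \<in> D.op (\<phi> b)"
          using a by (auto simp: K.well_inside_iff)
        then have "y \<in> topspace Y"
          using D.op_subset[of "\<phi> b"] D.subset[OF c[OF b(1)]] by blast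
        then show "y \<in> {y \<in> topspace Y. u y \<in> K.op a}" using u[OF _ b(1,3)] b(2) by blast
      qed
    qed
    finally show "g (\<phi> a) \<subseteq> Y closure_of {y \<in> topspace Y. u y \<in> K.op a}" .
    show "Y closure_of {y \<in> topspace Y. u y \<in> K.op a} \<subseteq> g (\<phi> a)"
      using uop[OF a] D.op_subset a by (intro closure_of_minimal) auto
  qed
  then have "dual u \<phi>" using cont \<phi> by (simp add: dualizes_def K.op_def)
  then show ?thesis by blast
qed

end

text \<open>The plain composite \<open>h \<circ> \<iota>\<close> need not be a dual, since closures
  are taken twice. For \<open>b\<close> well inside \<open>a\<close> the inner closure stays within
  the preimage of the interior of \<open>f a\<close>, so the join over such \<open>b\<close> in
  \<open>DHC_comp\<close> is exactly the dual of \<open>v \<circ> u\<close>.\<close>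

lemma dual_comp:
  assumes "realization_pair K X f S T k" "realization_pair S T k D Y g"
    and \<iota>: "dualizes K X f S T k v \<iota>" and h: "dualizes S T k D Y g u h"
  shows "dualizes K X f D Y g (v \<circ> u) (DHC_comp K D h \<iota>)"
proof -
  interpret KS: realization_pair K X f S T k by fact
  interpret SD: realization_pair S T k D Y g by fact
  have cv: "continuous_map T X v" and cu: "continuous_map Y T u"
    and \<iota>E: "\<iota> \<in> carrier K \<rightarrow>\<^sub>E carrier S" and hE: "h \<in> carrier S \<rightarrow>\<^sub>E carrier D"
    and k: "\<And>a. a \<in> carrier K \<Longrightarrow> k (\<iota> a) = T closure_of {t \<in> topspace T. v t \<in> KS.K.op a}"
    and g: "\<And>a. a \<in> carrier S \<Longrightarrow> g (h a) = Y closure_of {y \<in> topspace Y. u y \<in> KS.D.op a}"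
    using \<iota> h by (auto simp: dualizes_def KS.K.op_def KS.D.op_def)
  have uT: "u y \<in> topspace T" if "y \<in> topspace Y" for y
    using cu that by (auto simp: continuous_map_def)
  have c [simp]: "\<iota> a \<in> carrier S" if "a \<in> carrier K" for a using \<iota>E that by auto
  have c' [simp]: "h a \<in> carrier D" if "a \<in> carrier S" for a using hE that by auto
  have op: "{y \<in> topspace Y. u y \<in> KS.D.op a} \<subseteq> SD.D.op (h a)" if "a \<in> carrier S" for a
    using that cu g by (intro SD.D.op_max openin_continuous_map_preimage) (auto intro: subsetD[OF closure_of_subset])
  have op': "{t \<in> topspace T. v t \<in> KS.K.op a} \<subseteq> KS.D.op (\<iota> a)" if "a \<in> carrier K" for a
    using that cv k by (intro KS.D.op_max openin_continuous_map_preimage) (auto intro: subsetD[OF closure_of_subset])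
  have "g (DHC_comp K D h \<iota> a) = Y closure_of {y \<in> topspace Y. v (u y) \<in> KS.K.op a} \<and>
      DHC_comp K D h \<iota> a \<in> carrier D"
    if a: "a \<in> carrier K" for a
  proof -
    let ?S = "{h (\<iota> b) |b. b \<in> carrier K \<and> b \<lless>\<^bsub>K\<^esub> a}"
    have S: "?S \<subseteq> carrier D" by auto
    have e: "DHC_comp K D h \<iota> a = \<Squnion>\<^bsub>D\<^esub> ?S" using a by (simp add: DHC_comp_def DHC_check_def)
    let ?V = "{y \<in> topspace Y. v (u y) \<in> KS.K.op a}"
    have 1: "?V \<subseteq> \<Union>(SD.D.op ` ?S)"
    proof
      fix y assume "y \<in> ?V"
      then obtain b where b: "b \<in> carrier K" "v (u y) \<in> KS.K.op b" "f b \<subseteq> KS.K.op a" "y \<in> topspace Y"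
        using KS.K.regular_interpolate[of "KS.K.op a" "v (u y)"] by auto
      then have "u y \<in> KS.D.op (\<iota> b)" using op'[of b] uT by auto
      then have "y \<in> SD.D.op (h (\<iota> b))" using op[of "\<iota> b"] b by auto
      moreover have "b \<lless>\<^bsub>K\<^esub> a" using b a by (simp add: KS.K.well_inside_iff)
      ultimately show "y \<in> \<Union>(SD.D.op ` ?S)" using b by blast
    qed
    have ub: "SD.D.op (h (\<iota> b)) \<subseteq> Y closure_of ?V" if b: "b \<in> carrier K" "f b \<subseteq> KS.K.op a" for b
    proof -
      have "k (\<iota> b) \<subseteq> {t \<in> topspace T. v t \<in> f b}"
        unfolding k[OF b(1)] using b KS.K.op_subset
        by (intro closure_of_minimal closedin_continuous_map_preimage[OF cv]) auto
      then have "KS.D.op (\<iota> b) \<subseteq> {t \<in> topspace T. v t \<in> KS.K.op a}"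
        using KS.D.op_subset b by blast
      then have "g (h (\<iota> b)) \<subseteq> Y closure_of ?V"
        using b g[of "\<iota> b"] by (auto intro!: closure_of_mono)
      then show ?thesis using SD.D.op_subset by blast
    qed
    have 2: "\<Union>(SD.D.op ` ?S) \<subseteq> Y closure_of ?V"
    proof
      fix y assume "y \<in> \<Union>(SD.D.op ` ?S)"
      then obtain b where b: "b \<in> carrier K" "b \<lless>\<^bsub>K\<^esub> a" "y \<in> SD.D.op (h (\<iota> b))" by blast
      show "y \<in> Y closure_of ?V"
        by (rule subsetD[OF ub b(3)]) (use a b in \<open>simp_all add: KS.K.well_inside_iff\<close>)
    qed
    have "Y closure_of ?V = Y closure_of \<Union>(SD.D.op ` ?S)"
      using 1 2 by (rule closure_of_eqI)
    then show ?thesis using e SD.D.f_sup[OF S] SD.D.K.sup_closed[OF S] by simp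
  qed
  moreover have "continuous_map Y X (v \<circ> u)" using cv cu continuous_map_compose by blast
  moreover have "DHC_comp K D h \<iota> \<in> extensional (carrier K)" by (simp add: DHC_comp_def DHC_check_def)
  ultimately show ?thesis by (auto simp: dualizes_def KS.K.op_def PiE_def)
qed

lemma realization_pairI:
  "\<lbrakk>realization K X f; realization D Y g\<rbrakk> \<Longrightarrow> realization_pair K X f D Y g"
  by (simp add: realization_pair_def)

section \<open>The space of points of a complete normal contact algebra\<close>

context contact_algebra
begin

lemma contact_mono:
  assumes "contact B a b" "a \<sqsubseteq> a'" "b \<sqsubseteq> b'"
    and c: "a \<in> carrier B" "b \<in> carrier B" "a' \<in> carrier B" "b' \<in> carrier B"
  shows "contact B a' b'"
proof -
  have r: "contact B x z" if "contact B x y" "y \<sqsubseteq> z" "x \<in> carrier B" "y \<in> carrier B" "z \<in> carrier B" for x y z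
    using C4[of x y z] le_iff_meet[of y z] that by auto
  have "contact B a b'" using r assms by blast
  then have "contact B b' a" using C3 c by blast
  then have "contact B b' a'" using r assms by blast
  then show ?thesis using C3 c by blast
qed

lemma wi_mono:
  assumes "a' \<lless> b'" "a \<sqsubseteq> a'" "b' \<sqsubseteq> b"
    and c: "a \<in> carrier B" "b \<in> carrier B" "a' \<in> carrier B" "b' \<in> carrier B"
  shows "a \<lless> b"
  using contact_mono[of a "compl B b" a' "compl B b'"] assms compl_le_compl
  by (auto simp: well_inside_def)

lemma wi_le:
  assumes "a \<lless> b" "a \<in> carrier B" "b \<in> carrier B"
  shows "a \<sqsubseteq> b"
proof (rule ccontr)
  assume "\<not> a \<sqsubseteq> b"
  then have "contact B (a \<sqinter> compl B b) (a \<sqinter> compl B b)" using assms C1 le_iff_meet_compl by simp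
  then have "contact B a (compl B b)"
    using contact_mono meet_left meet_right assms(2,3) by (meson compl_closed meet_closed)
  then show False using assms by (simp add: well_inside_def)
qed

lemma wi_compl: "\<lbrakk>a \<lless> b; a \<in> carrier B; b \<in> carrier B\<rbrakk> \<Longrightarrow> compl B b \<lless> compl B a"
  using C3[of "compl B b" a] by (auto simp: well_inside_def)

lemma wi_top: "\<top> \<lless> \<top>"
  using C2[of \<top> \<bottom>] by (auto simp: well_inside_def)

lemma wi_meet:
  assumes "a \<lless> b" "a' \<lless> b'"
    and c: "a \<in> carrier B" "b \<in> carrier B" "a' \<in> carrier B" "b' \<in> carrier B"
  shows "a \<sqinter> a' \<lless> b \<sqinter> b'"
proof -
  have e: "compl B (b \<sqinter> b') = compl B b \<squnion> compl B b'"
    using c by (simp add: eq_iff_ultra ultra_simps)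
  have "\<not> contact B (a \<sqinter> a') (compl B b)" "\<not> contact B (a \<sqinter> a') (compl B b')"
    using contact_mono[of "a \<sqinter> a'" "compl B b" a "compl B b"]
      contact_mono[of "a \<sqinter> a'" "compl B b'" a' "compl B b'"] assms meet_left meet_right le_refl
    by (auto simp: well_inside_def)
  then show ?thesis using c by (simp add: well_inside_def e C4)
qed

end

lemma (in NCA) wi_interpolate:
  assumes "a \<lless> b" "a \<in> carrier B" "b \<in> carrier B"
  shows "\<exists>c\<in>carrier B. a \<lless> c \<and> c \<lless> b"
proof -
  obtain c where c: "c \<in> carrier B" "\<not> contact B a c" "\<not> contact B (compl B b) (compl B c)"
    using C5[of a "compl B b"] assms by (auto simp: well_inside_def)
  then have "\<not> contact B (compl B c) (compl B b)" using C3[of "compl B c" "compl B b"] assms by auto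
  then show ?thesis using c by (intro bexI[of _ "compl B c"]) (auto simp: well_inside_def)
qed

text \<open>These are the maximal round filters: the penultimate clause is roundness, and the last
  one expresses maximality without quantifying over filters.\<close>

definition points :: "('a, 'm) contact_alg_scheme \<Rightarrow> 'a set set" where
  "points B = {P. P \<subseteq> carrier B \<and> \<top>\<^bsub>B\<^esub> \<in> P \<and> \<bottom>\<^bsub>B\<^esub> \<notin> P \<and>
     (\<forall>a\<in>P. \<forall>b\<in>P. a \<sqinter>\<^bsub>B\<^esub> b \<in> P) \<and> (\<forall>a\<in>P. \<forall>b\<in>carrier B. a \<sqsubseteq>\<^bsub>B\<^esub> b \<longrightarrow> b \<in> P) \<and>
     (\<forall>a\<in>P. \<exists>b\<in>P. b \<lless>\<^bsub>B\<^esub> a) \<and>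
     (\<forall>a\<in>carrier B. \<forall>b\<in>carrier B. a \<lless>\<^bsub>B\<^esub> b \<longrightarrow> compl B a \<in> P \<or> b \<in> P)}"

definition point_basic :: "('a, 'm) contact_alg_scheme \<Rightarrow> 'a \<Rightarrow> 'a set set" where
  "point_basic B a = {P \<in> points B. a \<in> P}"

definition point_space :: "('a, 'm) contact_alg_scheme \<Rightarrow> 'a set topology" where
  "point_space B = topology (\<lambda>U. U \<subseteq> points B \<and> (\<forall>P\<in>U. \<exists>a\<in>P. point_basic B a \<subseteq> U))"

text \<open>By \<open>closure_basic\<close> this is the closure of the basic open set of
  \<open>a\<close>: the filter need not contain \<open>a\<close>, it only must not reject
  it.\<close>

definition point_real :: "('a, 'm) contact_alg_scheme \<Rightarrow> 'a \<Rightarrow> 'a set set" where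
  "point_real B a = {P \<in> points B. compl B a \<notin> P}"

text \<open>The canonical map from the Stone space to the points; it produces points wherever
  \<open>prime_ideal\<close> produces ultrafilters.\<close>

definition round_part :: "('a, 'm) contact_alg_scheme \<Rightarrow> 'a set \<Rightarrow> 'a set" where
  "round_part B u = {a \<in> carrier B. \<exists>b\<in>u. b \<lless>\<^bsub>B\<^esub> a}"

context CNCA
begin

lemma pointD:
  assumes "P \<in> points B"
  shows "P \<subseteq> carrier B" "\<top> \<in> P" "\<bottom> \<notin> P" "\<And>a b. a \<in> P \<Longrightarrow> b \<in> P \<Longrightarrow> a \<sqinter> b \<in> P"
    "\<And>a b. a \<in> P \<Longrightarrow> b \<in> carrier B \<Longrightarrow> a \<sqsubseteq> b \<Longrightarrow> b \<in> P"
    "\<And>a. a \<in> P \<Longrightarrow> \<exists>b\<in>P. b \<lless> a"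
    "\<And>a b. a \<in> carrier B \<Longrightarrow> b \<in> carrier B \<Longrightarrow> a \<lless> b \<Longrightarrow> compl B a \<in> P \<or> b \<in> P"
  using assms unfolding points_def by blast+

lemma point_meet: "P \<in> points B \<Longrightarrow> a \<in> carrier B \<Longrightarrow> b \<in> carrier B \<Longrightarrow> a \<sqinter> b \<in> P \<longleftrightarrow> a \<in> P \<and> b \<in> P"
  by (meson meet_closed meet_left meet_right pointD)

lemma point_compl: "P \<in> points B \<Longrightarrow> a \<in> carrier B \<Longrightarrow> a \<in> P \<Longrightarrow> compl B a \<notin> P"
  using pointD(3,4) meet_compl by metis

lemma round_part_point:
  assumes u: "u \<in> ultrafilters B"
  shows "round_part B u \<in> points B"
proof -
  have uc: "b \<in> carrier B" if "b \<in> u" for b using u that by (auto simp: ultrafilters_def)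
  show ?thesis
    unfolding points_def mem_Collect_eq
  proof (intro conjI ballI impI)
    show "round_part B u \<subseteq> carrier B" by (auto simp: round_part_def)
    show "\<top> \<in> round_part B u"
      using ultra_simps(1)[OF u] wi_top by (auto simp: round_part_def)
    show "\<bottom> \<notin> round_part B u"
    proof
      assume "\<bottom> \<in> round_part B u"
      then obtain b where b: "b \<in> u" "b \<lless> \<bottom>" by (auto simp: round_part_def)
      then have "b \<sqsubseteq> \<bottom>" using wi_le[OF b(2) uc[OF b(1)] bottom_closed] by simp
      then have "b = \<bottom>" using uc[OF b(1)] le_antisym[of b \<bottom>] by simp
      then show False using b ultra_simps(2)[OF u] by simp
    qed
  next
    fix a b assume "a \<in> round_part B u" "b \<in> round_part B u"
    then obtain c d where cd: "c \<in> u" "d \<in> u" "c \<lless> a" "d \<lless> b" "a \<in> carrier B" "b \<in> carrier B"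
      by (auto simp: round_part_def)
    then have "c \<sqinter> d \<lless> a \<sqinter> b" "c \<sqinter> d \<in> u" using wi_meet uc ultra_simps(4)[OF u] by auto
    then show "a \<sqinter> b \<in> round_part B u" using cd by (auto simp: round_part_def)
  next
    fix a b assume "a \<in> round_part B u" and ab: "b \<in> carrier B" "a \<sqsubseteq> b"
    then obtain c where c: "c \<in> u" "c \<lless> a" "a \<in> carrier B" by (auto simp: round_part_def)
    then have "c \<lless> b" using wi_mono[of c a c b] ab uc le_refl by blast
    then show "b \<in> round_part B u" using c ab by (auto simp: round_part_def)
  next
    fix a assume "a \<in> round_part B u"
    then obtain c where c: "c \<in> u" "c \<lless> a" "a \<in> carrier B" by (auto simp: round_part_def)
    obtain d where d: "d \<in> carrier B" "c \<lless> d" "d \<lless> a" using wi_interpolate[OF c(2) uc[OF c(1)] c(3)] by blast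
    then show "\<exists>b\<in>round_part B u. b \<lless> a" using c by (auto simp: round_part_def)
  next
    fix a b assume ab: "a \<in> carrier B" "b \<in> carrier B" "a \<lless> b"
    \<comment> \<open>The ultrafilter decides the interpolant: either \<open>c\<close> is in
      \<open>u\<close> and well inside \<open>b\<close>, or its complement is in \<open>u\<close>
      and well inside \<open>compl B a\<close>.\<close>
    obtain c where c: "c \<in> carrier B" "a \<lless> c" "c \<lless> b" using wi_interpolate[OF ab(3,1,2)] by blast
    show "compl B a \<in> round_part B u \<or> b \<in> round_part B u"
    proof (cases "c \<in> u")
      case True then show ?thesis using c ab by (auto simp: round_part_def)
    next
      case False
      then have "compl B c \<in> u" using ultra_simps(3)[OF u] c by simp
      moreover have "compl B c \<lless> compl B a" using wi_compl c ab by blast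
      ultimately show ?thesis using ab by (auto simp: round_part_def)
    qed
  qed
qed

lemma round_part_subset:
  assumes u: "u \<in> ultrafilters B"
  shows "round_part B u \<subseteq> u"
proof
  fix a assume "a \<in> round_part B u"
  then obtain b where b: "b \<in> u" "b \<lless> a" "a \<in> carrier B" by (auto simp: round_part_def)
  then have "b \<in> carrier B" using u by (auto simp: ultrafilters_def)
  then have "b \<sqsubseteq> a" using wi_le b by blast
  then show "a \<in> u" using le_iff_ultra u b \<open>b \<in> carrier B\<close> by blast
qed

text \<open>C6, applied to the complement, gives a nonzero element well inside \<open>d\<close>; an
  ultrafilter containing that element has a round part containing \<open>d\<close>.\<close>

lemma point_basic_nonempty:
  assumes d: "d \<in> carrier B" "d \<noteq> \<bottom>"
  shows "point_basic B d \<noteq> {}"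
proof -
  have "compl B d \<noteq> \<top>" using d compl_compl[OF d(1)] compl_top by metis
  then obtain b where b: "b \<in> carrier B" "b \<noteq> \<bottom>" "\<not> contact B b (compl B d)"
    using C6[of "compl B d"] d by auto
  have "bool_ideal B {\<bottom>}" unfolding bool_ideal_def
    using bottom_join_eq le_antisym[OF _ bottom_lower] by auto
  then obtain u where u: "u \<in> ultrafilters B" "b \<in> u" using prime_ideal b by blast
  then have "d \<in> round_part B u" using b d by (auto simp: round_part_def well_inside_def)
  then show ?thesis using round_part_point[OF u(1)] by (auto simp: point_basic_def)
qed

lemma basic_meet: "a \<in> carrier B \<Longrightarrow> b \<in> carrier B \<Longrightarrow> point_basic B (a \<sqinter> b) = point_basic B a \<inter> point_basic B b"
  using point_meet by (auto simp: point_basic_def)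

lemma openin_point_space:
  "openin (point_space B) U \<longleftrightarrow> U \<subseteq> points B \<and> (\<forall>P\<in>U. \<exists>a\<in>P. point_basic B a \<subseteq> U)"
proof -
  have "istopology (\<lambda>U. U \<subseteq> points B \<and> (\<forall>P\<in>U. \<exists>a\<in>P. point_basic B a \<subseteq> U))"
    unfolding istopology_def
  proof (intro conjI allI impI ballI)
    fix U V P
    assume U: "U \<subseteq> points B \<and> (\<forall>P\<in>U. \<exists>a\<in>P. point_basic B a \<subseteq> U)"
      and V: "V \<subseteq> points B \<and> (\<forall>P\<in>V. \<exists>a\<in>P. point_basic B a \<subseteq> V)"
    show "U \<inter> V \<subseteq> points B" using U by auto
    assume P: "P \<in> U \<inter> V"
    then obtain a b where ab: "a \<in> P" "point_basic B a \<subseteq> U" "b \<in> P" "point_basic B b \<subseteq> V"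
      using bspec[OF conjunct2[OF U]] bspec[OF conjunct2[OF V]] by (metis IntD1 IntD2)
    have PP: "P \<in> points B" using P U by auto
    have c: "a \<in> carrier B" "b \<in> carrier B" using pointD(1)[OF PP] ab by auto
    show "\<exists>a\<in>P. point_basic B a \<subseteq> U \<inter> V"
      using ab basic_meet[OF c] pointD(4)[OF PP] by (intro bexI[of _ "a \<sqinter> b"]) auto
  next
    fix \<U> assume K: "\<forall>K\<in>\<U>. K \<subseteq> points B \<and> (\<forall>P\<in>K. \<exists>a\<in>P. point_basic B a \<subseteq> K)"
    then show "\<Union>\<U> \<subseteq> points B" by auto
    fix P assume "P \<in> \<Union>\<U>"
    then obtain K' where K': "K' \<in> \<U>" "P \<in> K'" by blast
    then obtain a where "a \<in> P" "point_basic B a \<subseteq> K'" using K by meson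
    then show "\<exists>a\<in>P. point_basic B a \<subseteq> \<Union>\<U>" using K' by blast
  qed
  then show ?thesis by (simp add: point_space_def)
qed

lemma open_basic: "openin (point_space B) (point_basic B a)"
  unfolding openin_point_space by (auto simp: point_basic_def)

lemma topspace_point_space: "topspace (point_space B) = points B"
proof
  show "topspace (point_space B) \<subseteq> points B"
    using openin_topspace[of "point_space B"] unfolding openin_point_space by blast
  have "point_basic B \<top> = points B" using pointD(2) by (auto simp: point_basic_def)
  then show "points B \<subseteq> topspace (point_space B)" using open_basic[of \<top>] openin_subset by metis
qed

lemma point_real_eq: "a \<in> carrier B \<Longrightarrow> point_real B a = points B - point_basic B (compl B a)"
  by (auto simp: point_real_def point_basic_def)

lemma closure_basic:
  assumes a: "a \<in> carrier B"
  shows "point_space B closure_of point_basic B a = point_real B a"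
proof
  have "closedin (point_space B) (point_real B a)"
    using open_basic[of "compl B a"] a
    by (simp add: point_real_eq topspace_point_space[symmetric] closedin_diff)
  moreover have "point_basic B a \<subseteq> point_real B a"
    using a point_compl by (auto simp: point_basic_def point_real_def)
  ultimately show "point_space B closure_of point_basic B a \<subseteq> point_real B a"
    by (simp add: closure_of_minimal)
  show "point_real B a \<subseteq> point_space B closure_of point_basic B a"
  proof
    fix P assume P: "P \<in> point_real B a"
    then have PP: "P \<in> points B" "compl B a \<notin> P" by (auto simp: point_real_def)
    have "\<exists>Q. Q \<in> point_basic B a \<and> Q \<in> U" if U: "P \<in> U" "openin (point_space B) U" for U
    proof -
      obtain c where c: "c \<in> P" "point_basic B c \<subseteq> U" using U openin_point_space by blast
      then have cc: "c \<in> carrier B" using pointD(1)[OF PP(1)] by auto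
      \<comment> \<open>Otherwise \<open>c\<close> would lie below \<open>compl B a\<close>, and the
        filter \<open>P\<close> would contain \<open>compl B a\<close>.\<close>
      have "c \<sqinter> a \<noteq> \<bottom>"
        using PP c cc a pointD(5)[OF PP(1) c(1), of "compl B a"] meet_bot_iff[of c a] by auto
      then have "point_basic B (c \<sqinter> a) \<noteq> {}" using point_basic_nonempty cc a by simp
      then show ?thesis using basic_meet[OF cc a] c by auto
    qed
    then show "P \<in> point_space B closure_of point_basic B a"
      using PP by (auto simp: in_closure_of topspace_point_space)
  qed
qed

lemma point_real_RC: "a \<in> carrier B \<Longrightarrow> point_real B a \<in> carrier (RC (point_space B))"
  using closure_basic[of a] RC_closure_open[OF open_basic[of a]] by simp

lemma point_real_le:
  assumes ab: "a \<in> carrier B" "b \<in> carrier B"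
  shows "a \<sqsubseteq> b \<longleftrightarrow> point_real B a \<subseteq> point_real B b"
proof
  assume "a \<sqsubseteq> b"
  then have "compl B b \<sqsubseteq> compl B a" using ab compl_le_compl by simp
  then show "point_real B a \<subseteq> point_real B b"
    using pointD(5) ab by (auto simp: point_real_def)
next
  assume s: "point_real B a \<subseteq> point_real B b"
  show "a \<sqsubseteq> b"
  proof (rule ccontr)
    assume "\<not> a \<sqsubseteq> b"
    then have "point_basic B (a \<sqinter> compl B b) \<noteq> {}"
      using ab le_iff_meet_compl by (intro point_basic_nonempty) auto
    then obtain P where "P \<in> points B" "a \<in> P" "compl B b \<in> P"
      using basic_meet[of a "compl B b"] ab by (auto simp: point_basic_def)
    then show False using s ab point_compl by (auto simp: point_real_def)
  qed
qed

lemma point_real_contact: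
  assumes ab: "a \<in> carrier B" "b \<in> carrier B"
  shows "contact B a b \<longleftrightarrow> point_real B a \<inter> point_real B b \<noteq> {}"
proof
  assume c: "contact B a b"
  \<comment> \<open>An ultrafilter that contains \<open>a\<close> and avoids all elements not in
    contact with \<open>b\<close> contains nothing well inside \<open>compl B b\<close>; its round
    part therefore belongs to both sets.\<close>
  define J where "J = {c \<in> carrier B. \<not> contact B c b}"
  have "bool_ideal B J"
    unfolding bool_ideal_def
  proof (intro conjI ballI impI)
    show "J \<subseteq> carrier B" by (auto simp: J_def)
    show "\<bottom> \<in> J" using C2[of \<bottom> b] ab by (auto simp: J_def)
  next
    fix x y assume "x \<in> J" "y \<in> J"
    then have "x \<in> carrier B" "y \<in> carrier B" "\<not> contact B b x" "\<not> contact B b y"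
      using C3[OF ab(2)] by (auto simp: J_def)
    then show "x \<squnion> y \<in> J" using C4[of b x y] C3[of "x \<squnion> y" b] ab by (auto simp: J_def)
  next
    fix x y assume "x \<in> J" "y \<in> carrier B" "y \<sqsubseteq> x"
    then show "y \<in> J" using contact_mono[of y b x b] ab le_refl by (auto simp: J_def)
  qed
  then obtain u where u: "u \<in> ultrafilters B" "a \<in> u" "u \<inter> J = {}"
    using prime_ideal[of J a] c ab by (auto simp: J_def)
  have "compl B a \<notin> round_part B u"
    using round_part_subset[OF u(1)] ultra_simps(3)[OF u(1) ab(1)] u by auto
  moreover have "compl B b \<notin> round_part B u"
  proof
    assume "compl B b \<in> round_part B u"
    then obtain c where c: "c \<in> u" "c \<lless> compl B b" by (auto simp: round_part_def)
    have "c \<in> carrier B" using u(1) c(1) by (auto simp: ultrafilters_def)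
    then have "c \<in> J" using ab c(2) by (simp add: J_def well_inside_def)
    then show False using u(3) c(1) by auto
  qed
  ultimately have "round_part B u \<in> point_real B a \<inter> point_real B b"
    using round_part_point[OF u(1)] by (simp add: point_real_def)
  then show "point_real B a \<inter> point_real B b \<noteq> {}" by blast
next
  assume "point_real B a \<inter> point_real B b \<noteq> {}"
  then obtain P where P: "P \<in> points B" "compl B a \<notin> P" "compl B b \<notin> P" by (auto simp: point_real_def)
  have "\<not> a \<lless> compl B b" using pointD(7)[OF P(1) ab(1), of "compl B b"] P ab by auto
  then show "contact B a b" using ab by (simp add: well_inside_def)
qed

lemma Hausdorff_point_space: "Hausdorff_space (point_space B)"
proof -
  \<comment> \<open>Roundness shrinks a witness \<open>a\<close> to some \<open>b\<close> well
    inside it; as \<open>a\<close> is missing from \<open>Q\<close>, the last clause of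
    \<open>points\<close> puts \<open>compl B b\<close> into \<open>Q\<close>.\<close>
  have sep: "\<exists>b\<in>carrier B. b \<in> P \<and> compl B b \<in> Q"
    if PQ: "P \<in> points B" "Q \<in> points B" "\<not> P \<subseteq> Q" for P Q
  proof -
    obtain a where a: "a \<in> P" "a \<notin> Q" using PQ by blast
    obtain b where b: "b \<in> P" "b \<lless> a" using pointD(6)[OF PQ(1) a(1)] by blast
    have "a \<in> carrier B" "b \<in> carrier B" using a b pointD(1)[OF PQ(1)] by auto
    then show ?thesis using pointD(7)[OF PQ(2), of b a] a b by blast
  qed
  have disj: "disjnt (point_basic B b) (point_basic B (compl B b))" if "b \<in> carrier B" for b
    using point_compl that by (auto simp: disjnt_iff point_basic_def)
  show ?thesis
    unfolding Hausdorff_space_def topspace_point_space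
  proof (intro allI impI)
    fix P Q assume PQ: "P \<in> points B \<and> Q \<in> points B \<and> P \<noteq> Q"
    then consider "\<not> P \<subseteq> Q" | "\<not> Q \<subseteq> P" by blast
    then show "\<exists>U V. openin (point_space B) U \<and> openin (point_space B) V \<and> P \<in> U \<and> Q \<in> V \<and> disjnt U V"
    proof cases
      case 1
      then obtain b where "b \<in> carrier B" "b \<in> P" "compl B b \<in> Q" using sep PQ by blast
      then show ?thesis using PQ open_basic disj
        by (intro exI[of _ "point_basic B b"] exI[of _ "point_basic B (compl B b)"]) (auto simp: point_basic_def)
    next
      case 2
      then obtain b where "b \<in> carrier B" "b \<in> Q" "compl B b \<in> P" using sep PQ by blast
      then show ?thesis using PQ open_basic disj disjnt_sym
        by (intro exI[of _ "point_basic B (compl B b)"] exI[of _ "point_basic B b"]) (auto simp: point_basic_def)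
    qed
  qed
qed

text \<open>If no finite part of the cover suffices, then the ideal \<open>J\<close> is proper, and the round part of an
  ultrafilter avoiding \<open>J\<close> is an uncovered point.\<close>

lemma compact_point_space: "compact_space (point_space B)"
  unfolding compact_space_alt topspace_point_space
proof (intro allI impI)
  fix \<U> assume "Ball \<U> (openin (point_space B)) \<and> points B \<subseteq> \<Union>\<U>"
  then have \<U>: "\<forall>U\<in>\<U>. openin (point_space B) U" "points B \<subseteq> \<Union>\<U>" by auto
  define M where "M = {a \<in> carrier B. \<exists>U\<in>\<U>. point_basic B a \<subseteq> U}"
  define J where "J = {c \<in> carrier B. \<exists>N. finite N \<and> N \<subseteq> M \<and>
      (\<forall>P\<in>points B. N \<inter> P = {} \<longrightarrow> compl B c \<in> P)}"
  have "bool_ideal B J"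
    unfolding bool_ideal_def
  proof (intro conjI ballI impI)
    show "J \<subseteq> carrier B" by (auto simp: J_def)
    show "\<bottom> \<in> J" using pointD(2) by (auto simp: J_def intro!: exI[of _ "{}"])
  next
    fix x y assume "x \<in> J" "y \<in> J"
    then obtain N N' where x: "x \<in> carrier B" "finite N" "N \<subseteq> M"
        "\<forall>P\<in>points B. N \<inter> P = {} \<longrightarrow> compl B x \<in> P"
      and y: "y \<in> carrier B" "finite N'" "N' \<subseteq> M"
        "\<forall>P\<in>points B. N' \<inter> P = {} \<longrightarrow> compl B y \<in> P"
      unfolding J_def by blast
    have e: "compl B (x \<squnion> y) = compl B x \<sqinter> compl B y"
      using x y by (simp add: eq_iff_ultra ultra_simps)
    have "compl B (x \<squnion> y) \<in> P" if P: "P \<in> points B" "(N \<union> N') \<inter> P = {}" for P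
    proof -
      have "N \<inter> P = {}" "N' \<inter> P = {}" using P by auto
      then have "compl B x \<in> P" "compl B y \<in> P" using x(4) y(4) P by auto
      then show ?thesis unfolding e using pointD(4)[OF P(1)] by simp
    qed
    then show "x \<squnion> y \<in> J"
      unfolding J_def using x y by (auto intro!: exI[of _ "N \<union> N'"])
  next
    fix x y assume xy: "x \<in> J" "y \<in> carrier B" "y \<sqsubseteq> x"
    then obtain N where x: "x \<in> carrier B" "finite N" "N \<subseteq> M"
        "\<forall>P\<in>points B. N \<inter> P = {} \<longrightarrow> compl B x \<in> P"
      unfolding J_def by blast
    have "compl B x \<sqsubseteq> compl B y" using xy x by (simp add: compl_le_compl)
    then have "\<forall>P\<in>points B. N \<inter> P = {} \<longrightarrow> compl B y \<in> P"
      using x pointD(5)[of _ "compl B x" "compl B y"] xy by simp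
    then show "y \<in> J" unfolding J_def using x xy by auto
  qed
  have "\<top> \<in> J"
  proof (rule ccontr)
    assume "\<top> \<notin> J"
    then obtain u where u: "u \<in> ultrafilters B" "u \<inter> J = {}"
      using prime_ideal[OF \<open>bool_ideal B J\<close>, of \<top>] by auto
    let ?P = "round_part B u"
    have P: "?P \<in> points B" by (rule round_part_point[OF u(1)])
    then obtain U where U: "U \<in> \<U>" "?P \<in> U" using \<U> by blast
    then obtain a where a: "a \<in> ?P" "point_basic B a \<subseteq> U" using \<U>(1) openin_point_space by blast
    then have aM: "a \<in> M" using U by (auto simp: M_def round_part_def)
    obtain c where c: "c \<in> u" "c \<lless> a" using a by (auto simp: round_part_def)
    have cc: "c \<in> carrier B" "a \<in> carrier B" using c u aM by (auto simp: ultrafilters_def M_def)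
    \<comment> \<open>Since \<open>c\<close> is well inside \<open>a\<close>, every point without
      \<open>a\<close> contains \<open>compl B c\<close>. The singleton \<open>{a}\<close> thus puts
      \<open>c\<close> into \<open>J\<close>, against the choice of \<open>u\<close>.\<close>
    have "\<forall>Q\<in>points B. {a} \<inter> Q = {} \<longrightarrow> compl B c \<in> Q"
      using pointD(7)[OF _ cc c(2)] by auto
    then have "c \<in> J" using cc aM by (auto simp: J_def intro!: exI[of _ "{a}"])
    then show False using u c by auto
  qed
  then obtain N where N: "finite N" "N \<subseteq> M" "\<forall>P\<in>points B. N \<inter> P = {} \<longrightarrow> \<bottom> \<in> P"
    by (auto simp: J_def)
  have "\<forall>a\<in>N. \<exists>U. U \<in> \<U> \<and> point_basic B a \<subseteq> U" using N(2) by (auto simp: M_def)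
  then obtain U where U: "\<And>a. a \<in> N \<Longrightarrow> U a \<in> \<U> \<and> point_basic B a \<subseteq> U a" by metis
  have "points B \<subseteq> \<Union>(U ` N)"
  proof
    fix P assume P: "P \<in> points B"
    then have "N \<inter> P \<noteq> {}" using N(3) pointD(3) by blast
    then obtain a where "a \<in> N" "a \<in> P" by blast
    then show "P \<in> \<Union>(U ` N)" using U P by (auto simp: point_basic_def)
  qed
  then show "\<exists>\<F>. finite \<F> \<and> \<F> \<subseteq> \<U> \<and> points B \<subseteq> \<Union>\<F>"
    using N(1) U by (intro exI[of _ "U ` N"]) auto
qed

text \<open>Completeness enters here: the preimage is the join of all \<open>a\<close> whose basic
  open set lies in \<open>F\<close>.\<close>

lemma point_real_surj:
  assumes F: "F \<in> carrier (RC (point_space B))"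
  shows "\<exists>m\<in>carrier B. point_real B m = F"
proof -
  define M where "M = {a \<in> carrier B. point_basic B a \<subseteq> F}"
  have M: "M \<subseteq> carrier B" by (auto simp: M_def)
  define m where "m = \<Squnion> M"
  have m: "m \<in> carrier B" using M by (simp add: m_def)
  have "point_space B interior_of F \<subseteq> point_basic B m"
  proof
    fix P assume "P \<in> point_space B interior_of F"
    then obtain a where a: "a \<in> P" "point_basic B a \<subseteq> F" "P \<in> points B"
      using openin_interior_of[of "point_space B" F] interior_of_subset[of "point_space B" F]
      unfolding openin_point_space by blast
    then have aM: "a \<in> M" using subsetD[OF pointD(1)[OF a(3)] a(1)] by (simp add: M_def)
    then have "a \<sqsubseteq> m" using sup_upper[OF M] by (simp add: m_def)
    then show "P \<in> point_basic B m"
      using pointD(5)[OF a(3,1) m] a(3) by (simp add: point_basic_def)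
  qed
  then have 1: "F \<subseteq> point_real B m"
    using closure_of_mono[of _ "point_basic B m" "point_space B"] F closure_basic[OF m]
    by (metis RC_iff)
  have "point_basic B m \<subseteq> F"
  proof (rule ccontr)
    assume "\<not> point_basic B m \<subseteq> F"
    moreover have "openin (point_space B) (point_basic B m - F)"
      using open_basic RC_closedin[OF F] openin_diff by blast
    ultimately obtain P c where P: "P \<in> points B" "c \<in> P" "point_basic B c \<subseteq> point_basic B m - F"
      unfolding openin_point_space by blast
    have c: "c \<in> carrier B" "c \<noteq> \<bottom>" using pointD(1,3)[OF P(1)] P by auto
    \<comment> \<open>A nonempty basic set inside \<open>point_basic B m\<close> but outside
      \<open>F\<close> is disjoint from every member of \<open>M\<close>, hence from their join
      \<open>m\<close>, which is absurd.\<close>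
    have "a \<sqsubseteq> compl B c" if a: "a \<in> M" for a
    proof (rule ccontr)
      have ac: "a \<in> carrier B" using a M by auto
      assume "\<not> a \<sqsubseteq> compl B c"
      then have "point_basic B (a \<sqinter> c) \<noteq> {}"
        using ac c meet_bot_iff[of a c] by (intro point_basic_nonempty) auto
      then show False using basic_meet[OF ac c(1)] P a by (auto simp: M_def)
    qed
    then have "m \<sqsubseteq> compl B c" unfolding m_def using M c by (intro sup_least) auto
    then have "m \<sqinter> c = \<bottom>" using meet_bot_iff m c by simp
    then have "point_basic B m \<inter> point_basic B c = {}"
      using basic_meet[OF m c(1)] pointD(3) by (auto simp: point_basic_def)
    then show False using P point_basic_nonempty[OF c] by blast
  qed
  then have "point_real B m \<subseteq> F"
    using closure_basic[OF m] closure_of_minimal RC_closedin[OF F] by metis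
  then show ?thesis using 1 m by blast
qed

end

theorem CNCA_realization:
  fixes B :: "'a contact_alg"
  assumes "CNCA B"
  shows "realization B (point_space B) (point_real B)"
proof -
  interpret CNCA B by fact
  show ?thesis
  proof (rule realization.intro)
    show "boolean_alg B" "complete_lattice B" by unfold_locales
    have "inj_on (point_real B) (carrier B)"
      by (rule inj_onI) (metis point_real_le le_antisym order_refl)
    then show "bij_betw (point_real B) (carrier B) (carrier (RC (point_space B)))"
      using point_real_RC point_real_surj by (auto simp: bij_betw_def)
  qed (use compact_point_space Hausdorff_point_space point_real_le point_real_contact in auto)
qed

section \<open>Records with the same underlying order\<close>

text \<open>The algebra \<open>At\<close>, the record \<open>tilde_LCA\<close> and its Alexandroff
  extension differ only in further fields, and all lattice notions are computed from the three
  fields compared here.\<close>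

locale same_order =
  fixes L :: "('a, 'm) gorder_scheme" and M :: "('a, 'n) gorder_scheme"
  assumes carrier_eq: "carrier M = carrier L" and eq_eq: "eq M = eq L" and le_eq: "le M = le L"
begin

lemma ops:
  "\<Squnion>\<^bsub>M\<^esub>S = \<Squnion>\<^bsub>L\<^esub>S" "\<Sqinter>\<^bsub>M\<^esub>S = \<Sqinter>\<^bsub>L\<^esub>S" "x \<squnion>\<^bsub>M\<^esub> y = x \<squnion>\<^bsub>L\<^esub> y" "x \<sqinter>\<^bsub>M\<^esub> y = x \<sqinter>\<^bsub>L\<^esub> y"
  "\<bottom>\<^bsub>M\<^esub> = \<bottom>\<^bsub>L\<^esub>" "\<top>\<^bsub>M\<^esub> = \<top>\<^bsub>L\<^esub>" "compl M x = compl L x"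
  by (simp_all add: sup_def inf_def join_def meet_def bottom_def top_def compl_def least_def
      greatest_def Upper_def Lower_def carrier_eq le_eq)

lemma partial_order: "partial_order L \<Longrightarrow> partial_order M"
  unfolding partial_order_def weak_partial_order_def equivalence_def weak_partial_order_axioms_def
    partial_order_axioms_def carrier_eq eq_eq le_eq .

lemma complete_lattice: "complete_lattice L \<Longrightarrow> complete_lattice M"
  unfolding complete_lattice_def complete_lattice_axioms_def least_def greatest_def Upper_def Lower_def
  using partial_order by (simp add: carrier_eq le_eq)

lemma boolean_alg:
  assumes "boolean_alg L"
  shows "boolean_alg M"
proof -
  interpret L: boolean_alg L by fact
  interpret M: partial_order M using L.partial_order_axioms by (rule partial_order)
  show ?thesis
  proof
    fix x y assume xy: "x \<in> carrier M" "y \<in> carrier M"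
    show "\<exists>s. least M s (Upper M {x, y})"
      using L.sup_of_two_exists[of x y] xy by (simp add: least_def Upper_def carrier_eq le_eq)
    show "\<exists>s. greatest M s (Lower M {x, y})"
      using L.inf_of_two_exists[of x y] xy by (simp add: greatest_def Lower_def carrier_eq le_eq)
  next
    show "\<exists>x. least M x (carrier M)" using L.bottom_exists by (simp add: least_def carrier_eq le_eq)
    show "\<exists>x. greatest M x (carrier M)" using L.top_exists by (simp add: greatest_def carrier_eq le_eq)
  next
    fix a b c assume "a \<in> carrier M" "b \<in> carrier M" "c \<in> carrier M"
    then show "a \<sqinter>\<^bsub>M\<^esub> (b \<squnion>\<^bsub>M\<^esub> c) = a \<sqinter>\<^bsub>M\<^esub> b \<squnion>\<^bsub>M\<^esub> (a \<sqinter>\<^bsub>M\<^esub> c)"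
      unfolding ops carrier_eq by (rule L.distrib)
  next
    fix a assume "a \<in> carrier M"
    then show "\<exists>b\<in>carrier M. a \<sqinter>\<^bsub>M\<^esub> b = \<bottom>\<^bsub>M\<^esub> \<and> a \<squnion>\<^bsub>M\<^esub> b = \<top>\<^bsub>M\<^esub>"
      unfolding ops carrier_eq by (rule L.compl_exists)
  qed
qed

end

section \<open>Pointed compact Hausdorff spaces give local contact algebras\<close>

text \<open>The point \<open>p\<close> plays the role of infinity: \<open>B\<close> is realized by the locally compact space
  \<open>X - {p}\<close>, and its Alexandroff extension by \<open>X\<close>.\<close>

lemma pointed_CLCA:
  fixes B :: "'a local_contact_alg"
  assumes R: "realization (alexandroff_ext B) X f"
    and p: "p \<in> topspace X" "\<not> openin X {p}"
    and contact: "\<And>a b. a \<in> carrier B \<Longrightarrow> b \<in> carrier B \<Longrightarrow> contact B a b \<longleftrightarrow> f a \<inter> f b - {p} \<noteq> {}"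
    and bounded: "bounded_elems B = {a \<in> carrier B. p \<notin> f a}"
  shows "CLCA B"
proof -
  define K where "K = alexandroff_ext B"
  interpret K: realization K X f unfolding K_def by (rule R)
  interpret o: same_order K B by unfold_locales (simp_all add: K_def alexandroff_ext_def)
  interpret B: boolean_alg B by (rule o.boolean_alg[OF K.boolean])
  interpret B: complete_lattice B by (rule o.complete_lattice[OF K.complete])
  have cK: "carrier B = carrier K" and leK: "le B = le K" by (rule o.carrier_eq o.le_eq)+
  note con = contact[unfolded cK]
  have Xp: "openin X (U - {p})" if "openin X U" for U
    using that p K.Hausdorff by (intro openin_diff) (auto simp: closedin_Hausdorff_sing_eq)
  \<comment> \<open>As \<open>p\<close> is not isolated, no nonempty open set is exhausted by
    \<open>p\<close>; C1 and BC3 rest on this.\<close>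
  have ne: "op - {p} \<noteq> {}" if "openin X op" "op \<noteq> {}" for op
  proof
    assume "op - {p} = {}"
    then have "op = {p}" using that by auto
    then show False using that p by simp
  qed
  have wi: "a \<lless>\<^bsub>B\<^esub> b \<longleftrightarrow> f a - K.op b \<subseteq> {p}" if "a \<in> carrier K" "b \<in> carrier K" for a b
    using that K.subset[of a] by (auto simp: well_inside_def o.ops con)
  show ?thesis
  proof
    fix a assume "a \<in> carrier B" "a \<noteq> \<bottom>\<^bsub>B\<^esub>"
    then show "contact B a a"
      using ne[of "K.op a"] K.f_eq_empty[of a] K.op_subset[of a] by (auto simp: cK o.ops con)
  next
    fix a b assume ab: "a \<in> carrier B" "b \<in> carrier B"
    show "a \<noteq> \<bottom>\<^bsub>B\<^esub> \<and> b \<noteq> \<bottom>\<^bsub>B\<^esub>" if "contact B a b"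
      using that ab by (auto simp: cK con o.ops)
    show "contact B b a" if "contact B a b"
      using that ab by (auto simp: cK con)
    fix c assume "c \<in> carrier B"
    then show "contact B a (b \<squnion>\<^bsub>B\<^esub> c) = (contact B a b \<or> contact B a c)"
      using ab by (auto simp: cK con o.ops)
  next
    show "bool_ideal B (bounded_elems B)"
      unfolding bool_ideal_def bounded cK leK o.ops by (auto simp: K.le_iff)
  next
    fix a c assume a: "a \<in> bounded_elems B" and c: "c \<in> carrier B" and ac: "a \<lless>\<^bsub>B\<^esub> c"
    have ca: "a \<in> carrier K" "p \<notin> f a" "c \<in> carrier K" using a c by (auto simp: bounded cK)
    \<comment> \<open>Because \<open>f a\<close> misses \<open>p\<close>, the exceptional point in
      \<open>wi\<close> disappears, and normality applies in the open set without
      \<open>p\<close>.\<close>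
    then have "f a \<subseteq> K.op c - {p}" using ac by (auto simp: wi)
    then obtain b where b: "b \<in> carrier K" "f a \<subseteq> K.op b" "f b \<subseteq> K.op c - {p}"
      using K.normal_interpolate[of "f a" "K.op c - {p}"] ca Xp by auto
    then show "\<exists>b\<in>bounded_elems B. a \<lless>\<^bsub>B\<^esub> b \<and> b \<lless>\<^bsub>B\<^esub> c"
      using ca by (intro bexI[of _ b]) (auto simp: bounded cK wi)
  next
    fix a b assume ab: "a \<in> carrier B" "b \<in> carrier B" and "contact B a b"
    then obtain x where x: "x \<in> f a" "x \<in> f b" "x \<noteq> p" by (auto simp: con cK)
    have ab: "a \<in> carrier K" "b \<in> carrier K" using ab by (auto simp: cK)
    obtain c where c: "c \<in> carrier K" "x \<in> K.op c" "f c \<subseteq> topspace X - {p}"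
      using K.regular_interpolate[OF Xp[OF openin_topspace], of x] x K.subset ab by auto
    \<comment> \<open>\<open>x\<close> is a limit of points of \<open>K.op b\<close>, and near
      \<open>x\<close> these lie in \<open>K.op c\<close>. This puts \<open>x\<close> into the
      Boolean meet, which can be smaller than the intersection.\<close>
    have "x \<in> K.op c \<inter> X closure_of K.op b" using c x ab by (simp add: K.closure_op)
    also have "\<dots> \<subseteq> X closure_of (K.op c \<inter> K.op b)" by (rule openin_Int_closure_of_subset) simp
    also have "\<dots> = f (c \<sqinter>\<^bsub>K\<^esub> b)" using K.closure_op[of "c \<sqinter>\<^bsub>K\<^esub> b"] c ab by simp
    finally have "contact B a (c \<sqinter>\<^bsub>B\<^esub> b)" using x ab c by (auto simp: o.ops con)
    then show "\<exists>c\<in>bounded_elems B. contact B a (c \<sqinter>\<^bsub>B\<^esub> b)"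
      using c by (intro bexI[of _ c]) (auto simp: bounded cK)
  next
    fix a assume "a \<in> carrier B" "a \<noteq> \<bottom>\<^bsub>B\<^esub>"
    then have a: "a \<in> carrier K" "K.op a \<noteq> {}" by (auto simp: cK o.ops K.f_eq_empty)
    then obtain x where x: "x \<in> K.op a - {p}" using ne[of "K.op a"] by auto
    obtain b where b: "b \<in> carrier K" "x \<in> K.op b" "f b \<subseteq> K.op a - {p}"
      using K.regular_interpolate[OF Xp[OF K.open_op] x] by blast
    then have "b \<noteq> \<bottom>\<^bsub>B\<^esub>" by (auto simp: o.ops)
    then show "\<exists>b\<in>bounded_elems B. b \<noteq> \<bottom>\<^bsub>B\<^esub> \<and> b \<lless>\<^bsub>B\<^esub> a"
      using b a by (intro bexI[of _ b]) (auto simp: bounded cK wi)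
  qed
qed

section \<open>Uniqueness of realizing spaces\<close>

text \<open>The identity of \<open>K\<close> is dual to maps in both directions between the spaces,
  and uniqueness of dual maps makes their composites identities.\<close>

lemma realization_unique:
  assumes "realization K X f" "realization K X' f'"
  shows "X homeomorphic_space X'"
proof -
  interpret a: realization_pair K X f K X' f' using assms by (rule realization_pairI)
  interpret b: realization_pair K X' f' K X f using assms(2,1) by (rule realization_pairI)
  interpret aa: realization_pair K X f K X f using assms(1,1) by (rule realization_pairI)
  interpret bb: realization_pair K X' f' K X' f' using assms(2,2) by (rule realization_pairI)
  define \<phi> where "\<phi> = (\<lambda>a\<in>carrier K. a)"
  have id: "dualizes K Z h K Z h (\<lambda>x. x) \<phi>" if "realization K Z h" for Z :: "'z topology" and h
  proof -
    interpret realization K Z h by fact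
    have "{y \<in> topspace Z. y \<in> Z interior_of h a} = Z interior_of h a" for a
      using interior_of_subset_topspace by fastforce
    then show ?thesis using closure_op by (auto simp: dualizes_def \<phi>_def op_def)
  qed
  have hom: "\<phi> \<in> DHC_hom K K" using aa.dual_hom id assms by blast
  obtain u where u: "a.dual u \<phi>" using a.hom_dual[OF hom] by blast
  obtain v where v: "b.dual v \<phi>" using b.hom_dual[OF hom] by blast
  \<comment> \<open>Read off by duality from the identity map composed with itself, instead of
    computing the joins in \<open>DHC_comp\<close>.\<close>
  have idem: "DHC_comp K K \<phi> \<phi> = \<phi>"
    using aa.dual_unique_hom[OF dual_comp[OF aa.realization_pair_axioms aa.realization_pair_axioms id id] id]
      assms by auto
  have 1: "u (v x) = x" if "x \<in> topspace X" for x
    using aa.dual_unique_map[OF dual_comp[OF a.realization_pair_axioms b.realization_pair_axioms u v, unfolded idem] id that] assms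
    by simp
  have 2: "v (u x) = x" if "x \<in> topspace X'" for x
    using bb.dual_unique_map[OF dual_comp[OF b.realization_pair_axioms a.realization_pair_axioms v u, unfolded idem] id that] assms
    by simp
  have "homeomorphic_maps X X' v u"
    using u v 1 2 by (auto simp: homeomorphic_maps_def dualizes_def)
  then show ?thesis by (auto simp: homeomorphic_space_def)
qed

lemma homeomorphic_image_RC:
  assumes q: "homeomorphic_map X X' q" and F: "F \<in> carrier (RC X)"
  shows "q ` F \<in> carrier (RC X')"
proof -
  have F: "F \<subseteq> topspace X" "X closure_of (X interior_of F) = F" using F by (auto simp: RC_iff)
  have "X' closure_of (X' interior_of (q ` F)) = q ` F"
    using homeomorphic_map_interior_of[OF q F(1)]
      homeomorphic_map_closure_of[OF q interior_of_subset_topspace[of X F]] F(2) by simp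
  moreover have "q ` F \<subseteq> topspace X'" using F q homeomorphic_imp_surjective_map by blast
  ultimately show ?thesis by (simp add: RC_iff)
qed

lemma realization_homeomorphic:
  assumes "realization K X f" and q: "homeomorphic_map X X' q"
  shows "realization K X' (\<lambda>a. q ` f a)"
proof -
  interpret realization K X f by fact
  obtain q' where qq: "homeomorphic_maps X X' q q'" using q homeomorphic_map_maps by blast
  then have q': "homeomorphic_map X' X q'" by (simp add: homeomorphic_maps_map)
  have inv: "\<And>x. x \<in> topspace X \<Longrightarrow> q' (q x) = x" "\<And>y. y \<in> topspace X' \<Longrightarrow> q (q' y) = y"
    using qq by (auto simp: homeomorphic_maps_def)
  have inj: "inj_on q (topspace X)" using inv by (metis inj_onI)
  have hs: "X homeomorphic_space X'" using qq by (auto simp: homeomorphic_space_def)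
  show ?thesis
  proof (rule realization.intro[OF boolean complete])
    show "compact_space X'" using compact hs homeomorphic_compact_space by blast
    show "Hausdorff_space X'" using Hausdorff hs homeomorphic_Hausdorff_space by blast
    show "contact K a b \<longleftrightarrow> q ` f a \<inter> q ` f b \<noteq> {}" if "a \<in> carrier K" "b \<in> carrier K" for a b
      using contact_iff[OF that] inj_on_image_Int[OF inj, of "f a" "f b"] subset that by (metis image_is_empty)
    show le: "a \<sqsubseteq>\<^bsub>K\<^esub> b \<longleftrightarrow> q ` f a \<subseteq> q ` f b" if "a \<in> carrier K" "b \<in> carrier K" for a b
      using le_iff[OF that] inj_on_image_subset_iff[OF inj, of "f a" "f b"] subset that by simp
    have "inj_on (\<lambda>a. q ` f a) (carrier K)"
      by (rule inj_onI) (metis le K.le_antisym order_refl)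
    moreover have srj: "\<exists>a\<in>carrier K. q ` f a = G" if G: "G \<in> carrier (RC X')" for G
    proof -
      have GX: "G \<subseteq> topspace X'" using G by (simp add: RC_iff)
      obtain a where a: "a \<in> carrier K" "f a = q' ` G"
        using surj[OF homeomorphic_image_RC[OF q' G]] by blast
      have "q ` f a = G" using inv(2) GX unfolding a(2) by (force simp: image_image)
      then show ?thesis using a(1) by blast
    qed
    moreover have "(\<lambda>a. q ` f a) ` carrier K = carrier (RC X')"
      using homeomorphic_image_RC[OF q RC] by (auto dest!: srj)
    ultimately show "bij_betw (\<lambda>a. q ` f a) (carrier K) (carrier (RC X'))"
      by (simp add: bij_betw_def)
  qed
qed

lemma realization_CA_isomorphic:
  assumes "realization K X f"
  shows "CA_isomorphic (RC X) K"
proof -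
  interpret realization K X f by fact
  define h where "h = inv_into (carrier K) f"
  have bh: "bij_betw h (carrier (RC X)) (carrier K)"
    unfolding h_def using bij by (rule bij_betw_inv_into)
  have fh: "f (h F) = F" "h F \<in> carrier K" if "F \<in> carrier (RC X)" for F
    using bij bh that by (auto simp: h_def bij_betw_def f_inv_into_f)
  have "h \<in> bool_iso (RC X) K"
    by (rule order_iso_bool_iso[OF RC_boolean_alg boolean bh]) (simp add: le_iff fh RC_le)
  moreover have "contact (RC X) F G = contact K (h F) (h G)"
    if "F \<in> carrier (RC X)" "G \<in> carrier (RC X)" for F G
    using that by (simp add: contact_iff fh) (simp add: RC_def)
  ultimately show ?thesis unfolding CA_isomorphic_def by blast
qed

lemma CA_isomorphic_realization:
  assumes X: "compact_space X" "Hausdorff_space X" and K: "boolean_alg K" "complete_lattice K"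
    and "CA_isomorphic (RC X) K"
  shows "\<exists>f. realization K X f"
proof -
  obtain h where h: "h \<in> bool_iso (RC X) K"
    and c: "\<And>F G. F \<in> carrier (RC X) \<Longrightarrow> G \<in> carrier (RC X) \<Longrightarrow> contact (RC X) F G \<longleftrightarrow> contact K (h F) (h G)"
    using assms by (auto simp: CA_isomorphic_def)
  have bh: "bij_betw h (carrier (RC X)) (carrier K)" using h by (simp add: bool_iso_def)
  define f where "f = inv_into (carrier (RC X)) h"
  have bf: "bij_betw f (carrier K) (carrier (RC X))"
    unfolding f_def using bh by (rule bij_betw_inv_into)
  have hf: "h (f a) = a" "f a \<in> carrier (RC X)" if "a \<in> carrier K" for a
    using bh bf that by (auto simp: f_def bij_betw_def f_inv_into_f)
  have "realization K X f"
  proof (rule realization.intro[OF K X bf])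
    fix a b assume ab: "a \<in> carrier K" "b \<in> carrier K"
    show "a \<sqsubseteq>\<^bsub>K\<^esub> b \<longleftrightarrow> f a \<subseteq> f b"
      using bool_iso_le[OF RC_boolean_alg K(1) h, of "f a" "f b"] hf ab by (simp add: RC_le)
    show "contact K a b \<longleftrightarrow> f a \<inter> f b \<noteq> {}"
      using c[of "f a" "f b"] hf ab by (simp add: RC_def)
  qed
  then show ?thesis by blast
qed

section \<open>Powers of a realized algebra\<close>

locale realized_power =
  fixes K :: "'a contact_alg" and X :: "'x topology" and f :: "'a \<Rightarrow> 'x set" and I :: "'i set"
  assumes K: "realization K X f"
begin

definition T :: "('i \<Rightarrow> 'x) topology" where
  "T = product_topology (\<lambda>_. X) I"

sublocale K: realization K X f by (rule K)

lemma T_compact: "compact_space T" and T_Hausdorff: "Hausdorff_space T"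
  using K.compact K.Hausdorff
  by (simp_all add: T_def compact_space_product_topology Hausdorff_space_product_topology)

lemma proj: "i \<in> I \<Longrightarrow> continuous_map T X (\<lambda>x. x i)"
  unfolding T_def using continuous_map_product_projection[of i I "\<lambda>_. X"] by simp

lemma tuple:
  assumes "\<And>i. i \<in> I \<Longrightarrow> continuous_map Y X (g i)"
  shows "continuous_map Y T (\<lambda>y. \<lambda>i\<in>I. g i y)"
  using assms unfolding T_def by (auto simp: continuous_map_componentwise)

lemma T_ext: "\<lbrakk>x \<in> topspace T; y \<in> topspace T; \<And>i. i \<in> I \<Longrightarrow> x i = y i\<rbrakk> \<Longrightarrow> x = y"
  by (auto simp: T_def intro: PiE_ext)

lemma RC_T: "realization (RC T) T (\<lambda>F. F)"
  using T_compact T_Hausdorff by (rule RC_realization)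

lemma injections_exist:
  "\<exists>\<iota>. \<forall>i\<in>I. dualizes K X f (RC T) T (\<lambda>F. F) (\<lambda>x. x i) (\<iota> i)"
proof -
  interpret KT: realization_pair K X f "RC T" T "\<lambda>F. F" using K RC_T by (rule realization_pairI)
  have "\<forall>i\<in>I. \<exists>\<psi>. KT.dual (\<lambda>x. x i) \<psi>" using KT.dual_exists proj by blast
  then show ?thesis by metis
qed

text \<open>Continuous maps into \<open>T\<close> are tuples of continuous maps into
  \<open>X\<close>, and composition with an injection corresponds to taking a coordinate. A target
  on any type is realized by its own point space, so the test type is arbitrary.\<close>

lemma sum_universal:
  assumes \<iota>: "\<forall>i\<in>I. dualizes K X f (RC T) T (\<lambda>F. F) (\<lambda>x. x i) (\<iota> i)"
  shows "DHC_sum TYPE('v) I (\<lambda>_. K) (RC T) \<iota>"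
proof -
  interpret KT: realization_pair K X f "RC T" T "\<lambda>F. F" using K RC_T by (rule realization_pairI)
  have univ: "\<exists>!h. h \<in> DHC_hom (RC T) D \<and> (\<forall>i\<in>I. DHC_comp K D h (\<iota> i) = F i)"
    if D: "CNCA D" and F: "\<And>i. i \<in> I \<Longrightarrow> F i \<in> DHC_hom K D" for D :: "'v contact_alg" and F
  proof -
    define Y where "Y = point_space D"
    define s where "s = point_real D"
    have RD: "realization D Y s" unfolding Y_def s_def by (rule CNCA_realization[OF D])
    interpret KD: realization_pair K X f D Y s using K RD by (rule realization_pairI)
    interpret TD: realization_pair "RC T" T "\<lambda>F. F" D Y s using RC_T RD by (rule realization_pairI)
    have "\<forall>i\<in>I. \<exists>u. KD.dual u (F i)" using KD.hom_dual F by blast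
    then obtain g where g: "\<And>i. i \<in> I \<Longrightarrow> KD.dual (g i) (F i)" by metis
    have comp: "KD.dual ((\<lambda>x. x i) \<circ> u) (DHC_comp K D h (\<iota> i))" if "i \<in> I" "TD.dual u h" for i u h
      using dual_comp[OF KT.realization_pair_axioms TD.realization_pair_axioms] \<iota> that by blast
    show ?thesis
    proof (rule ex_ex1I)
      have "continuous_map Y T (\<lambda>y. \<lambda>i\<in>I. g i y)" using g by (intro tuple) (simp add: dualizes_def)
      then obtain h where h: "TD.dual (\<lambda>y. \<lambda>i\<in>I. g i y) h" using TD.dual_exists by blast
      have "DHC_comp K D h (\<iota> i) = F i" if "i \<in> I" for i
        by (rule KD.dual_unique_hom[OF comp[OF that h] g[OF that]]) (simp add: that)
      then show "\<exists>h. h \<in> DHC_hom (RC T) D \<and> (\<forall>i\<in>I. DHC_comp K D h (\<iota> i) = F i)"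
        using TD.dual_hom[OF h] by blast
    next
      fix h h' assume h: "h \<in> DHC_hom (RC T) D \<and> (\<forall>i\<in>I. DHC_comp K D h (\<iota> i) = F i)"
        and h': "h' \<in> DHC_hom (RC T) D \<and> (\<forall>i\<in>I. DHC_comp K D h' (\<iota> i) = F i)"
      obtain u where u: "TD.dual u h" using TD.hom_dual h by blast
      obtain u' where u': "TD.dual u' h'" using TD.hom_dual h' by blast
      show "h = h'"
      proof (rule TD.dual_unique_hom[OF u u'])
        fix y assume y: "y \<in> topspace Y"
        have "continuous_map Y T u" "continuous_map Y T u'" using u u' by (auto simp: dualizes_def)
        then have t: "u y \<in> topspace T" "u' y \<in> topspace T" using y by (auto simp: continuous_map_def)
        show "u y = u' y"
        proof (rule T_ext[OF t])
          fix i assume i: "i \<in> I"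
          have "KD.dual ((\<lambda>x. x i) \<circ> u) (F i)" "KD.dual ((\<lambda>x. x i) \<circ> u') (F i)"
            using comp[OF i u] comp[OF i u'] h h' i by auto
          from KD.dual_unique_map[OF this y] show "u y i = u' y i" by simp
        qed
      qed
    qed
  qed
  show ?thesis
    unfolding DHC_sum_def using univ KT.D.CNCA K.CNCA KT.dual_hom \<iota> by blast
qed

text \<open>Homomorphisms into the two-element algebra of a one-point space are the points of the space
  realizing \<open>S\<close>, so the universal property for these targets alone makes \<open>q\<close> bijective.\<close>

lemma sum_realization:
  fixes S :: "'s contact_alg"
  assumes sum: "DHC_sum TYPE(('i \<Rightarrow> 'x) set) I (\<lambda>_. K) S \<iota>"
  shows "\<exists>s. realization S T s"
proof -
  have S: "CNCA S" and \<iota>: "\<And>i. i \<in> I \<Longrightarrow> \<iota> i \<in> DHC_hom K S"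
    using sum by (auto simp: DHC_sum_def)
  define Y where "Y = point_space S"
  define s where "s = point_real S"
  have RS: "realization S Y s" unfolding Y_def s_def by (rule CNCA_realization[OF S])
  interpret KS: realization_pair K X f S Y s using K RS by (rule realization_pairI)
  have "\<forall>i\<in>I. \<exists>u. KS.dual u (\<iota> i)" using KS.hom_dual \<iota> by blast
  then obtain g where g: "\<And>i. i \<in> I \<Longrightarrow> KS.dual (g i) (\<iota> i)" by metis
  define q where "q = (\<lambda>y. \<lambda>i\<in>I. g i y)"
  have q: "continuous_map Y T q"
    unfolding q_def using g by (intro tuple) (simp add: dualizes_def)
  have bij: "\<exists>!y. y \<in> topspace Y \<and> q y = x" if x: "x \<in> topspace T" for x
  proof -
    \<comment> \<open>The regular closed sets of a one-point subspace of \<open>T\<close> live on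
      the type \<open>('i \<Rightarrow> 'x) set\<close>, which is why this is the test type.\<close>
    define P where "P = subtopology T {x}"
    have tP: "topspace P = {x}" using x by (simp add: P_def)
    have "compact_space P" unfolding P_def using x by (intro compact_space_subtopology) simp
    moreover have "Hausdorff_space P" unfolding P_def by (intro Hausdorff_space_subtopology T_Hausdorff)
    ultimately have RP: "realization (RC P) P (\<lambda>F. F)" by (rule RC_realization)
    interpret KP: realization_pair K X f "RC P" P "\<lambda>F. F" using K RP by (rule realization_pairI)
    interpret SP: realization_pair S Y s "RC P" P "\<lambda>F. F" using RS RP by (rule realization_pairI)
    have "continuous_map P X (\<lambda>z. z i)" if "i \<in> I" for i
      unfolding P_def using proj[OF that] by (rule continuous_map_from_subtopology)
    then have "\<forall>i\<in>I. \<exists>\<psi>. KP.dual (\<lambda>z. z i) \<psi>" using KP.dual_exists by blast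
    then obtain F where F: "\<And>i. i \<in> I \<Longrightarrow> KP.dual (\<lambda>z. z i) (F i)" by metis
    then have ex1: "\<exists>!h. h \<in> DHC_hom S (RC P) \<and> (\<forall>i\<in>I. DHC_comp K (RC P) h (\<iota> i) = F i)"
      using sum KP.D.CNCA KP.dual_hom unfolding DHC_sum_def by blast
    have comp: "KP.dual (g i \<circ> u) (DHC_comp K (RC P) h (\<iota> i))" if "i \<in> I" "SP.dual u h" for i u h
      using dual_comp[OF KS.realization_pair_axioms SP.realization_pair_axioms g] that by blast
    \<comment> \<open>A homomorphism into \<open>RC P\<close> amounts to a point \<open>u x\<close>
      of \<open>Y\<close>. The universal property for the family \<open>F\<close> thus says that
      \<open>q\<close> maps exactly one point of \<open>Y\<close> to \<open>x\<close>.\<close>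
    have iff: "(\<forall>i\<in>I. DHC_comp K (RC P) h (\<iota> i) = F i) \<longleftrightarrow> q (u x) = x" if u: "SP.dual u h" for u h
    proof -
      have "u x \<in> topspace Y" using u tP by (auto simp: dualizes_def continuous_map_def)
      then have qu: "q (u x) \<in> topspace T" using q by (auto simp: continuous_map_def)
      have "DHC_comp K (RC P) h (\<iota> i) = F i \<longleftrightarrow> q (u x) i = x i" if i: "i \<in> I" for i
      proof
        assume "DHC_comp K (RC P) h (\<iota> i) = F i"
        then have "KP.dual (g i \<circ> u) (F i)" using comp[OF i u] by simp
        from KP.dual_unique_map[OF this F[OF i], of x] show "q (u x) i = x i"
          using tP i by (simp add: q_def)
      next
        assume "q (u x) i = x i"
        then show "DHC_comp K (RC P) h (\<iota> i) = F i"
          using tP i by (intro KP.dual_unique_hom[OF comp[OF i u] F[OF i]]) (simp add: q_def)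
      qed
      then show ?thesis using T_ext[OF qu x] by auto
    qed
    have const: "\<exists>h. SP.dual (\<lambda>_. y) h" if "y \<in> topspace Y" for y
      by (rule SP.dual_exists) (simp add: that)
    show ?thesis
    proof (rule ex_ex1I)
      obtain h where h: "h \<in> DHC_hom S (RC P)" "\<forall>i\<in>I. DHC_comp K (RC P) h (\<iota> i) = F i"
        using ex1 by blast
      obtain u where u: "SP.dual u h" using SP.hom_dual h(1) by blast
      moreover have "u x \<in> topspace Y" using u tP by (auto simp: dualizes_def continuous_map_def)
      ultimately show "\<exists>y. y \<in> topspace Y \<and> q y = x" using iff[OF u] h(2) by blast
    next
      fix y y' assume y: "y \<in> topspace Y \<and> q y = x" and y': "y' \<in> topspace Y \<and> q y' = x"
      obtain h where h: "SP.dual (\<lambda>_. y) h" using const y by blast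
      obtain h' where h': "SP.dual (\<lambda>_. y') h'" using const y' by blast
      have "h = h'"
        using ex1 iff[OF h] iff[OF h'] y y' SP.dual_hom[OF h] SP.dual_hom[OF h'] by blast
      then show "y = y'" using SP.dual_unique_map[OF h, of "\<lambda>_. y'" x] h' tP by simp
    qed
  qed
  have "homeomorphic_map Y T q"
  proof (rule continuous_imp_homeomorphic_map[OF q KS.D.compact T_Hausdorff])
    have qT: "q y \<in> topspace T" if "y \<in> topspace Y" for y
      using q that by (auto simp: continuous_map_def)
    show "q ` topspace Y = topspace T" using qT bij by (force simp: image_iff)
    show "inj_on q (topspace Y)" using qT bij by (intro inj_onI) metis
  qed
  then show ?thesis using realization_homeomorphic[OF RS] by blast
qed

end

lemma sum_power:
  fixes X :: "'x topology" and I :: "'i set"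
  assumes K: "realization K X f" and T: "T = product_topology (\<lambda>_. X) I"
  shows "(\<exists>(S :: ('i \<Rightarrow> 'x) set contact_alg) \<iota>.
       DHC_sum TYPE(('i \<Rightarrow> 'x) set) I (\<lambda>_. K) S \<iota> \<and> DHC_sum TYPE('t) I (\<lambda>_. K) S \<iota> \<and>
       CA_isomorphic (RC T) S)"
    and "\<And>(S :: 's contact_alg) \<iota>. DHC_sum TYPE(('i \<Rightarrow> 'x) set) I (\<lambda>_. K) S \<iota> \<Longrightarrow>
       CA_isomorphic (RC T) S \<and>
       (\<forall>Y :: 'y topology. compact_space Y \<and> Hausdorff_space Y \<and> CA_isomorphic (RC Y) S \<longrightarrow>
          Y homeomorphic_space T)"
proof -
  interpret p: realized_power K X f I using K by (rule realized_power.intro)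
  have T: "T = p.T" by (simp add: T p.T_def)
  obtain \<iota> where \<iota>: "\<forall>i\<in>I. dualizes K X f (RC T) T (\<lambda>F. F) (\<lambda>x. x i) (\<iota> i)"
    unfolding T using p.injections_exist by blast
  show "\<exists>(S :: ('i \<Rightarrow> 'x) set contact_alg) \<iota>.
       DHC_sum TYPE(('i \<Rightarrow> 'x) set) I (\<lambda>_. K) S \<iota> \<and> DHC_sum TYPE('t) I (\<lambda>_. K) S \<iota> \<and>
       CA_isomorphic (RC T) S"
    unfolding T
    by (intro exI[of _ "RC p.T"] exI[of _ \<iota>] conjI p.sum_universal \<iota>[unfolded T]
        realization_CA_isomorphic[OF p.RC_T])
  fix S :: "'s contact_alg" and \<iota>
  assume "DHC_sum TYPE(('i \<Rightarrow> 'x) set) I (\<lambda>_. K) S \<iota>"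
  then obtain s where s: "realization S T s" using p.sum_realization unfolding T by blast
  have "Y homeomorphic_space T"
    if "compact_space Y" "Hausdorff_space Y" "CA_isomorphic (RC Y) S" for Y :: "'y topology"
    using CA_isomorphic_realization[OF that(1,2) realization.boolean[OF s] realization.complete[OF s] that(3)]
      realization_unique s by blast
  then show "CA_isomorphic (RC T) S \<and>
       (\<forall>Y :: 'y topology. compact_space Y \<and> Hausdorff_space Y \<and> CA_isomorphic (RC Y) S \<longrightarrow>
          Y homeomorphic_space T)"
    using realization_CA_isomorphic[OF s] by blast
qed

section \<open>Complete Boolean algebras with matching dense families\<close>

text \<open>Density as in forcing. Repeated indices are allowed, which suits the redundant codes in
  \<open>pieces\<close>.\<close>

locale dense_family = boolean_alg B + complete_lattice B for B (structure) +
  fixes J :: "'j set" and e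
  assumes e_closed: "s \<in> J \<Longrightarrow> e s \<in> carrier B" and e_nonzero: "s \<in> J \<Longrightarrow> e s \<noteq> \<bottom>"
    and dense: "\<lbrakk>x \<in> carrier B; x \<noteq> \<bottom>\<rbrakk> \<Longrightarrow> \<exists>s\<in>J. e s \<sqsubseteq> x"
begin

lemma le_iff_dense:
  assumes xy: "x \<in> carrier B" "y \<in> carrier B"
  shows "x \<sqsubseteq> y \<longleftrightarrow> (\<forall>s\<in>J. e s \<sqsubseteq> x \<longrightarrow> e s \<sqsubseteq> y)"
proof
  assume "x \<sqsubseteq> y"
  then show "\<forall>s\<in>J. e s \<sqsubseteq> x \<longrightarrow> e s \<sqsubseteq> y"
    using le_trans[of _ x y] xy e_closed by simp
next
  assume r: "\<forall>s\<in>J. e s \<sqsubseteq> x \<longrightarrow> e s \<sqsubseteq> y"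
  show "x \<sqsubseteq> y"
  proof (rule ccontr)
    assume "\<not> x \<sqsubseteq> y"
    then have "x \<sqinter> compl B y \<noteq> \<bottom>" using xy le_iff_meet_compl by simp
    then obtain s where s: "s \<in> J" "e s \<sqsubseteq> x \<sqinter> compl B y" using dense xy by (meson compl_closed meet_closed)
    then have "e s \<sqsubseteq> x" "e s \<sqsubseteq> compl B y"
      using xy e_closed[OF s(1)] by (auto simp: le_iff_ultra ultra_simps)
    moreover have "e s \<sqsubseteq> y" using r s(1) calculation by blast
    ultimately have "e s = \<bottom>"
      using xy e_closed[OF s(1)] by (auto simp: le_iff_ultra eq_iff_ultra ultra_simps)
    then show False using e_nonzero s by blast
  qed
qed

text \<open>If part of \<open>e s\<close> lay outside \<open>x\<close>, a member of the family below
  that part would meet \<open>e s\<close>. The order is thereby expressed through disjointness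
  within the family, which is why compatibility alone determines the complete algebra.\<close>

lemma le_iff_disjoint:
  assumes s: "s \<in> J" and x: "x \<in> carrier B"
  shows "e s \<sqsubseteq> x \<longleftrightarrow> (\<forall>t\<in>J. e t \<sqsubseteq> compl B x \<longrightarrow> e s \<sqinter> e t = \<bottom>)"
proof
  assume le: "e s \<sqsubseteq> x"
  show "\<forall>t\<in>J. e t \<sqsubseteq> compl B x \<longrightarrow> e s \<sqinter> e t = \<bottom>"
  proof (intro ballI impI)
    fix t assume t: "t \<in> J" "e t \<sqsubseteq> compl B x"
    show "e s \<sqinter> e t = \<bottom>"
      using le t(2) e_closed[OF s] e_closed[OF t(1)] x
      by (auto simp: le_iff_ultra eq_iff_ultra ultra_simps)
  qed
next
  assume r: "\<forall>t\<in>J. e t \<sqsubseteq> compl B x \<longrightarrow> e s \<sqinter> e t = \<bottom>"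
  have es: "e s \<in> carrier B" by (rule e_closed[OF s])
  show "e s \<sqsubseteq> x"
  proof (rule ccontr)
    assume "\<not> e s \<sqsubseteq> x"
    then have "e s \<sqinter> compl B x \<noteq> \<bottom>" using es x le_iff_meet_compl by simp
    then obtain t where t: "t \<in> J" "e t \<sqsubseteq> e s \<sqinter> compl B x" using dense es x by (meson compl_closed meet_closed)
    have et: "e t \<in> carrier B" by (rule e_closed[OF t(1)])
    have l: "e t \<sqsubseteq> e s" "e t \<sqsubseteq> compl B x"
      using t(2) es x et by (auto simp: le_iff_ultra ultra_simps)
    then have "e s \<sqinter> e t = \<bottom>" using r t by blast
    then have "e t = \<bottom>" using l(1) es et by (auto simp: le_iff_ultra eq_iff_ultra ultra_simps)
    then show False using e_nonzero t by blast
  qed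
qed

end

locale dense_match = A: dense_family A J e + B: dense_family B J d for A B J e d +
  assumes compat: "\<lbrakk>s \<in> J; t \<in> J\<rbrakk> \<Longrightarrow> e s \<sqinter>\<^bsub>A\<^esub> e t = \<bottom>\<^bsub>A\<^esub> \<longleftrightarrow> d s \<sqinter>\<^bsub>B\<^esub> d t = \<bottom>\<^bsub>B\<^esub>"
begin

definition match where
  "match x = \<Squnion>\<^bsub>B\<^esub> (d ` {s \<in> J. e s \<sqsubseteq>\<^bsub>A\<^esub> x})"

lemma match_closed: "match x \<in> carrier B"
  unfolding match_def using B.e_closed by (intro B.sup_closed) auto

lemma le_match:
  assumes s: "s \<in> J" and x: "x \<in> carrier A"
  shows "d s \<sqsubseteq>\<^bsub>B\<^esub> match x \<longleftrightarrow> e s \<sqsubseteq>\<^bsub>A\<^esub> x"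
proof
  have S: "d ` {s \<in> J. e s \<sqsubseteq>\<^bsub>A\<^esub> x} \<subseteq> carrier B" using B.e_closed by auto
  show "d s \<sqsubseteq>\<^bsub>B\<^esub> match x" if "e s \<sqsubseteq>\<^bsub>A\<^esub> x"
    unfolding match_def using S that s by (intro B.sup_upper) auto
  assume le: "d s \<sqsubseteq>\<^bsub>B\<^esub> match x"
  show "e s \<sqsubseteq>\<^bsub>A\<^esub> x"
    unfolding A.le_iff_disjoint[OF s x]
  proof (intro ballI impI)
    fix t assume t: "t \<in> J" "e t \<sqsubseteq>\<^bsub>A\<^esub> compl A x"
    have dt: "d t \<in> carrier B" by (rule B.e_closed[OF t(1)])
    \<comment> \<open>Each member of the join is disjoint from \<open>d t\<close>; having
      \<open>compl B (d t)\<close> as an upper bound passes this to the join.\<close>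
    have "match x \<sqsubseteq>\<^bsub>B\<^esub> compl B (d t)"
      unfolding match_def
    proof (rule B.sup_least[OF S])
      fix y assume "y \<in> d ` {s \<in> J. e s \<sqsubseteq>\<^bsub>A\<^esub> x}"
      then obtain s' where s': "s' \<in> J" "e s' \<sqsubseteq>\<^bsub>A\<^esub> x" "y = d s'" by blast
      then have "e s' \<sqinter>\<^bsub>A\<^esub> e t = \<bottom>\<^bsub>A\<^esub>" using A.le_iff_disjoint[OF s'(1) x] t by blast
      then have "d s' \<sqinter>\<^bsub>B\<^esub> d t = \<bottom>\<^bsub>B\<^esub>" using compat[OF s'(1) t(1)] by blast
      then show "y \<sqsubseteq>\<^bsub>B\<^esub> compl B (d t)"
        using B.meet_bot_iff[OF B.e_closed[OF s'(1)] dt] s'(3) by simp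
    qed (use dt in simp)
    then have "d s \<sqsubseteq>\<^bsub>B\<^esub> compl B (d t)"
      using B.le_trans[OF le _ B.e_closed[OF s] match_closed] dt by simp
    then have "d s \<sqinter>\<^bsub>B\<^esub> d t = \<bottom>\<^bsub>B\<^esub>" using B.meet_bot_iff[OF B.e_closed[OF s] dt] by simp
    then show "e s \<sqinter>\<^bsub>A\<^esub> e t = \<bottom>\<^bsub>A\<^esub>" using compat[OF s t(1)] by blast
  qed
qed

lemma match_le: "\<lbrakk>x \<in> carrier A; y \<in> carrier A\<rbrakk> \<Longrightarrow> x \<sqsubseteq>\<^bsub>A\<^esub> y \<longleftrightarrow> match x \<sqsubseteq>\<^bsub>B\<^esub> match y"
  by (simp add: A.le_iff_dense[of x y] B.le_iff_dense[OF match_closed match_closed] le_match)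

end

lemma (in dense_match) match_bij: "bij_betw match (carrier A) (carrier B)"
proof -
  \<comment> \<open>The hypotheses are symmetric, so the same construction in the opposite direction
    gives the inverse.\<close>
  interpret sw: dense_match B A J d e using compat by unfold_locales auto
  have "inj_on match (carrier A)"
    by (rule inj_onI) (metis match_le A.le_antisym B.le_refl match_closed)
  moreover have "match (sw.match b) = b" if b: "b \<in> carrier B" for b
  proof (rule B.le_antisym)
    show "match (sw.match b) \<sqsubseteq>\<^bsub>B\<^esub> b" "b \<sqsubseteq>\<^bsub>B\<^esub> match (sw.match b)"
      using b by (simp_all add: B.le_iff_dense match_closed le_match sw.match_closed sw.le_match)
  qed (use b match_closed in auto)
  then have "carrier B \<subseteq> match ` carrier A" using sw.match_closed by (metis image_eqI subsetI)
  ultimately show ?thesis using match_closed by (auto simp: bij_betw_def)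
qed

context dense_match
begin

lemma e_le_iff_d:
  assumes "s \<in> J" "t \<in> J"
  shows "e t \<sqsubseteq>\<^bsub>A\<^esub> e s \<longleftrightarrow> d t \<sqsubseteq>\<^bsub>B\<^esub> d s"
proof -
  have "e t \<sqsubseteq>\<^bsub>A\<^esub> e s \<longleftrightarrow> (\<forall>t'\<in>J. e t' \<sqinter>\<^bsub>A\<^esub> e s = \<bottom>\<^bsub>A\<^esub> \<longrightarrow> e t \<sqinter>\<^bsub>A\<^esub> e t' = \<bottom>\<^bsub>A\<^esub>)"
    using A.le_iff_disjoint[OF assms(2) A.e_closed[OF assms(1)]] A.meet_bot_iff A.e_closed assms(1)
    by simp
  also have "\<dots> \<longleftrightarrow> (\<forall>t'\<in>J. d t' \<sqinter>\<^bsub>B\<^esub> d s = \<bottom>\<^bsub>B\<^esub> \<longrightarrow> d t \<sqinter>\<^bsub>B\<^esub> d t' = \<bottom>\<^bsub>B\<^esub>)"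
    using compat assms by simp
  also have "\<dots> \<longleftrightarrow> d t \<sqsubseteq>\<^bsub>B\<^esub> d s"
    using B.le_iff_disjoint[OF assms(2) B.e_closed[OF assms(1)]] B.meet_bot_iff B.e_closed assms(1)
    by simp
  finally show ?thesis .
qed

lemma match_e:
  assumes "s \<in> J"
  shows "match (e s) = d s"
proof -
  have iff: "d t \<sqsubseteq>\<^bsub>B\<^esub> match (e s) \<longleftrightarrow> d t \<sqsubseteq>\<^bsub>B\<^esub> d s" if "t \<in> J" for t
    using le_match[OF that A.e_closed[OF assms]] e_le_iff_d[OF assms that] by simp
  have c: "match (e s) \<in> carrier B" "d s \<in> carrier B" by (rule match_closed, rule B.e_closed[OF assms])
  show ?thesis
    using iff B.le_iff_dense[OF c] B.le_iff_dense[OF c(2,1)] B.le_antisym[OF _ _ c] by simp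
qed

text \<open>For identifying the image of an element outside the dense family, such as a
  \<open>q_elem\<close>: below each member there should be one that decides both \<open>x\<close>
  and \<open>F\<close> with the same answer.\<close>

lemma match_eqI:
  assumes x: "x \<in> carrier A" and F: "F \<in> carrier B"
    and ref: "\<And>s. s \<in> J \<Longrightarrow> \<exists>t\<in>J. e t \<sqsubseteq>\<^bsub>A\<^esub> e s \<and>
      ((e t \<sqsubseteq>\<^bsub>A\<^esub> x \<and> d t \<sqsubseteq>\<^bsub>B\<^esub> F) \<or> (e t \<sqsubseteq>\<^bsub>A\<^esub> compl A x \<and> d t \<sqsubseteq>\<^bsub>B\<^esub> compl B F))"
  shows "match x = F"
proof (rule B.le_antisym)
  have notA: False if "t \<in> J" "e t \<sqsubseteq>\<^bsub>A\<^esub> y" "e t \<sqsubseteq>\<^bsub>A\<^esub> compl A y" "y \<in> carrier A" for t y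
    using that A.e_nonzero[OF that(1)] A.e_closed[OF that(1)]
    by (auto simp: A.le_iff_ultra A.eq_iff_ultra ultra_simps)
  have notB: False if "t \<in> J" "d t \<sqsubseteq>\<^bsub>B\<^esub> y" "d t \<sqsubseteq>\<^bsub>B\<^esub> compl B y" "y \<in> carrier B" for t y
    using that B.e_nonzero[OF that(1)] B.e_closed[OF that(1)]
    by (auto simp: B.le_iff_ultra B.eq_iff_ultra ultra_simps)
  show "match x \<sqsubseteq>\<^bsub>B\<^esub> F"
  proof (rule ccontr)
    assume "\<not> ?thesis"
    then have "match x \<sqinter>\<^bsub>B\<^esub> compl B F \<noteq> \<bottom>\<^bsub>B\<^esub>" using match_closed F B.le_iff_meet_compl by simp
    then obtain s where s: "s \<in> J" "d s \<sqsubseteq>\<^bsub>B\<^esub> match x \<sqinter>\<^bsub>B\<^esub> compl B F"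
      using B.dense[OF B.meet_closed[OF match_closed B.compl_closed[OF F]]] by blast
    then have ds: "d s \<sqsubseteq>\<^bsub>B\<^esub> match x" "d s \<sqsubseteq>\<^bsub>B\<^esub> compl B F"
      using F match_closed B.e_closed[OF s(1)] by (auto simp: B.le_iff_ultra ultra_simps)
    obtain t where t: "t \<in> J" "e t \<sqsubseteq>\<^bsub>A\<^esub> e s"
      "(e t \<sqsubseteq>\<^bsub>A\<^esub> x \<and> d t \<sqsubseteq>\<^bsub>B\<^esub> F) \<or> (e t \<sqsubseteq>\<^bsub>A\<^esub> compl A x \<and> d t \<sqsubseteq>\<^bsub>B\<^esub> compl B F)"
      using ref[OF s(1)] by blast
    have "d t \<sqsubseteq>\<^bsub>B\<^esub> compl B F"
      using B.le_trans[OF _ ds(2)] e_le_iff_d[OF s(1) t(1)] t(1,2) s(1) F B.e_closed by simp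
    then have "\<not> d t \<sqsubseteq>\<^bsub>B\<^esub> F" using notB[OF t(1)] F by blast
    then have "e t \<sqsubseteq>\<^bsub>A\<^esub> compl A x" using t(3) by blast
    moreover have "e t \<sqsubseteq>\<^bsub>A\<^esub> x"
      using A.le_trans[OF t(2)] le_match[OF s(1) x] ds(1) A.e_closed s(1) t(1) x by simp
    ultimately show False using notA[OF t(1)] x by blast
  qed
  show "F \<sqsubseteq>\<^bsub>B\<^esub> match x"
    unfolding B.le_iff_dense[OF F match_closed]
  proof (intro ballI impI)
    fix s0 assume s0: "s0 \<in> J" "d s0 \<sqsubseteq>\<^bsub>B\<^esub> F"
    show "d s0 \<sqsubseteq>\<^bsub>B\<^esub> match x"
    proof (rule ccontr)
      assume "\<not> ?thesis"
      then have "\<not> e s0 \<sqsubseteq>\<^bsub>A\<^esub> x" using le_match s0 x by blast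
      then have "e s0 \<sqinter>\<^bsub>A\<^esub> compl A x \<noteq> \<bottom>\<^bsub>A\<^esub>" using A.e_closed[OF s0(1)] x A.le_iff_meet_compl by simp
      then obtain s where s: "s \<in> J" "e s \<sqsubseteq>\<^bsub>A\<^esub> e s0 \<sqinter>\<^bsub>A\<^esub> compl A x"
        using A.dense[OF A.meet_closed[OF A.e_closed[OF s0(1)] A.compl_closed[OF x]]] by blast
      then have es: "e s \<sqsubseteq>\<^bsub>A\<^esub> e s0" "e s \<sqsubseteq>\<^bsub>A\<^esub> compl A x"
        using x A.e_closed[OF s(1)] A.e_closed[OF s0(1)] by (auto simp: A.le_iff_ultra ultra_simps)
      obtain t where t: "t \<in> J" "e t \<sqsubseteq>\<^bsub>A\<^esub> e s"
        "(e t \<sqsubseteq>\<^bsub>A\<^esub> x \<and> d t \<sqsubseteq>\<^bsub>B\<^esub> F) \<or> (e t \<sqsubseteq>\<^bsub>A\<^esub> compl A x \<and> d t \<sqsubseteq>\<^bsub>B\<^esub> compl B F)"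
        using ref[OF s(1)] by blast
      have "e t \<sqsubseteq>\<^bsub>A\<^esub> compl A x"
        using A.le_trans[OF t(2) es(2)] x A.e_closed s(1) t(1) by simp
      then have "\<not> e t \<sqsubseteq>\<^bsub>A\<^esub> x" using notA[OF t(1)] x by blast
      then have "d t \<sqsubseteq>\<^bsub>B\<^esub> compl B F" using t(3) by blast
      moreover have "e t \<sqsubseteq>\<^bsub>A\<^esub> e s0"
        using A.le_trans[OF t(2) es(1)] A.e_closed s(1) s0(1) t(1) by simp
      then have "d t \<sqsubseteq>\<^bsub>B\<^esub> F"
        using B.le_trans[OF _ s0(2)] e_le_iff_d[OF s0(1) t(1)] B.e_closed s0(1) t(1) F by simp
      ultimately show False using notB[OF t(1)] F by blast
    qed
  qed
qed (use match_closed F in auto)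

end

section \<open>The completed free product\<close>

text \<open>This and the next two lemmas compute operations in a bare partial order, before it is
  known to be a lattice.\<close>

lemma po_meet_eq:
  assumes "partial_order D" "x \<in> carrier D" "y \<in> carrier D" "z \<in> carrier D" "z \<sqsubseteq>\<^bsub>D\<^esub> x" "z \<sqsubseteq>\<^bsub>D\<^esub> y"
    and "\<And>w. \<lbrakk>w \<in> carrier D; w \<sqsubseteq>\<^bsub>D\<^esub> x; w \<sqsubseteq>\<^bsub>D\<^esub> y\<rbrakk> \<Longrightarrow> w \<sqsubseteq>\<^bsub>D\<^esub> z"
  shows "greatest D z (Lower D {x, y}) \<and> x \<sqinter>\<^bsub>D\<^esub> y = z"
proof -
  interpret partial_order D by fact
  have g: "greatest D z (Lower D {x, y})" using assms by (auto simp: greatest_def Lower_def)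
  then show ?thesis unfolding meet_def inf_def by (metis (no_types, lifting) greatest_unique someI)
qed

lemma po_join_eq:
  assumes "partial_order D" "x \<in> carrier D" "y \<in> carrier D" "z \<in> carrier D" "x \<sqsubseteq>\<^bsub>D\<^esub> z" "y \<sqsubseteq>\<^bsub>D\<^esub> z"
    and "\<And>w. \<lbrakk>w \<in> carrier D; x \<sqsubseteq>\<^bsub>D\<^esub> w; y \<sqsubseteq>\<^bsub>D\<^esub> w\<rbrakk> \<Longrightarrow> z \<sqsubseteq>\<^bsub>D\<^esub> w"
  shows "least D z (Upper D {x, y}) \<and> x \<squnion>\<^bsub>D\<^esub> y = z"
proof -
  interpret partial_order D by fact
  have g: "least D z (Upper D {x, y})" using assms by (auto simp: least_def Upper_def)
  then show ?thesis unfolding join_def sup_def by (metis (no_types, lifting) least_unique someI)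
qed

lemma po_bottom_top_eq:
  assumes "partial_order D" "b \<in> carrier D" "t \<in> carrier D"
    and "\<And>w. w \<in> carrier D \<Longrightarrow> b \<sqsubseteq>\<^bsub>D\<^esub> w \<and> w \<sqsubseteq>\<^bsub>D\<^esub> t"
  shows "least D b (carrier D) \<and> \<bottom>\<^bsub>D\<^esub> = b \<and> greatest D t (carrier D) \<and> \<top>\<^bsub>D\<^esub> = t"
proof -
  interpret partial_order D by fact
  have g: "least D b (carrier D)" "greatest D t (carrier D)"
    using assms by (auto simp: least_def greatest_def)
  then have "\<bottom>\<^bsub>D\<^esub> = b" unfolding bottom_def by (metis (no_types, lifting) least_unique someI)
  moreover have "\<top>\<^bsub>D\<^esub> = t" using g unfolding top_def by (metis (no_types, lifting) greatest_unique someI)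
  ultimately show ?thesis using g by blast
qed

text \<open>The universal property of the free product is assumed only for test algebras on the type
  \<open>'a\<close>, and subalgebras of \<open>A\<close> are a supply of such algebras.\<close>

lemma subalgebra:
  fixes A :: "'a gorder"
  assumes "boolean_alg A" and S: "S \<subseteq> carrier A" "\<bottom>\<^bsub>A\<^esub> \<in> S"
    and meet: "\<And>x y. x \<in> S \<Longrightarrow> y \<in> S \<Longrightarrow> x \<sqinter>\<^bsub>A\<^esub> y \<in> S" and compl: "\<And>x. x \<in> S \<Longrightarrow> compl A x \<in> S"
    and D: "D = \<lparr>carrier = S, eq = (=), le = le A\<rparr>"
  shows "boolean_alg D \<and> \<bottom>\<^bsub>D\<^esub> = \<bottom>\<^bsub>A\<^esub> \<and> \<top>\<^bsub>D\<^esub> = \<top>\<^bsub>A\<^esub> \<and>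
    (\<forall>x\<in>S. \<forall>y\<in>S. x \<sqinter>\<^bsub>D\<^esub> y = x \<sqinter>\<^bsub>A\<^esub> y \<and> x \<squnion>\<^bsub>D\<^esub> y = x \<squnion>\<^bsub>A\<^esub> y) \<and> (\<forall>x\<in>S. compl D x = compl A x)"
proof -
  interpret A: boolean_alg A by fact
  have join: "x \<squnion>\<^bsub>A\<^esub> y \<in> S" if "x \<in> S" "y \<in> S" for x y
  proof -
    have xy: "x \<in> carrier A" "y \<in> carrier A" using that S by auto
    have "x \<squnion>\<^bsub>A\<^esub> y = compl A (compl A x \<sqinter>\<^bsub>A\<^esub> compl A y)"
      using xy by (simp add: A.eq_iff_ultra ultra_simps)
    then show ?thesis using meet compl that by simp
  qed
  have top: "\<top>\<^bsub>A\<^esub> \<in> S" using compl[OF S(2)] by simp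
  have Dc: "carrier D = S" and Dl: "le D = le A" using D by simp_all
  have po: "partial_order D"
  proof -
    have Sc: "x \<in> carrier A" if "x \<in> S" for x using S that by auto
    show ?thesis
    proof (unfold_locales, simp_all add: D Sc)
      fix x y assume "x \<sqsubseteq>\<^bsub>A\<^esub> y" "y \<sqsubseteq>\<^bsub>A\<^esub> x" "x \<in> S" "y \<in> S"
      then show "x = y" using A.le_antisym Sc by simp
    next
      fix x y z assume "x \<sqsubseteq>\<^bsub>A\<^esub> y" "y \<sqsubseteq>\<^bsub>A\<^esub> z" "x \<in> S" "y \<in> S" "z \<in> S"
      then show "x \<sqsubseteq>\<^bsub>A\<^esub> z" using A.le_trans[of x y z] Sc by simp
    qed
  qed
  have m: "greatest D (x \<sqinter>\<^bsub>A\<^esub> y) (Lower D {x, y}) \<and> x \<sqinter>\<^bsub>D\<^esub> y = x \<sqinter>\<^bsub>A\<^esub> y" if "x \<in> S" "y \<in> S" for x y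
    using that S meet A.meet_left A.meet_right A.meet_le
    by (intro po_meet_eq[OF po]) (auto simp: Dc Dl subset_iff)
  have j: "least D (x \<squnion>\<^bsub>A\<^esub> y) (Upper D {x, y}) \<and> x \<squnion>\<^bsub>D\<^esub> y = x \<squnion>\<^bsub>A\<^esub> y" if "x \<in> S" "y \<in> S" for x y
    using that S join A.join_left A.join_right A.join_le
    by (intro po_join_eq[OF po]) (auto simp: Dc Dl subset_iff)
  have bt: "least D \<bottom>\<^bsub>A\<^esub> (carrier D) \<and> \<bottom>\<^bsub>D\<^esub> = \<bottom>\<^bsub>A\<^esub> \<and> greatest D \<top>\<^bsub>A\<^esub> (carrier D) \<and> \<top>\<^bsub>D\<^esub> = \<top>\<^bsub>A\<^esub>"
    using S top by (intro po_bottom_top_eq[OF po]) (auto simp: Dc Dl)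
  interpret D: partial_order D by (rule po)
  have b: "boolean_alg D"
  proof
    fix x y assume "x \<in> carrier D" "y \<in> carrier D"
    then show "\<exists>s. least D s (Upper D {x, y})" "\<exists>s. greatest D s (Lower D {x, y})"
      using m j Dc by blast+
  next
    show "\<exists>x. least D x (carrier D)" "\<exists>x. greatest D x (carrier D)" using bt by blast+
  next
    fix a b c assume "a \<in> carrier D" "b \<in> carrier D" "c \<in> carrier D"
    then show "a \<sqinter>\<^bsub>D\<^esub> (b \<squnion>\<^bsub>D\<^esub> c) = a \<sqinter>\<^bsub>D\<^esub> b \<squnion>\<^bsub>D\<^esub> (a \<sqinter>\<^bsub>D\<^esub> c)"
      using S m j meet join A.distrib by (simp add: Dc subset_iff)
  next
    fix a assume "a \<in> carrier D"
    then show "\<exists>b\<in>carrier D. a \<sqinter>\<^bsub>D\<^esub> b = \<bottom>\<^bsub>D\<^esub> \<and> a \<squnion>\<^bsub>D\<^esub> b = \<top>\<^bsub>D\<^esub>"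
      using S m j compl bt A.meet_compl A.join_compl
      by (intro bexI[of _ "compl A a"]) (auto simp: Dc subset_iff)
  qed
  have "compl D x = compl A x" if "x \<in> S" for x
    using that S m j compl bt A.meet_compl A.join_compl
    by (intro boolean_alg.compl_eqI[OF b]) (auto simp: Dc subset_iff)
  then show ?thesis using b bt m j by blast
qed

lemma pow_alg_ops:
  "\<bottom>\<^bsub>pow_alg U\<^esub> = {}" "\<top>\<^bsub>pow_alg U\<^esub> = U"
  "\<lbrakk>x \<subseteq> U; y \<subseteq> U\<rbrakk> \<Longrightarrow> x \<sqinter>\<^bsub>pow_alg U\<^esub> y = x \<inter> y"
  "\<lbrakk>x \<subseteq> U; y \<subseteq> U\<rbrakk> \<Longrightarrow> x \<squnion>\<^bsub>pow_alg U\<^esub> y = x \<union> y"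
  "x \<subseteq> U \<Longrightarrow> compl (pow_alg U) x = U - x"
proof -
  \<comment> \<open>In a discrete space every set is regular closed, so the operations are those
    already computed for \<open>RC\<close>.\<close>
  let ?X = "discrete_topology U"
  have c: "carrier (RC ?X) = Pow U"
    by (auto simp: RC_def discrete_topology_closure_of interior_of_closure_of)
  interpret same_order "RC ?X" "pow_alg U"
    by unfold_locales (simp_all add: c, simp_all add: RC_def pow_alg_def)
  show "\<bottom>\<^bsub>pow_alg U\<^esub> = {}" "\<top>\<^bsub>pow_alg U\<^esub> = U"
    by (simp_all add: ops RC_bottom RC_top)
  show "x \<sqinter>\<^bsub>pow_alg U\<^esub> y = x \<inter> y" if "x \<subseteq> U" "y \<subseteq> U"
    using that by (auto simp: ops RC_meet c discrete_topology_closure_of interior_of_closure_of)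
  show "x \<squnion>\<^bsub>pow_alg U\<^esub> y = x \<union> y" if "x \<subseteq> U" "y \<subseteq> U"
    using that by (simp add: ops RC_join c)
  show "compl (pow_alg U) x = U - x" if "x \<subseteq> U"
    using that by (auto simp: ops RC_compl c discrete_topology_closure_of)
qed

locale free_completion =
  fixes A At :: "'a gorder" and \<phi> :: "nat \<Rightarrow> int set \<Rightarrow> 'a"
  assumes sum: "bool_sum TYPE('a) {1..} (\<lambda>_. pow_alg Z0) A \<phi>"
    and inj: "\<forall>i\<in>{1..}. inj_on (\<phi> i) (Pow Z0)"
    and mac: "macneille_completion A At"
begin

sublocale A: boolean_alg A using mac by (simp add: macneille_completion_def)
sublocale At: complete_lattice At using mac by (simp add: macneille_completion_def)
sublocale At: boolean_alg At using mac by (simp add: macneille_completion_def)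

lemma carrier_At: "x \<in> carrier A \<Longrightarrow> x \<in> carrier At"
  and le_At: "x \<in> carrier A \<Longrightarrow> y \<in> carrier A \<Longrightarrow> x \<sqsubseteq>\<^bsub>At\<^esub> y \<longleftrightarrow> x \<sqsubseteq>\<^bsub>A\<^esub> y"
  and sup_dense: "x \<in> carrier At \<Longrightarrow> x = \<Squnion>\<^bsub>At\<^esub> {a \<in> carrier A. a \<sqsubseteq>\<^bsub>At\<^esub> x}"
  and inf_dense: "x \<in> carrier At \<Longrightarrow> x = \<Sqinter>\<^bsub>At\<^esub> {a \<in> carrier A. x \<sqsubseteq>\<^bsub>At\<^esub> a}"
  using mac unfolding macneille_completion_def by blast+

lemma At_le_by:
  assumes "x \<in> carrier At" "y \<in> carrier At" "\<And>a. a \<in> carrier A \<Longrightarrow> a \<sqsubseteq>\<^bsub>At\<^esub> x \<Longrightarrow> a \<sqsubseteq>\<^bsub>At\<^esub> y"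
  shows "x \<sqsubseteq>\<^bsub>At\<^esub> y"
  by (subst sup_dense[OF assms(1)], rule At.sup_least) (use assms carrier_At in auto)

lemma At_le_by_inf:
  assumes "x \<in> carrier At" "y \<in> carrier At" "\<And>a. a \<in> carrier A \<Longrightarrow> y \<sqsubseteq>\<^bsub>At\<^esub> a \<Longrightarrow> x \<sqsubseteq>\<^bsub>At\<^esub> a"
  shows "x \<sqsubseteq>\<^bsub>At\<^esub> y"
  by (subst inf_dense[OF assms(2)], rule At.inf_greatest) (use assms carrier_At in auto)

text \<open>Join density of \<open>A\<close> settles meets; dually, meet density settles joins in
  \<open>At_join\<close>.\<close>

lemma At_meet:
  assumes xy: "x \<in> carrier A" "y \<in> carrier A"
  shows "x \<sqinter>\<^bsub>At\<^esub> y = x \<sqinter>\<^bsub>A\<^esub> y"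
proof (rule At.le_antisym)
  have xy': "x \<in> carrier At" "y \<in> carrier At" "x \<sqinter>\<^bsub>A\<^esub> y \<in> carrier At"
    using xy carrier_At by auto
  show "x \<sqinter>\<^bsub>At\<^esub> y \<sqsubseteq>\<^bsub>At\<^esub> x \<sqinter>\<^bsub>A\<^esub> y"
  proof (rule At_le_by)
    fix a assume a: "a \<in> carrier A" "a \<sqsubseteq>\<^bsub>At\<^esub> x \<sqinter>\<^bsub>At\<^esub> y"
    have "a \<sqsubseteq>\<^bsub>At\<^esub> x" "a \<sqsubseteq>\<^bsub>At\<^esub> y"
      using a(2) xy' carrier_At[OF a(1)] by (auto simp: At.le_iff_ultra ultra_simps)
    then show "a \<sqsubseteq>\<^bsub>At\<^esub> x \<sqinter>\<^bsub>A\<^esub> y" using a(1) xy by (simp add: le_At A.meet_le)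
  qed (use xy' in auto)
  show "x \<sqinter>\<^bsub>A\<^esub> y \<sqsubseteq>\<^bsub>At\<^esub> x \<sqinter>\<^bsub>At\<^esub> y"
    using xy xy' by (intro At.meet_le) (simp_all add: le_At A.meet_left A.meet_right)
qed (use xy carrier_At in auto)

lemma At_join:
  assumes xy: "x \<in> carrier A" "y \<in> carrier A"
  shows "x \<squnion>\<^bsub>At\<^esub> y = x \<squnion>\<^bsub>A\<^esub> y"
proof (rule At.le_antisym)
  have xy': "x \<in> carrier At" "y \<in> carrier At" "x \<squnion>\<^bsub>A\<^esub> y \<in> carrier At"
    using xy carrier_At by auto
  show "x \<squnion>\<^bsub>A\<^esub> y \<sqsubseteq>\<^bsub>At\<^esub> x \<squnion>\<^bsub>At\<^esub> y"
  proof (rule At_le_by_inf)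
    fix a assume a: "a \<in> carrier A" "x \<squnion>\<^bsub>At\<^esub> y \<sqsubseteq>\<^bsub>At\<^esub> a"
    have "x \<sqsubseteq>\<^bsub>At\<^esub> a" "y \<sqsubseteq>\<^bsub>At\<^esub> a"
      using a(2) xy' carrier_At[OF a(1)] by (auto simp: At.le_iff_ultra ultra_simps)
    then show "x \<squnion>\<^bsub>A\<^esub> y \<sqsubseteq>\<^bsub>At\<^esub> a" using a(1) xy by (simp add: le_At A.join_le)
  qed (use xy' in auto)
  show "x \<squnion>\<^bsub>At\<^esub> y \<sqsubseteq>\<^bsub>At\<^esub> x \<squnion>\<^bsub>A\<^esub> y"
    using xy xy' by (intro At.join_le) (simp_all add: le_At A.join_left A.join_right)
qed (use xy carrier_At in auto)

lemma At_bottom: "\<bottom>\<^bsub>At\<^esub> = \<bottom>\<^bsub>A\<^esub>"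
proof (rule At.le_antisym)
  show "\<bottom>\<^bsub>A\<^esub> \<sqsubseteq>\<^bsub>At\<^esub> \<bottom>\<^bsub>At\<^esub>" by (rule At_le_by_inf) (auto simp: le_At carrier_At)
qed (auto simp: carrier_At)

lemma At_top: "\<top>\<^bsub>At\<^esub> = \<top>\<^bsub>A\<^esub>"
proof (rule At.le_antisym)
  show "\<top>\<^bsub>At\<^esub> \<sqsubseteq>\<^bsub>At\<^esub> \<top>\<^bsub>A\<^esub>" by (rule At_le_by) (auto simp: le_At carrier_At)
qed (auto simp: carrier_At)

lemma phi_hom: "1 \<le> i \<Longrightarrow> \<phi> i \<in> bool_hom (pow_alg Z0) A"
  using sum by (simp add: bool_sum_def)

lemma phi [simp]: "\<lbrakk>1 \<le> i; x \<subseteq> Z0\<rbrakk> \<Longrightarrow> \<phi> i x \<in> carrier A"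
  and phi_empty: "1 \<le> i \<Longrightarrow> \<phi> i {} = \<bottom>\<^bsub>A\<^esub>"
  and phi_Z0: "1 \<le> i \<Longrightarrow> \<phi> i Z0 = \<top>\<^bsub>A\<^esub>"
  and phi_Int: "\<lbrakk>1 \<le> i; x \<subseteq> Z0; y \<subseteq> Z0\<rbrakk> \<Longrightarrow> \<phi> i (x \<inter> y) = \<phi> i x \<sqinter>\<^bsub>A\<^esub> \<phi> i y"
  and phi_compl: "\<lbrakk>1 \<le> i; x \<subseteq> Z0\<rbrakk> \<Longrightarrow> \<phi> i (Z0 - x) = compl A (\<phi> i x)"
proof -
  assume i: "1 \<le> i"
  have c: "carrier (pow_alg Z0) = Pow Z0" by (simp add: pow_alg_def)
  note h = phi_hom[OF i, unfolded bool_hom_def c pow_alg_ops mem_Collect_eq]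
  show "\<phi> i {} = \<bottom>\<^bsub>A\<^esub>" "\<phi> i Z0 = \<top>\<^bsub>A\<^esub>" using h by blast+
  assume x: "x \<subseteq> Z0"
  show "\<phi> i x \<in> carrier A" using h x by blast
  have "\<forall>x\<in>Pow Z0. \<phi> i (compl (pow_alg Z0) x) = compl A (\<phi> i x)" using h by blast
  from bspec[OF this, of x] show "\<phi> i (Z0 - x) = compl A (\<phi> i x)"
    using x pow_alg_ops(5)[OF x] by simp
  assume y: "y \<subseteq> Z0"
  have "\<forall>x\<in>Pow Z0. \<forall>y\<in>Pow Z0. \<phi> i (x \<sqinter>\<^bsub>pow_alg Z0\<^esub> y) = \<phi> i x \<sqinter>\<^bsub>A\<^esub> \<phi> i y"
    using h by blast
  from bspec[OF bspec[OF this, of x], of y] show "\<phi> i (x \<inter> y) = \<phi> i x \<sqinter>\<^bsub>A\<^esub> \<phi> i y"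
    using x y pow_alg_ops(3)[OF x y] by simp
qed

lemma phi_ultra:
  assumes "u \<in> ultrafilters A" "1 \<le> i"
  shows "\<phi> i {} \<notin> u" "\<phi> i Z0 \<in> u"
    "\<lbrakk>x \<subseteq> Z0; y \<subseteq> Z0\<rbrakk> \<Longrightarrow> \<phi> i (x \<inter> y) \<in> u \<longleftrightarrow> \<phi> i x \<in> u \<and> \<phi> i y \<in> u"
    "x \<subseteq> Z0 \<Longrightarrow> \<phi> i (Z0 - x) \<in> u \<longleftrightarrow> \<phi> i x \<notin> u"
  using assms ultra_simps[OF assms(1)] by (simp_all add: phi_empty phi_Z0 phi_Int phi_compl)

lemma phi_ultra_mono:
  assumes "u \<in> ultrafilters A" "1 \<le> i" "x \<subseteq> y" "y \<subseteq> Z0" "\<phi> i x \<in> u"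
  shows "\<phi> i y \<in> u"
  using phi_ultra(3)[OF assms(1,2), of x y] assms by (simp add: Int_absorb2)

lemma universal:
  fixes D :: "'a gorder"
  assumes "boolean_alg D" "\<And>i. 1 \<le> i \<Longrightarrow> F i \<in> bool_hom (pow_alg Z0) D"
  shows "\<exists>!h. h \<in> bool_hom A D \<inter> extensional (carrier A) \<and> (\<forall>j\<in>{1..}. \<forall>x\<in>Pow Z0. h (\<phi> j x) = F j x)"
proof -
  have c: "carrier (pow_alg Z0) = Pow Z0" by (simp add: pow_alg_def)
  show ?thesis
    using sum[unfolded bool_sum_def c, THEN conjunct2, THEN conjunct2, THEN spec[of _ D],
      THEN spec[of _ F], THEN mp] assms by simp
qed

section \<open>Rectangles and their density in the free product\<close>

primrec rect :: "(nat \<Rightarrow> int set) \<Rightarrow> nat \<Rightarrow> 'a" where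
  "rect X 0 = \<top>\<^bsub>A\<^esub>"
| "rect X (Suc k) = rect X k \<sqinter>\<^bsub>A\<^esub> \<phi> (Suc k) (X (Suc k))"

lemma rect_closed: "(\<And>i. X i \<subseteq> Z0) \<Longrightarrow> rect X k \<in> carrier A"
  by (induction k) auto

lemma rect_ultra:
  assumes "\<And>i. X i \<subseteq> Z0" "u \<in> ultrafilters A"
  shows "rect X k \<in> u \<longleftrightarrow> (\<forall>i\<in>{1..k}. \<phi> i (X i) \<in> u)"
proof (induction k)
  case (Suc k)
  then show ?case
    using assms rect_closed[of X k, OF assms(1)] ultra_simps(4)[OF assms(2)]
    by (auto simp: atLeastAtMostSuc_conv)
qed (use assms ultra_simps in auto)

text \<open>Evaluation at a point \<omega> of the rectangle maps each factor to two truth values;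
  the universal property extends this to a homomorphism on \<open>A\<close> that sends the rectangle
  to the top.\<close>

lemma rect_nonzero:
  assumes X: "\<And>i. X i \<subseteq> Z0" and \<omega>: "\<And>i. i \<in> {1..k} \<Longrightarrow> \<omega> i \<in> X i"
  shows "rect X k \<noteq> \<bottom>\<^bsub>A\<^esub>"
proof -
  \<comment> \<open>Injectivity of a canonical map excludes the one-element algebra.\<close>
  have ne: "\<bottom>\<^bsub>A\<^esub> \<noteq> \<top>\<^bsub>A\<^esub>"
  proof
    assume "\<bottom>\<^bsub>A\<^esub> = \<top>\<^bsub>A\<^esub>"
    then have "\<phi> 1 {} = \<phi> 1 Z0" by (simp add: phi_empty phi_Z0)
    then have "{} = Z0" using inj by (auto dest: inj_onD)
    moreover have "1 \<in> Z0" by (simp add: Z0_def)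
    ultimately show False by blast
  qed
  \<comment> \<open>The truth values are the bottom and top of \<open>A\<close>, so that the test
    algebra has the required type.\<close>
  define D :: "'a gorder" where "D = \<lparr>carrier = {\<bottom>\<^bsub>A\<^esub>, \<top>\<^bsub>A\<^esub>}, eq = (=), le = le A\<rparr>"
  \<comment> \<open>Every factor needs a value, hence the default 1 from \<open>Z0\<close> outside
    \<open>{1..k}\<close>.\<close>
  define w where "w i = (if i \<in> {1..k} then \<omega> i else 1)" for i
  have w: "w i \<in> Z0" for i using X \<omega> by (auto simp: w_def Z0_def)
  define F where "F i x = (if w i \<in> x then \<top>\<^bsub>A\<^esub> else \<bottom>\<^bsub>A\<^esub>)" for i :: nat and x
  have simps: "\<bottom>\<^bsub>A\<^esub> \<sqinter>\<^bsub>A\<^esub> \<bottom>\<^bsub>A\<^esub> = \<bottom>\<^bsub>A\<^esub>" "\<bottom>\<^bsub>A\<^esub> \<sqinter>\<^bsub>A\<^esub> \<top>\<^bsub>A\<^esub> = \<bottom>\<^bsub>A\<^esub>" "\<top>\<^bsub>A\<^esub> \<sqinter>\<^bsub>A\<^esub> \<bottom>\<^bsub>A\<^esub> = \<bottom>\<^bsub>A\<^esub>" "\<top>\<^bsub>A\<^esub> \<sqinter>\<^bsub>A\<^esub> \<top>\<^bsub>A\<^esub> = \<top>\<^bsub>A\<^esub>"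
    "\<bottom>\<^bsub>A\<^esub> \<squnion>\<^bsub>A\<^esub> \<bottom>\<^bsub>A\<^esub> = \<bottom>\<^bsub>A\<^esub>" "\<bottom>\<^bsub>A\<^esub> \<squnion>\<^bsub>A\<^esub> \<top>\<^bsub>A\<^esub> = \<top>\<^bsub>A\<^esub>" "\<top>\<^bsub>A\<^esub> \<squnion>\<^bsub>A\<^esub> \<bottom>\<^bsub>A\<^esub> = \<top>\<^bsub>A\<^esub>" "\<top>\<^bsub>A\<^esub> \<squnion>\<^bsub>A\<^esub> \<top>\<^bsub>A\<^esub> = \<top>\<^bsub>A\<^esub>"
    by (simp_all add: A.eq_iff_ultra ultra_simps)
  let ?two = "{\<bottom>\<^bsub>A\<^esub>, \<top>\<^bsub>A\<^esub>}"
  have "boolean_alg D \<and> \<bottom>\<^bsub>D\<^esub> = \<bottom>\<^bsub>A\<^esub> \<and> \<top>\<^bsub>D\<^esub> = \<top>\<^bsub>A\<^esub> \<and>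
    (\<forall>x\<in>?two. \<forall>y\<in>?two. x \<sqinter>\<^bsub>D\<^esub> y = x \<sqinter>\<^bsub>A\<^esub> y \<and> x \<squnion>\<^bsub>D\<^esub> y = x \<squnion>\<^bsub>A\<^esub> y) \<and>
    (\<forall>x\<in>?two. compl D x = compl A x)"
    by (rule subalgebra[OF A.boolean_alg_axioms _ _ _ _ D_def]) (auto simp: simps)
  then have D: "boolean_alg D" "\<bottom>\<^bsub>D\<^esub> = \<bottom>\<^bsub>A\<^esub>" "\<top>\<^bsub>D\<^esub> = \<top>\<^bsub>A\<^esub>"
    "\<And>x y. x \<in> {\<bottom>\<^bsub>A\<^esub>, \<top>\<^bsub>A\<^esub>} \<Longrightarrow> y \<in> {\<bottom>\<^bsub>A\<^esub>, \<top>\<^bsub>A\<^esub>} \<Longrightarrow> x \<sqinter>\<^bsub>D\<^esub> y = x \<sqinter>\<^bsub>A\<^esub> y \<and> x \<squnion>\<^bsub>D\<^esub> y = x \<squnion>\<^bsub>A\<^esub> y"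
    "\<And>x. x \<in> {\<bottom>\<^bsub>A\<^esub>, \<top>\<^bsub>A\<^esub>} \<Longrightarrow> compl D x = compl A x"
    by blast+
  have Dc: "carrier D = {\<bottom>\<^bsub>A\<^esub>, \<top>\<^bsub>A\<^esub>}" by (simp add: D_def)
  have "F i \<in> bool_hom (pow_alg Z0) D" for i
    unfolding bool_hom_def mem_Collect_eq pow_alg_ops Dc
    using w[of i] simps D(2-) by (auto simp: F_def pow_alg_def[of Z0, THEN arg_cong[of _ _ carrier]] pow_alg_ops)
  then obtain h where h: "h \<in> bool_hom A D" "\<And>i x. 1 \<le> i \<Longrightarrow> x \<subseteq> Z0 \<Longrightarrow> h (\<phi> i x) = F i x"
    using ex1_implies_ex[OF universal[of D F, OF D(1)]] by auto
  have hh: "h \<bottom>\<^bsub>A\<^esub> = \<bottom>\<^bsub>A\<^esub>" "h \<top>\<^bsub>A\<^esub> = \<top>\<^bsub>A\<^esub>"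
    "\<And>x y. x \<in> carrier A \<Longrightarrow> y \<in> carrier A \<Longrightarrow> h (x \<sqinter>\<^bsub>A\<^esub> y) = h x \<sqinter>\<^bsub>D\<^esub> h y"
    using h(1) D(2,3) by (auto simp: bool_hom_def)
  have "h (rect X j) = \<top>\<^bsub>A\<^esub>" if "j \<le> k" for j
    using that
  proof (induction j)
    case (Suc j)
    then have "h (\<phi> (Suc j) (X (Suc j))) = \<top>\<^bsub>A\<^esub>"
      using h(2)[of "Suc j" "X (Suc j)"] X \<omega>[of "Suc j"] by (simp add: F_def w_def)
    then show ?case using Suc hh(3)[OF rect_closed[of X j, OF X]] X D(4)[of "\<top>\<^bsub>A\<^esub>" "\<top>\<^bsub>A\<^esub>"] simps by simp
  qed (use hh in simp)
  then show ?thesis using hh(1) ne by (metis order_refl)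
qed

text \<open>The elements decided by a predense set of rectangles form a subalgebra containing all
  \<open>\<phi> i x\<close>; by uniqueness in the universal property it is all of \<open>A\<close>.\<close>

definition decided :: "'a set" where
  "decided = {x \<in> carrier A. \<forall>y\<in>carrier A. y \<noteq> \<bottom>\<^bsub>A\<^esub> \<longrightarrow>
     (\<exists>k X. (\<forall>i. X i \<subseteq> Z0) \<and> rect X k \<sqinter>\<^bsub>A\<^esub> y \<noteq> \<bottom>\<^bsub>A\<^esub> \<and>
        (rect X k \<sqsubseteq>\<^bsub>A\<^esub> x \<or> rect X k \<sqsubseteq>\<^bsub>A\<^esub> compl A x))}"

lemma decidedD:
  assumes "x \<in> decided" "y \<in> carrier A" "y \<noteq> \<bottom>\<^bsub>A\<^esub>"
  shows "\<exists>k X. (\<forall>i. X i \<subseteq> Z0) \<and> rect X k \<sqinter>\<^bsub>A\<^esub> y \<noteq> \<bottom>\<^bsub>A\<^esub> \<and>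
        (rect X k \<sqsubseteq>\<^bsub>A\<^esub> x \<or> rect X k \<sqsubseteq>\<^bsub>A\<^esub> compl A x)"
  using assms unfolding decided_def by blast

lemma decidedI:
  assumes "x \<in> carrier A"
    and "\<And>y. \<lbrakk>y \<in> carrier A; y \<noteq> \<bottom>\<^bsub>A\<^esub>\<rbrakk> \<Longrightarrow> \<exists>k X. (\<forall>i. X i \<subseteq> Z0) \<and> rect X k \<sqinter>\<^bsub>A\<^esub> y \<noteq> \<bottom>\<^bsub>A\<^esub> \<and>
        (rect X k \<sqsubseteq>\<^bsub>A\<^esub> x \<or> rect X k \<sqsubseteq>\<^bsub>A\<^esub> compl A x)"
  shows "x \<in> decided"
  unfolding decided_def using assms by blast

text \<open>The shorter rectangle is padded with \<open>Z0\<close>, whose image is the top.\<close>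

lemma rect_meet:
  assumes X: "\<And>i. X i \<subseteq> Z0" and Y: "\<And>i. Y i \<subseteq> Z0"
  shows "\<exists>Z. (\<forall>i. Z i \<subseteq> Z0) \<and> rect X k \<sqinter>\<^bsub>A\<^esub> rect Y l = rect Z (max k l)"
proof -
  define Z where "Z i = (if i \<le> k then X i else Z0) \<inter> (if i \<le> l then Y i else Z0)" for i
  have Z: "Z i \<subseteq> Z0" for i using X Y by (auto simp: Z_def)
  have "rect X k \<sqinter>\<^bsub>A\<^esub> rect Y l = rect Z (max k l)"
    unfolding A.eq_iff_ultra[OF A.meet_closed[OF rect_closed[OF X] rect_closed[OF Y]] rect_closed[OF Z]]
  proof
    fix u assume u: "u \<in> ultrafilters A"
    have *: "\<phi> i (Z i) \<in> u \<longleftrightarrow> (i \<le> k \<longrightarrow> \<phi> i (X i) \<in> u) \<and> (i \<le> l \<longrightarrow> \<phi> i (Y i) \<in> u)" if "1 \<le> i" for i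
      using phi_ultra(2,3)[OF u that] X Y by (simp add: Z_def)
    show "(rect X k \<sqinter>\<^bsub>A\<^esub> rect Y l \<in> u) = (rect Z (max k l) \<in> u)"
      unfolding ultra_simps(4)[OF u rect_closed[OF X] rect_closed[OF Y]]
        rect_ultra[OF X u] rect_ultra[OF Y u] rect_ultra[OF Z u]
      using * by auto
  qed
  then show ?thesis using Z by blast
qed

lemma decided_compl: "x \<in> decided \<Longrightarrow> compl A x \<in> decided"
proof (rule decidedI)
  fix y assume x: "x \<in> decided" and y: "y \<in> carrier A" "y \<noteq> \<bottom>\<^bsub>A\<^esub>"
  have "x \<in> carrier A" using x by (simp add: decided_def)
  then show "\<exists>k X. (\<forall>i. X i \<subseteq> Z0) \<and> rect X k \<sqinter>\<^bsub>A\<^esub> y \<noteq> \<bottom>\<^bsub>A\<^esub> \<and>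
        (rect X k \<sqsubseteq>\<^bsub>A\<^esub> compl A x \<or> rect X k \<sqsubseteq>\<^bsub>A\<^esub> compl A (compl A x))"
    using decidedD[OF x y] by auto
qed (simp add: decided_def)

lemma decided_meet:
  assumes "x \<in> decided" "x' \<in> decided"
  shows "x \<sqinter>\<^bsub>A\<^esub> x' \<in> decided"
proof (rule decidedI)
  have xc: "x \<in> carrier A" "x' \<in> carrier A" using assms by (auto simp: decided_def)
  then show "x \<sqinter>\<^bsub>A\<^esub> x' \<in> carrier A" by simp
  fix y assume y: "y \<in> carrier A" "y \<noteq> \<bottom>\<^bsub>A\<^esub>"
  obtain k X where X0: "\<forall>i. X i \<subseteq> Z0" and X1: "rect X k \<sqinter>\<^bsub>A\<^esub> y \<noteq> \<bottom>\<^bsub>A\<^esub>"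
    "rect X k \<sqsubseteq>\<^bsub>A\<^esub> x \<or> rect X k \<sqsubseteq>\<^bsub>A\<^esub> compl A x"
    using decidedD[OF assms(1) y] by blast
  have X: "\<And>i. X i \<subseteq> Z0" using X0 by blast
  have rX: "rect X k \<in> carrier A" by (rule rect_closed[OF X])
  \<comment> \<open>The second decision is made inside \<open>rect X k \<sqinter> y\<close>, not
    just inside \<open>y\<close>, so that both rectangles meet \<open>y\<close>
    simultaneously.\<close>
  obtain l Y where Y0: "\<forall>i. Y i \<subseteq> Z0" and Y1: "rect Y l \<sqinter>\<^bsub>A\<^esub> (rect X k \<sqinter>\<^bsub>A\<^esub> y) \<noteq> \<bottom>\<^bsub>A\<^esub>"
    "rect Y l \<sqsubseteq>\<^bsub>A\<^esub> x' \<or> rect Y l \<sqsubseteq>\<^bsub>A\<^esub> compl A x'"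
    using decidedD[OF assms(2) A.meet_closed[OF rX y(1)] X1(1)] by blast
  have Y: "\<And>i. Y i \<subseteq> Z0" using Y0 by blast
  have rY: "rect Y l \<in> carrier A" by (rule rect_closed[OF Y])
  obtain Z where Z: "\<forall>i. Z i \<subseteq> Z0" "rect X k \<sqinter>\<^bsub>A\<^esub> rect Y l = rect Z (max k l)"
    using rect_meet[of X Y k l, OF X Y] by metis
  have "rect Z (max k l) \<sqinter>\<^bsub>A\<^esub> y \<noteq> \<bottom>\<^bsub>A\<^esub>"
    using Y1(1) rX rY y unfolding Z(2)[symmetric] by (auto simp: A.eq_iff_ultra ultra_simps)
  moreover have "rect Z (max k l) \<sqsubseteq>\<^bsub>A\<^esub> x \<sqinter>\<^bsub>A\<^esub> x' \<or> rect Z (max k l) \<sqsubseteq>\<^bsub>A\<^esub> compl A (x \<sqinter>\<^bsub>A\<^esub> x')"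
    using X1(2) Y1(2) rX rY xc unfolding Z(2)[symmetric] by (auto simp: A.le_iff_ultra ultra_simps)
  ultimately show "\<exists>k X. (\<forall>i. X i \<subseteq> Z0) \<and> rect X k \<sqinter>\<^bsub>A\<^esub> y \<noteq> \<bottom>\<^bsub>A\<^esub> \<and>
        (rect X k \<sqsubseteq>\<^bsub>A\<^esub> x \<sqinter>\<^bsub>A\<^esub> x' \<or> rect X k \<sqsubseteq>\<^bsub>A\<^esub> compl A (x \<sqinter>\<^bsub>A\<^esub> x'))"
    using Z(1) by blast
qed

lemma decided_phi:
  assumes i: "1 \<le> i" and z: "z \<subseteq> Z0"
  shows "\<phi> i z \<in> decided"
proof (rule decidedI)
  show c: "\<phi> i z \<in> carrier A" using i z by simp
  fix y assume y: "y \<in> carrier A" "y \<noteq> \<bottom>\<^bsub>A\<^esub>"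
  define X where "X w = (\<lambda>j. if j = i then w else Z0)" for w
  have X: "X w j \<subseteq> Z0" if "w \<subseteq> Z0" for w j using that by (auto simp: X_def)
  have r: "rect (X w) i = \<phi> i w" if w: "w \<subseteq> Z0" for w
    unfolding A.eq_iff_ultra[OF rect_closed[of "X w", OF X[OF w]] phi[OF i w]]
  proof
    fix u assume u: "u \<in> ultrafilters A"
    show "(rect (X w) i \<in> u) = (\<phi> i w \<in> u)"
      unfolding rect_ultra[OF X[OF w] u] using phi_ultra(2)[OF u] i by (auto simp: X_def)
  qed
  have "\<phi> i z \<sqinter>\<^bsub>A\<^esub> y \<noteq> \<bottom>\<^bsub>A\<^esub> \<or> \<phi> i (Z0 - z) \<sqinter>\<^bsub>A\<^esub> y \<noteq> \<bottom>\<^bsub>A\<^esub>"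
    using y c unfolding phi_compl[OF i z] by (auto simp: A.eq_iff_ultra ultra_simps)
  then obtain w where w: "w = z \<or> w = Z0 - z" "\<phi> i w \<sqinter>\<^bsub>A\<^esub> y \<noteq> \<bottom>\<^bsub>A\<^esub>" by blast
  then have wZ: "w \<subseteq> Z0" using z by auto
  have "\<phi> i w \<sqsubseteq>\<^bsub>A\<^esub> \<phi> i z \<or> \<phi> i w \<sqsubseteq>\<^bsub>A\<^esub> compl A (\<phi> i z)"
    using w(1) c phi_compl[OF i z] by auto
  then show "\<exists>k X. (\<forall>i. X i \<subseteq> Z0) \<and> rect X k \<sqinter>\<^bsub>A\<^esub> y \<noteq> \<bottom>\<^bsub>A\<^esub> \<and>
        (rect X k \<sqsubseteq>\<^bsub>A\<^esub> \<phi> i z \<or> rect X k \<sqsubseteq>\<^bsub>A\<^esub> compl A (\<phi> i z))"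
    using w(2) X[OF wZ] r[OF wZ] by (intro exI[of _ i] exI[of _ "X w"]) auto
qed

lemma decided_all: "carrier A \<subseteq> decided"
proof -
  define D :: "'a gorder" where "D = \<lparr>carrier = decided, eq = (=), le = le A\<rparr>"
  have Dc: "carrier D = decided" by (simp add: D_def)
  have sub: "decided \<subseteq> carrier A" by (auto simp: decided_def)
  have bot: "\<bottom>\<^bsub>A\<^esub> \<in> decided" using decided_phi[of 1 "{}"] by (simp add: phi_empty)
  have "boolean_alg D \<and> \<bottom>\<^bsub>D\<^esub> = \<bottom>\<^bsub>A\<^esub> \<and> \<top>\<^bsub>D\<^esub> = \<top>\<^bsub>A\<^esub> \<and>
    (\<forall>x\<in>decided. \<forall>y\<in>decided. x \<sqinter>\<^bsub>D\<^esub> y = x \<sqinter>\<^bsub>A\<^esub> y \<and> x \<squnion>\<^bsub>D\<^esub> y = x \<squnion>\<^bsub>A\<^esub> y) \<and>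
    (\<forall>x\<in>decided. compl D x = compl A x)"
    by (rule subalgebra[OF A.boolean_alg_axioms sub bot _ _ D_def])
      (simp_all add: decided_meet decided_compl)
  then have D: "boolean_alg D" "\<bottom>\<^bsub>D\<^esub> = \<bottom>\<^bsub>A\<^esub>" "\<top>\<^bsub>D\<^esub> = \<top>\<^bsub>A\<^esub>"
    "\<And>x y. x \<in> decided \<Longrightarrow> y \<in> decided \<Longrightarrow> x \<sqinter>\<^bsub>D\<^esub> y = x \<sqinter>\<^bsub>A\<^esub> y"
    "\<And>x y. x \<in> decided \<Longrightarrow> y \<in> decided \<Longrightarrow> x \<squnion>\<^bsub>D\<^esub> y = x \<squnion>\<^bsub>A\<^esub> y"
    "\<And>x. x \<in> decided \<Longrightarrow> compl D x = compl A x"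
    by blast+
  have pc: "carrier (pow_alg Z0) = Pow Z0" by (simp add: pow_alg_def)
  have "\<phi> i \<in> bool_hom (pow_alg Z0) D" if i: "1 \<le> i" for i
    using phi_hom[OF i] decided_phi[OF i] unfolding bool_hom_def Dc pc
    by (auto simp: D Pi_iff)
  then obtain h where h: "h \<in> bool_hom A D" "h \<in> extensional (carrier A)"
      "\<And>i x. 1 \<le> i \<Longrightarrow> x \<subseteq> Z0 \<Longrightarrow> h (\<phi> i x) = \<phi> i x"
    using ex1_implies_ex[OF universal[of D \<phi>, OF D(1)]] by auto
  have hd: "h x \<in> decided" if "x \<in> carrier A" for x using h(1) that by (auto simp: bool_hom_def Dc)
  have hA: "h \<in> bool_hom A A"
    using h(1) hd sub unfolding bool_hom_def by (auto simp: D Dc)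
  \<comment> \<open>Both \<open>h\<close> and the identity are endomorphisms of \<open>A\<close>
    extending the maps \<open>\<phi> i\<close>, so they agree; the values of \<open>h\<close>, that
    is all elements of \<open>A\<close>, are decided.\<close>
  define i where "i = restrict id (carrier A)"
  have iA: "i \<in> bool_hom A A" "i \<in> extensional (carrier A)"
    "\<And>j x. 1 \<le> j \<Longrightarrow> x \<subseteq> Z0 \<Longrightarrow> i (\<phi> j x) = \<phi> j x"
    by (auto simp: i_def bool_hom_def)
  have "\<exists>!h. h \<in> bool_hom A A \<inter> extensional (carrier A) \<and> (\<forall>j\<in>{1..}. \<forall>x\<in>Pow Z0. h (\<phi> j x) = \<phi> j x)"
    by (rule universal[OF A.boolean_alg_axioms phi_hom])
  then have "h = i" using h(2,3) hA iA by blast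
  then show ?thesis using hd by (force simp: i_def)
qed

text \<open>The infimum taken in the completion is that of a finite family from \<open>A\<close>, so
  it can be computed in \<open>A\<close>.\<close>

lemma b_elem_rect:
  assumes k: "1 \<le> k" and n: "\<And>i. n i \<in> Z0"
  shows "b_elem At \<phi> k n = rect (\<lambda>i. {n i}) k"
proof -
  have X: "(\<lambda>i. {n i}) i \<subseteq> Z0" for i using n by auto
  let ?S = "{\<phi> i {n i} |i. i \<in> {1..k}}"
  have S: "?S \<subseteq> carrier At" using X carrier_At by auto
  have r: "rect (\<lambda>i. {n i}) k \<in> carrier A" by (rule rect_closed[OF X])
  show ?thesis unfolding b_elem_def
  proof (rule At.le_antisym)
    have "rect (\<lambda>i. {n i}) k \<sqsubseteq>\<^bsub>A\<^esub> \<phi> i {n i}" if i: "i \<in> {1..k}" for i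
      using i X r rect_ultra[OF X] by (subst A.le_iff_ultra) auto
    then show "rect (\<lambda>i. {n i}) k \<sqsubseteq>\<^bsub>At\<^esub> \<Sqinter>\<^bsub>At\<^esub> ?S"
      using S r X carrier_At by (intro At.inf_greatest) (auto simp: le_At)
    have l: "\<Sqinter>\<^bsub>At\<^esub> ?S \<sqsubseteq>\<^bsub>At\<^esub> \<phi> i {n i}" if "i \<in> {1..k}" for i
      using S that by (intro At.inf_lower) auto
    show "\<Sqinter>\<^bsub>At\<^esub> ?S \<sqsubseteq>\<^bsub>At\<^esub> rect (\<lambda>i. {n i}) k"
    proof (rule At_le_by)
      fix a assume a: "a \<in> carrier A" "a \<sqsubseteq>\<^bsub>At\<^esub> \<Sqinter>\<^bsub>At\<^esub> ?S"
      have "a \<sqsubseteq>\<^bsub>A\<^esub> \<phi> i {n i}" if i: "i \<in> {1..k}" for i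
      proof -
        have "\<phi> i {n i} \<in> carrier A" using i X by simp
        then show ?thesis
          using At.le_trans[OF a(2) l[OF i]] a(1) carrier_At At.inf_closed[OF S] le_At by blast
      qed
      then have "a \<sqsubseteq>\<^bsub>A\<^esub> rect (\<lambda>i. {n i}) k"
        using X a(1) r rect_ultra[OF X] by (auto simp: A.le_iff_ultra)
      then show "a \<sqsubseteq>\<^bsub>At\<^esub> rect (\<lambda>i. {n i}) k" using le_At a r by simp
    qed (use S r carrier_At in auto)
  qed (use S r carrier_At in auto)
qed

lemma b_dense:
  assumes x: "x \<in> carrier At" "x \<noteq> \<bottom>\<^bsub>At\<^esub>"
  shows "\<exists>k n. 1 \<le> k \<and> (\<forall>i. n i \<in> Z0) \<and> b_elem At \<phi> k n \<sqsubseteq>\<^bsub>At\<^esub> x"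
proof -
  have "\<exists>a\<in>carrier A. a \<noteq> \<bottom>\<^bsub>A\<^esub> \<and> a \<sqsubseteq>\<^bsub>At\<^esub> x"
  proof (rule ccontr)
    assume "\<not> ?thesis"
    then have no: "\<forall>a. a \<in> carrier A \<longrightarrow> a \<sqsubseteq>\<^bsub>At\<^esub> x \<longrightarrow> a = \<bottom>\<^bsub>A\<^esub>" by metis
    have "x \<sqsubseteq>\<^bsub>At\<^esub> \<bottom>\<^bsub>At\<^esub>"
    proof (rule At_le_by[OF x(1) At.bottom_closed])
      fix a assume "a \<in> carrier A" "a \<sqsubseteq>\<^bsub>At\<^esub> x"
      then have "a = \<bottom>\<^bsub>A\<^esub>" using no by simp
      then show "a \<sqsubseteq>\<^bsub>At\<^esub> \<bottom>\<^bsub>At\<^esub>" using At_bottom At.le_refl[OF At.bottom_closed] by simp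
    qed
    then show False using x At.le_antisym[of x "\<bottom>\<^bsub>At\<^esub>"] by simp
  qed
  then obtain a where a: "a \<in> carrier A" "a \<noteq> \<bottom>\<^bsub>A\<^esub>" "a \<sqsubseteq>\<^bsub>At\<^esub> x" by blast
  \<comment> \<open>Here \<open>a\<close> is decided inside \<open>a\<close> itself: a rectangle
    that meets \<open>a\<close> cannot lie below its complement, so it lies below
    \<open>a\<close>.\<close>
  obtain k X where X0: "\<forall>i. X i \<subseteq> Z0" and X1: "rect X k \<sqinter>\<^bsub>A\<^esub> a \<noteq> \<bottom>\<^bsub>A\<^esub>"
    "rect X k \<sqsubseteq>\<^bsub>A\<^esub> a \<or> rect X k \<sqsubseteq>\<^bsub>A\<^esub> compl A a"
    using decidedD[OF subsetD[OF decided_all a(1)] a(1,2)] by blast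
  have X: "\<And>i. X i \<subseteq> Z0" using X0 by blast
  have r: "rect X k \<in> carrier A" by (rule rect_closed[OF X])
  have ra: "rect X k \<sqsubseteq>\<^bsub>A\<^esub> a" using X1 A.meet_bot_iff[OF r a(1)] by blast
  have "\<exists>m. m \<in> X i" if i: "i \<in> {1..k}" for i
  proof (rule ccontr)
    assume "\<not> ?thesis"
    then have "X i = {}" by auto
    then have no: "rect X k \<notin> u" if "u \<in> ultrafilters A" for u
      using rect_ultra[of X u k, OF X that] phi_ultra(1)[OF that, of i] i by (metis atLeastAtMost_iff)
    have "rect X k \<sqinter>\<^bsub>A\<^esub> a = \<bottom>\<^bsub>A\<^esub>"
      using r a(1) no by (auto simp: A.eq_iff_ultra ultra_simps)
    then show False using X1(1) by simp
  qed
  then obtain m where m: "\<And>i. i \<in> {1..k} \<Longrightarrow> m i \<in> X i" by metis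
  define n where "n i = (if i \<in> {1..k} then m i else 1)" for i
  have n: "n i \<in> Z0" for i using m X by (auto simp: n_def Z0_def)
  have nX: "(\<lambda>i. {n i}) i \<subseteq> Z0" for i using n by auto
  \<comment> \<open>The empty rectangle \<open>k = 0\<close> is the top, whereas elements of
    \<open>B0\<close> have at least one factor.\<close>
  let ?k = "max 1 k"
  have b: "b_elem At \<phi> ?k n = rect (\<lambda>i. {n i}) ?k" using n by (intro b_elem_rect) auto
  have "rect (\<lambda>i. {n i}) ?k \<sqsubseteq>\<^bsub>A\<^esub> rect X k"
    unfolding A.le_iff_ultra[OF rect_closed[OF nX] r]
  proof (intro ballI impI)
    fix u assume u: "u \<in> ultrafilters A" and "rect (\<lambda>i. {n i}) ?k \<in> u"
    then have *: "\<phi> i {n i} \<in> u" if "i \<in> {1..k}" for i using rect_ultra[OF nX u] that by auto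
    show "rect X k \<in> u"
      unfolding rect_ultra[OF X u]
    proof
      fix i assume i: "i \<in> {1..k}"
      then show "\<phi> i (X i) \<in> u"
        using m X by (intro phi_ultra_mono[OF u _ _ _ *[OF i]]) (auto simp: n_def)
    qed
  qed
  moreover have rn: "rect (\<lambda>i. {n i}) ?k \<in> carrier A" by (rule rect_closed[OF nX])
  ultimately have "rect (\<lambda>i. {n i}) ?k \<sqsubseteq>\<^bsub>A\<^esub> a" using A.le_trans[OF _ ra rn r a(1)] by simp
  then have "b_elem At \<phi> ?k n \<sqsubseteq>\<^bsub>At\<^esub> a" unfolding b using le_At[OF rn a(1)] by simp
  then have "b_elem At \<phi> ?k n \<sqsubseteq>\<^bsub>At\<^esub> x"
    using At.le_trans[OF _ a(3) _ carrier_At[OF a(1)] x(1)] carrier_At[OF rn] b by simp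
  then show ?thesis using n by (intro exI[of _ ?k] exI[of _ n]) auto
qed

end

section \<open>Nested subdivisions of the unit interval\<close>

text \<open>A two-sided increasing sequence from 0 to 1 with value 1/2 at index 0. Consecutive
  values lie on the same side of 1/2, so gaps are at most 1/2 and nested pieces shrink
  geometrically.\<close>

definition cutpt :: "int \<Rightarrow> real" where
  "cutpt m = (if 0 \<le> m then 1 - 1 / (m + 2) else 1 / (2 - m))"

lemma cutpt_bounds: "0 < cutpt m" "cutpt m < 1"
  by (auto simp: cutpt_def field_simps)

lemma cutpt_half: "0 \<le> m \<Longrightarrow> 1 / 2 \<le> cutpt m" "m \<le> 0 \<Longrightarrow> cutpt m \<le> 1 / 2"
  by (auto simp: cutpt_def field_simps)

lemma cutpt_less: assumes "m < m'" shows "cutpt m < cutpt m'"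
proof -
  consider "0 \<le> m" | "m < 0" "0 \<le> m'" | "m' < 0" by linarith
  then show ?thesis
  proof cases
    case 1
    then have "1 / (real_of_int m' + 2) < 1 / (real_of_int m + 2)"
      using assms by (intro divide_strict_left_mono) auto
    then show ?thesis using 1 assms by (simp add: cutpt_def)
  next
    case 2
    then have "cutpt m < 1 / 2" by (auto simp: cutpt_def field_simps)
    then show ?thesis using cutpt_half(1)[OF 2(2)] by linarith
  next
    case 3
    then have "1 / (2 - real_of_int m) < 1 / (2 - real_of_int m')"
      using assms by (intro divide_strict_left_mono mult_pos_pos) auto
    then show ?thesis using 3 assms by (simp add: cutpt_def)
  qed
qed

lemma cutpt_le: "m \<le> m' \<Longrightarrow> cutpt m \<le> cutpt m'"
  using cutpt_less[of m m'] by (cases "m = m'") auto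

lemma cutpt_gap: "cutpt (m + 1) - cutpt m \<le> 1 / 2"
  using cutpt_half[of m] cutpt_half[of "m + 1"] cutpt_bounds[of m] cutpt_bounds[of "m + 1"]
  by (cases "0 \<le> m") auto

lemma cutpt_cover:
  assumes "0 < t" "t < 1"
  shows "\<exists>m. cutpt m \<le> t \<and> t < cutpt (m + 1)"
proof (cases "1 / 2 \<le> t")
  case True
  \<comment> \<open>The largest integer with \<open>1 - 1 / (m + 2) \<le> t\<close>, solved for
    \<open>m\<close>.\<close>
  define m where "m = \<lfloor>1 / (1 - t)\<rfloor> - 2"
  have f: "real_of_int m + 2 \<le> 1 / (1 - t)" "1 / (1 - t) < real_of_int m + 3"
    unfolding m_def by linarith+
  have "2 \<le> 1 / (1 - t)" using True assms by (simp add: field_simps)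
  then have m0: "0 \<le> m" unfolding m_def by linarith
  have "1 - t \<le> 1 / (real_of_int m + 2)" "1 / (real_of_int m + 3) < 1 - t"
    using f m0 assms by (simp_all add: field_simps)
  then show ?thesis using m0 by (intro exI[of _ m]) (simp add: cutpt_def add.assoc)
next
  case False
  \<comment> \<open>From \<open>1 / (2 - m) \<le> t\<close>, solved for \<open>m\<close>. The
    successor may be 0, where the other branch of \<open>cutpt\<close> applies.\<close>
  define m where "m = \<lfloor>2 - 1 / t\<rfloor>"
  have f: "real_of_int m \<le> 2 - 1 / t" "2 - 1 / t < real_of_int m + 1"
    unfolding m_def by linarith+
  have "2 < 1 / t" using False assms by (simp add: field_simps)
  then have m0: "m < 0" using f by linarith
  have "1 / (2 - real_of_int m) \<le> t" using f m0 assms by (simp add: field_simps)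
  moreover have "t < cutpt (m + 1)"
  proof (cases "m + 1 < 0")
    case True
    then have "1 - real_of_int m > 0" by linarith
    moreover have "1 - real_of_int m < 1 / t" using f by linarith
    ultimately have "t < 1 / (1 - real_of_int m)" using assms by (simp add: field_simps)
    then show ?thesis using True by (simp add: cutpt_def)
  next
    case False
    then show ?thesis using cutpt_half(1)[of "m + 1"] \<open>\<not> 1 / 2 \<le> t\<close> by linarith
  qed
  ultimately show ?thesis using m0 by (intro exI[of _ m]) (simp add: cutpt_def)
qed

lemma cutpt_small:
  assumes "0 < e"
  shows "\<exists>r>0. cutpt (- r) < e \<and> 1 - e < cutpt r"
proof -
  obtain N :: nat where N: "1 / e < N" using reals_Archimedean2 by blast
  have N0: "0 < real N" using N assms by (smt (verit) divide_pos_pos)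
  have "1 / real N < e" using N N0 assms by (simp add: field_simps)
  moreover have "1 / (2 + real N) < 1 / real N" using N0 by (simp add: field_simps)
  ultimately have "1 / (2 + real N) < e" by linarith
  then show ?thesis using N0 by (intro exI[of _ "int N"]) (simp add: cutpt_def add.commute)
qed

text \<open>\<open>pos\<close> is the order isomorphism from \<open>Z0\<close> to the integers.\<close>

definition pos :: "int \<Rightarrow> int" where
  "pos p = (if p < 0 then p else p - 1)"

lemma pos_less: "\<lbrakk>p \<in> Z0; q \<in> Z0\<rbrakk> \<Longrightarrow> pos p < pos q \<longleftrightarrow> p < q"
  by (auto simp: pos_def Z0_def)

lemma pos_pr: "p \<in> Z0 \<Longrightarrow> pos (pr p) = pos p - 1" and pos_nx: "p \<in> Z0 \<Longrightarrow> pos (nx p) = pos p + 1"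
  and pr_Z0: "p \<in> Z0 \<Longrightarrow> pr p \<in> Z0" and nx_Z0: "p \<in> Z0 \<Longrightarrow> nx p \<in> Z0"
  by (auto simp: pos_def Z0_def pr_def nx_def)

lemma pos_inj: "\<lbrakk>p \<in> Z0; q \<in> Z0; pos p = pos q\<rbrakk> \<Longrightarrow> p = q"
  by (auto simp: pos_def Z0_def split: if_splits)

lemma pos_surj: "\<exists>p\<in>Z0. pos p = m"
  by (rule bexI[of _ "if m < 0 then m else m + 1"]) (auto simp: pos_def Z0_def)

text \<open>The piece with index \<open>n\<^sub>1, \<dots>, n\<^sub>k\<close> is the interval from \<open>lo k n\<close> to \<open>hi k n\<close>.\<close>

primrec wd :: "nat \<Rightarrow> (nat \<Rightarrow> int) \<Rightarrow> real" where
  "wd 0 n = 1"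
| "wd (Suc k) n = wd k n * (cutpt (pos (n (Suc k)) + 1) - cutpt (pos (n (Suc k))))"

primrec lo :: "nat \<Rightarrow> (nat \<Rightarrow> int) \<Rightarrow> real" where
  "lo 0 n = 0"
| "lo (Suc k) n = lo k n + wd k n * cutpt (pos (n (Suc k)))"

definition hi :: "nat \<Rightarrow> (nat \<Rightarrow> int) \<Rightarrow> real" where
  "hi k n = lo k n + wd k n"

lemma hi_Suc: "hi (Suc k) n = lo k n + wd k n * cutpt (pos (n (Suc k)) + 1)"
  by (simp add: hi_def algebra_simps)

lemma wd_pos: "0 < wd k n"
  by (induction k) (simp_all add: cutpt_less)

lemma wd_le: "wd k n \<le> (1 / 2) ^ k"
proof (induction k)
  case (Suc k)
  have "wd (Suc k) n \<le> wd k n * (1 / 2)"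
    using cutpt_gap[of "pos (n (Suc k))"] wd_pos[of k n] by simp
  then show ?case using Suc by simp
qed simp

lemma wd_cong: "\<forall>i\<in>{1..k}. n i = n' i \<Longrightarrow> wd k n = wd k n'"
  by (induction k) auto

lemma lo_cong: "\<forall>i\<in>{1..k}. n i = n' i \<Longrightarrow> lo k n = lo k n'"
proof (induction k)
  case (Suc k)
  then have "\<forall>i\<in>{1..k}. n i = n' i" "n (Suc k) = n' (Suc k)" by auto
  then show ?case using Suc.IH wd_cong[of k n n'] by simp
qed simp

lemma hi_cong: "\<forall>i\<in>{1..k}. n i = n' i \<Longrightarrow> hi k n = hi k n'"
  using lo_cong[of k n n'] wd_cong[of k n n'] by (simp add: hi_def)

lemma lo_hi: "lo k n < hi k n"
  using wd_pos by (simp add: hi_def)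

lemma lo_Suc_less: "lo k n < lo (Suc k) n"
  using wd_pos[of k n] cutpt_bounds by simp

lemma hi_Suc_less: "hi (Suc k) n < hi k n"
  using wd_pos[of k n] cutpt_bounds unfolding hi_Suc by (simp add: hi_def)

lemma nested: assumes "m < k" shows "lo m n < lo k n" "hi k n < hi m n"
  using lift_Suc_mono_less[of "\<lambda>k. lo k n" m k, OF lo_Suc_less assms]
    lift_Suc_mono_less[of "\<lambda>k. - hi k n" m k] hi_Suc_less assms by auto

lemma nested_le: assumes "m \<le> k" shows "lo m n \<le> lo k n" "hi k n \<le> hi m n"
  using nested[of m k n] assms by (cases "m = k"; simp)+

lemma unit_bounds: assumes "1 \<le> k" shows "0 < lo k n" "hi k n < 1"
  using nested[of 0 k n] assms by (auto simp: hi_def)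

section \<open>Position of two pieces by the first index at which they differ\<close>

lemma sibling_le:
  assumes "\<forall>j\<in>{1..<i}. n j = n' j" "1 \<le> i" "pos (n i) < pos (n' i)"
  shows "hi i n \<le> lo i n'"
    and "pos (n i) + 1 < pos (n' i) \<Longrightarrow> hi i n < lo i n'"
    and "pos (n i) + 1 = pos (n' i) \<Longrightarrow> hi i n = lo i n'"
proof -
  obtain k where k: "i = Suc k" using assms by (cases i) auto
  have c: "lo k n = lo k n'" "wd k n = wd k n'"
    using assms(1) k by (auto intro!: lo_cong wd_cong)
  show "hi i n \<le> lo i n'"
    using cutpt_le[of "pos (n i) + 1" "pos (n' i)"] assms wd_pos[of k n'] c unfolding k hi_Suc by simp
  show "pos (n i) + 1 < pos (n' i) \<Longrightarrow> hi i n < lo i n'"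
    using cutpt_less[of "pos (n i) + 1" "pos (n' i)"] wd_pos[of k n'] c unfolding k hi_Suc by simp
  show "pos (n i) + 1 = pos (n' i) \<Longrightarrow> hi i n = lo i n'"
    using c unfolding k hi_Suc by simp
qed

text \<open>Only consecutive siblings share an end point, and going deeper on either side moves
  strictly away from it; hence the strict version.\<close>

lemma cmp:
  assumes "\<forall>j\<in>{1..<i}. n j = n' j" "1 \<le> i" "i \<le> k" "i \<le> l" "pos (n i) < pos (n' i)"
  shows "hi k n \<le> lo l n'"
    and "i < k \<or> i < l \<or> pos (n i) + 1 < pos (n' i) \<Longrightarrow> hi k n < lo l n'"
  using sibling_le(1,2)[OF assms(1,2,5)] nested_le[OF assms(3), of n] nested_le[OF assms(4), of n']
    nested[of i k n] nested[of i l n'] by linarith+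

lemma first_difference:
  assumes "\<not> (\<forall>i\<in>{1..<k::nat}. n i = (n' i :: int))"
  shows "\<exists>i. 1 \<le> i \<and> i < k \<and> n i \<noteq> n' i \<and> (\<forall>j\<in>{1..<i}. n j = n' j)"
proof -
  let ?P = "\<lambda>i. 1 \<le> i \<and> i < k \<and> n i \<noteq> n' i"
  have ex: "\<exists>i. ?P i" using assms by auto
  define i where "i = (LEAST i. ?P i)"
  have "?P i" unfolding i_def by (rule LeastI_ex[of ?P, OF ex])
  moreover have "n j = n' j" if "1 \<le> j" "j < i" for j
    using not_less_Least[of j ?P] that calculation unfolding i_def[symmetric] by auto
  ultimately show ?thesis by auto
qed

text \<open>The bound \<open>m\<close> is kept independent of the levels \<open>k\<close> and
  \<open>l\<close>, so that the lemma also applies to the parent piece around a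
  \<open>q_elem\<close> interval, whose level is one less.\<close>

lemma separated:
  assumes "\<not> (\<forall>j\<in>{1..<m}. n j = n' j)" "m \<le> Suc k" "m \<le> Suc l" "\<forall>i\<in>{1..<m}. n i \<in> Z0 \<and> n' i \<in> Z0"
  shows "hi k n \<le> lo l n' \<or> hi l n' \<le> lo k n"
    and "m \<le> k \<or> m \<le> l \<Longrightarrow> hi k n < lo l n' \<or> hi l n' < lo k n"
proof -
  obtain i where i: "1 \<le> i" "i < m" "n i \<noteq> n' i" "\<forall>j\<in>{1..<i}. n j = n' j"
    using first_difference[OF assms(1)] by blast
  have ik: "i \<le> k" "i \<le> l" using i assms by auto
  have sym: "\<forall>j\<in>{1..<i}. n' j = n j" using i(4) by auto
  have "pos (n i) < pos (n' i) \<or> pos (n' i) < pos (n i)"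
    using pos_inj[of "n i" "n' i"] i assms(4) by fastforce
  then show "hi k n \<le> lo l n' \<or> hi l n' \<le> lo k n"
    using cmp(1)[OF i(4,1) ik] cmp(1)[OF sym i(1) ik(2,1)] by blast
  assume "m \<le> k \<or> m \<le> l"
  then have "i < k \<or> i < l" using i by auto
  then show "hi k n < lo l n' \<or> hi l n' < lo k n"
    using cmp(2)[OF i(4,1) ik] cmp(2)[OF sym i(1) ik(2,1)]
      \<open>pos (n i) < pos (n' i) \<or> pos (n' i) < pos (n i)\<close> by blast
qed

text \<open>The element \<open>q_elem At \<phi> k n r\<close> will be realized by the interval from \<open>qlo k n r\<close> to \<open>qhi k n r\<close>,
  a neighbourhood of the left end of the piece \<open>n\<^sub>1, \<dots>, n\<^sub>k\<close>.\<close>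

definition left :: "nat \<Rightarrow> (nat \<Rightarrow> int) \<Rightarrow> nat \<Rightarrow> int" where
  "left k n = n(k := pr (n k))"

text \<open>The set \<open>succ_set r\<close> omits \<open>r\<close>, so the interval begins at the
  right end of subpiece \<open>r\<close> of the left neighbour; likewise
  \<open>pred_set (- r)\<close> omits \<open>- r\<close>, and the interval ends at the left end of
  subpiece \<open>- r\<close>.\<close>

definition qlo :: "nat \<Rightarrow> (nat \<Rightarrow> int) \<Rightarrow> int \<Rightarrow> real" where
  "qlo k n r = hi (Suc k) ((left k n)(Suc k := r))"

definition qhi :: "nat \<Rightarrow> (nat \<Rightarrow> int) \<Rightarrow> int \<Rightarrow> real" where
  "qhi k n r = lo (Suc k) (n(Suc k := - r))"

lemma hi_left: assumes "1 \<le> k" "n k \<in> Z0" shows "hi k (left k n) = lo k n"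
  using sibling_le(3)[of k "left k n" n] assms by (auto simp: left_def pos_pr)

lemma qlo_bounds:
  assumes "1 \<le> k" "n k \<in> Z0"
  shows "lo k (left k n) < qlo k n r" "qlo k n r < lo k n"
proof -
  let ?n = "(left k n)(Suc k := r)"
  have c: "lo k ?n = lo k (left k n)" "hi k ?n = hi k (left k n)" by (auto intro!: lo_cong hi_cong)
  show "lo k (left k n) < qlo k n r"
    using lo_Suc_less[of k ?n] lo_hi[of "Suc k" ?n] c by (simp add: qlo_def)
  show "qlo k n r < lo k n"
    using hi_Suc_less[of k ?n] c hi_left[of k n, OF assms] by (simp add: qlo_def)
qed

lemma qhi_bounds: "lo k n < qhi k n r" "qhi k n r < hi k n"
proof -
  let ?n = "n(Suc k := - r)"
  have c: "lo k ?n = lo k n" "hi k ?n = hi k n" by (auto intro!: lo_cong hi_cong)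
  show "lo k n < qhi k n r" using lo_Suc_less[of k ?n] c by (simp add: qhi_def)
  show "qhi k n r < hi k n"
    using hi_Suc_less[of k ?n] lo_hi[of "Suc k" ?n] c by (simp add: qhi_def)
qed

text \<open>The interval straddles the common end of two siblings, hence stays inside their parent
  of level \<open>k - 1\<close>; for \<open>k = 1\<close> the parent is the unit interval.\<close>

lemma q_parent:
  assumes "1 \<le> k" "n k \<in> Z0"
  shows "lo (k - 1) n < qlo k n r" "qhi k n r < hi (k - 1) n" "0 < qlo k n r" "qhi k n r < 1"
    "qlo k n r < qhi k n r"
proof -
  have c: "lo (k - 1) (left k n) = lo (k - 1) n" using assms by (auto intro!: lo_cong simp: left_def)
  have s: "Suc (k - 1) = k" using assms by simp
  show 1: "lo (k - 1) n < qlo k n r"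
    using lo_Suc_less[of "k - 1" "left k n"] qlo_bounds[of k n r, OF assms] c unfolding s by linarith
  show 2: "qhi k n r < hi (k - 1) n"
    using hi_Suc_less[of "k - 1" n] qhi_bounds[of k n r] unfolding s by linarith
  show "0 < qlo k n r" "qhi k n r < 1" "qlo k n r < qhi k n r"
    using 1 2 nested_le[of 0 "k - 1" n] qlo_bounds[of k n r, OF assms] qhi_bounds[of k n r]
    by (auto simp: hi_def)
qed

text \<open>Subpiece \<open>- r\<close> itself touches the interval in an end point, but everything
  deeper inside it is strictly to the right. This is the origin of the different rules for
  \<open>l = k + 1\<close> and \<open>l > k + 1\<close>.\<close>

lemma q_right:
  assumes k: "k < l" and ag: "\<forall>i\<in>{1..k}. n' i = n i" and r: "0 < r" and Z: "n' (Suc k) \<in> Z0"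
  shows "n' (Suc k) < - r \<Longrightarrow> hi l n' \<le> qhi k n r"
    and "- r \<le> n' (Suc k) \<Longrightarrow> qhi k n r \<le> lo l n'"
    and "l = Suc k \<Longrightarrow> n' (Suc k) = - r \<Longrightarrow> lo l n' = qhi k n r"
    and "- r \<le> n' (Suc k) \<Longrightarrow> Suc k < l \<or> - r < n' (Suc k) \<Longrightarrow> qhi k n r < lo l n'"
    and "lo k n < lo l n'"
proof -
  let ?m = "n(Suc k := - r)"
  have rZ: "- r \<in> Z0" using r by (simp add: Z0_def)
  have ag1: "\<forall>j\<in>{1..<Suc k}. n' j = ?m j" "\<forall>j\<in>{1..<Suc k}. ?m j = n' j" using ag by auto
  show "hi l n' \<le> qhi k n r" if "n' (Suc k) < - r"
    unfolding qhi_def using that k pos_less[OF Z rZ] by (intro cmp(1)[OF ag1(1)]) auto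
  have eq: "lo (Suc k) n' = qhi k n r" if "n' (Suc k) = - r"
    unfolding qhi_def using that ag by (intro lo_cong) auto
  then show "l = Suc k \<Longrightarrow> n' (Suc k) = - r \<Longrightarrow> lo l n' = qhi k n r" by simp
  have gt: "qhi k n r < lo (Suc k) n'" if "- r < n' (Suc k)"
  proof -
    have "hi (Suc k) ?m \<le> lo (Suc k) n'"
      using that pos_less[OF rZ Z] by (intro cmp(1)[OF ag1(2)]) auto
    then show ?thesis unfolding qhi_def using lo_hi[of "Suc k" ?m] by linarith
  qed
  show "- r \<le> n' (Suc k) \<Longrightarrow> qhi k n r \<le> lo l n'"
    using eq gt nested_le[of "Suc k" l n'] k by fastforce
  show "- r \<le> n' (Suc k) \<Longrightarrow> Suc k < l \<or> - r < n' (Suc k) \<Longrightarrow> qhi k n r < lo l n'"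
    using eq gt nested_le[of "Suc k" l n'] nested[of "Suc k" l n'] k by fastforce
  show "lo k n < lo l n'" using nested(1)[OF k, of n'] lo_cong[OF ag] by simp
qed

lemma q_left:
  assumes k: "1 \<le> k" "k < l" and ag: "\<forall>i\<in>{1..k}. n' i = left k n i" and r: "0 < r"
    and Z: "n' (Suc k) \<in> Z0" "n k \<in> Z0"
  shows "r < n' (Suc k) \<Longrightarrow> qlo k n r \<le> lo l n'"
    and "n' (Suc k) \<le> r \<Longrightarrow> hi l n' \<le> qlo k n r"
    and "l = Suc k \<Longrightarrow> n' (Suc k) = r \<Longrightarrow> hi l n' = qlo k n r"
    and "n' (Suc k) \<le> r \<Longrightarrow> Suc k < l \<or> n' (Suc k) < r \<Longrightarrow> hi l n' < qlo k n r"
    and "hi l n' < lo k n"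
proof -
  let ?m = "(left k n)(Suc k := r)"
  have rZ: "r \<in> Z0" using r by (simp add: Z0_def)
  have ag1: "\<forall>j\<in>{1..<Suc k}. n' j = ?m j" "\<forall>j\<in>{1..<Suc k}. ?m j = n' j" using ag by auto
  show "qlo k n r \<le> lo l n'" if "r < n' (Suc k)"
    unfolding qlo_def using that k pos_less[OF rZ Z(1)] by (intro cmp(1)[OF ag1(2)]) auto
  have eq: "hi (Suc k) n' = qlo k n r" if "n' (Suc k) = r"
    unfolding qlo_def using that ag by (intro hi_cong) auto
  then show "l = Suc k \<Longrightarrow> n' (Suc k) = r \<Longrightarrow> hi l n' = qlo k n r" by simp
  have lt: "hi (Suc k) n' < qlo k n r" if "n' (Suc k) < r"
  proof -
    have "hi (Suc k) n' \<le> lo (Suc k) ?m"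
      using that pos_less[OF Z(1) rZ] by (intro cmp(1)[OF ag1(1)]) auto
    then show ?thesis unfolding qlo_def using lo_hi[of "Suc k" ?m] by linarith
  qed
  show "n' (Suc k) \<le> r \<Longrightarrow> hi l n' \<le> qlo k n r"
    using eq lt nested_le[of "Suc k" l n'] k by fastforce
  show "n' (Suc k) \<le> r \<Longrightarrow> Suc k < l \<or> n' (Suc k) < r \<Longrightarrow> hi l n' < qlo k n r"
    using eq lt nested_le[of "Suc k" l n'] nested[of "Suc k" l n'] k by fastforce
  show "hi l n' < lo k n" using nested(2)[OF k(2), of n'] hi_cong[OF ag] hi_left[of k n, OF k(1) Z(2)] by simp
qed

lemma q_far:
  assumes k: "1 \<le> k" "k \<le> l" and ag: "\<forall>i\<in>{1..<k}. n' i = n i" and Z: "n k \<in> Z0" "n' k \<in> Z0"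
    and ne: "n' k \<noteq> n k" "n' k \<noteq> pr (n k)"
  shows "hi l n' \<le> lo k (left k n) \<or> hi k n \<le> lo l n'"
proof -
  have "pos (n' k) \<noteq> pos (n k)" "pos (n' k) \<noteq> pos (pr (n k))"
    using ne pos_inj Z pr_Z0 by blast+
  then have "pos (n k) < pos (n' k) \<or> pos (n' k) < pos (left k n k)"
    using pos_pr[OF Z(1)] by (auto simp: left_def)
  moreover have "\<forall>j\<in>{1..<k}. n j = n' j" "\<forall>j\<in>{1..<k}. n' j = left k n j"
    using ag by (auto simp: left_def)
  ultimately show ?thesis
    using cmp(1)[of k n n' k l] cmp(1)[of k n' "left k n" l k] k by blast
qed

text \<open>A point that is not a left end descends through one open piece at every level. Right
  ends need no case of their own, each being the left end of the next sibling.\<close>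

lemma small_pieces:
  assumes t: "0 < t" "t < 1"
  shows "(\<exists>l n. 1 \<le> l \<and> (\<forall>i. n i \<in> Z0) \<and> t = lo l n) \<or>
    (\<exists>n. (\<forall>i. n i \<in> Z0) \<and> lo k n < t \<and> t < hi k n)"
proof (induction k)
  case 0
  then show ?case using t by (auto simp: hi_def Z0_def intro!: exI[of _ "\<lambda>_. 1"])
next
  case (Suc k)
  show ?case
  proof (cases "\<exists>l n. 1 \<le> l \<and> (\<forall>i. n i \<in> Z0) \<and> t = lo l n")
    case False
    then obtain n where n: "\<forall>i. n i \<in> Z0" "lo k n < t" "t < hi k n" using Suc by blast
    \<comment> \<open>The relative position in the current piece, from which
      \<open>cutpt_cover\<close> picks the subpiece.\<close>
    define s where "s = (t - lo k n) / wd k n"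
    have s: "0 < s" "s < 1" and ts: "t = lo k n + wd k n * s"
      using n wd_pos[of k n] by (auto simp: s_def hi_def field_simps)
    obtain m where m: "cutpt m \<le> s" "s < cutpt (m + 1)" using cutpt_cover[OF s] by blast
    obtain p where p: "p \<in> Z0" "pos p = m" using pos_surj by blast
    define n' where "n' = n(Suc k := p)"
    have c: "lo k n' = lo k n" "wd k n' = wd k n" by (auto simp: n'_def intro!: lo_cong wd_cong)
    have Z: "\<forall>i. n' i \<in> Z0" using n p by (simp add: n'_def)
    have "lo (Suc k) n' \<le> t" "t < hi (Suc k) n'"
      using m wd_pos[of k n] c p unfolding hi_Suc ts by (simp_all add: n'_def)
    moreover have "t \<noteq> lo (Suc k) n'" using False Z by force
    ultimately show ?thesis using Z by (intro disjI2 exI[of _ n']) simp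
  qed blast
qed

lemma q_small:
  assumes k: "1 \<le> k" "n k \<in> Z0" and e: "0 < e"
  shows "\<exists>r>0. lo k n - e < qlo k n r \<and> qhi k n r < lo k n + e"
proof -
  \<comment> \<open>Widths are at most 1, so the two distances from \<open>lo k n\<close> are at
    most \<open>1 - cutpt r\<close> and \<open>cutpt (- r)\<close>.\<close>
  obtain r where r: "0 < r" "cutpt (- r) < e" "1 - e < cutpt r" using cutpt_small[OF e] by blast
  have w1: "wd k m \<le> 1" for m
    using wd_le[of k m] power_le_one[of "1/2::real" k] by linarith
  have "wd k n * cutpt (- r) \<le> 1 * cutpt (- r)"
    using w1 cutpt_bounds(1)[of "- r"] by (intro mult_right_mono) auto
  moreover have "qhi k n r = lo k n + wd k n * cutpt (- r)"
  proof -
    have "lo k (n(Suc k := - r)) = lo k n" "wd k (n(Suc k := - r)) = wd k n"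
      by (auto intro!: lo_cong wd_cong)
    then show ?thesis using r by (simp add: qhi_def pos_def)
  qed
  moreover have "qlo k n r = lo k n - wd k (left k n) * (1 - cutpt r)"
  proof -
    let ?m = "(left k n)(Suc k := r)"
    have "lo k ?m = lo k (left k n)" "wd k ?m = wd k (left k n)"
      by (auto intro!: lo_cong wd_cong)
    then have "qlo k n r = lo k (left k n) + wd k (left k n) * cutpt r"
      using r unfolding qlo_def hi_Suc by (simp add: pos_def)
    then show ?thesis using hi_left[of k n, OF k] by (simp add: hi_def algebra_simps)
  qed
  moreover have "wd k (left k n) * (1 - cutpt r) \<le> 1 * (1 - cutpt r)"
    using w1 cutpt_bounds(2)[of r] by (intro mult_right_mono) auto
  ultimately show ?thesis using r by (intro exI[of _ r]) auto
qed

text \<open>Left ends of pieces are handled by the intervals of \<open>B1\<close>; every other point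
  is interior to a piece at each level, and the widths tend to 0.\<close>

lemma small_generators:
  assumes t: "0 < t" "t < 1" and e: "0 < e"
  shows "(\<exists>k n. 1 \<le> k \<and> (\<forall>i. n i \<in> Z0) \<and> t - e < lo k n \<and> lo k n < t \<and> t < hi k n \<and> hi k n < t + e) \<or>
    (\<exists>k n r. 1 \<le> k \<and> (\<forall>i. n i \<in> Z0) \<and> 0 < r \<and> t - e < qlo k n r \<and> qlo k n r < t \<and>
       t < qhi k n r \<and> qhi k n r < t + e)"
proof (cases "\<exists>l n. 1 \<le> l \<and> (\<forall>i. n i \<in> Z0) \<and> t = lo l n")
  case True
  then obtain k n where n: "1 \<le> k" "\<forall>i. n i \<in> Z0" "t = lo k n" by blast
  then obtain r where "r > 0" "t - e < qlo k n r" "qhi k n r < t + e" using q_small e by blast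
  then show ?thesis using n qlo_bounds(2)[of k n r] qhi_bounds(1)[of k n r]
    by (intro disjI2 exI[of _ k] exI[of _ n] exI[of _ r]) auto
next
  case False
  obtain k where k: "(1 / 2) ^ k < e" using real_arch_pow_inv[of e "1/2"] e by auto
  have "(1/2::real) ^ Suc k < e" using k power_decreasing[of k "Suc k" "1/2::real"] by linarith
  moreover obtain n where n: "\<forall>i. n i \<in> Z0" "lo (Suc k) n < t" "t < hi (Suc k) n"
    using small_pieces[OF t, of "Suc k"] False by blast
  ultimately show ?thesis using wd_le[of "Suc k" n]
    by (intro disjI1 exI[of _ "Suc k"] exI[of _ n]) (auto simp: hi_def)
qed

text \<open>The rules for \<open>sigma_gen\<close> say exactly when the closed intervals of two generators meet.\<close>

lemma bb_iff:
  assumes seq: "is_seq k n" "is_seq l n'" and kl: "k \<le> l"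
  shows "lo k n \<le> hi l n' \<and> lo l n' \<le> hi k n \<longleftrightarrow>
    (\<forall>i\<in>{1..<k}. n i = n' i) \<and> (k = l \<longrightarrow> n' k \<in> {pr (n k), n k, nx (n k)}) \<and> (k < l \<longrightarrow> n' k = n k)"
    (is "?L \<longleftrightarrow> ?R")
proof
  have k: "1 \<le> k" and Z: "\<And>i. i \<in> {1..k} \<Longrightarrow> n i \<in> Z0" "\<And>i. i \<in> {1..k} \<Longrightarrow> n' i \<in> Z0"
    using seq kl by (auto simp: is_seq_def)
  have Zk: "n k \<in> Z0" "n' k \<in> Z0" using k Z by auto
  {
    assume L: ?L
    have ag: "\<forall>i\<in>{1..<k}. n i = n' i"
    proof (rule ccontr)
      assume "\<not> ?thesis"
      from separated(2)[OF this, of k l] kl Z L show False by fastforce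
    qed
    then have ag': "\<forall>i\<in>{1..<k}. n' i = n i" by auto
    have "n' k \<in> {pr (n k), n k, nx (n k)}" if "k = l"
    proof -
      \<comment> \<open>Meeting siblings are at most one step apart, where \<open>pos\<close> counts
        steps across the missing 0.\<close>
      have "\<not> pos (n k) + 1 < pos (n' k)" "\<not> pos (n' k) + 1 < pos (n k)"
        using cmp(2)[OF ag k, of k l] cmp(2)[OF ag' k, of l k] L kl that by auto
      then have "pos (n' k) = pos (n k) - 1 \<or> pos (n' k) = pos (n k) \<or> pos (n' k) = pos (n k) + 1" by linarith
      then show ?thesis
        using pos_inj Zk pr_Z0 nx_Z0 pos_pr[OF Zk(1)] pos_nx[OF Zk(1)] by (metis insertCI)
    qed
    moreover have "n' k = n k" if "k < l"
    proof (rule ccontr)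
      assume "n' k \<noteq> n k"
      then have "pos (n k) < pos (n' k) \<or> pos (n' k) < pos (n k)" using pos_inj Zk by fastforce
      then show False
        using cmp(2)[OF ag k, of k l] cmp(2)[OF ag' k, of l k] L that by auto
    qed
    ultimately show ?R using ag by blast
  }
  assume R: ?R
  then have ag: "\<forall>i\<in>{1..<k}. n i = n' i" by blast
  show ?L
  proof (cases "n' k = n k")
    case True
    then have "\<forall>i\<in>{1..k}. n i = n' i" using ag by (metis atLeastAtMost_iff atLeastLessThan_iff le_neq_implies_less)
    from lo_cong[OF this] hi_cong[OF this] show ?thesis
      using nested_le[OF kl, of n'] lo_hi[of l n'] by linarith
  next
    case False
    then have kl: "l = k" and c: "n' k = pr (n k) \<or> n' k = nx (n k)" using R kl by auto
    from c show ?thesis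
    proof
      assume "n' k = pr (n k)"
      then have "hi k n' = hi k (left k n)" using ag by (intro hi_cong) (auto simp: left_def)
      then have "hi l n' = lo k n" using hi_left[of k n, OF k Zk(1)] kl by simp
      then show ?thesis using lo_hi[of k n] lo_hi[of l n'] by linarith
    next
      assume "n' k = nx (n k)"
      then have "pr (n' k) = n k" using Zk(1) by (auto simp: pr_def nx_def Z0_def)
      then have "hi k n = hi k (left k n')" using ag by (intro hi_cong) (auto simp: left_def)
      then have "hi k n = lo l n'" using hi_left[of k n', OF k Zk(2)] kl by simp
      then show ?thesis using lo_hi[of k n] lo_hi[of l n'] by linarith
    qed
  qed
qed

text \<open>The interval lies strictly inside its parent of level \<open>k - 1\<close>, which is at
  least \<open>l\<close>; only the position of that parent relative to the coarser piece
  matters.\<close>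

lemma qb_gt_iff:
  assumes seq: "is_seq k n" "is_seq l n'" and lk: "l < k"
  shows "qlo k n r \<le> hi l n' \<and> lo l n' \<le> qhi k n r \<longleftrightarrow> (\<forall>i\<in>{1..l}. n i = n' i)"
    (is "?L \<longleftrightarrow> ?R")
proof
  have k: "1 \<le> k" "n k \<in> Z0" and Z: "\<forall>i\<in>{1..<Suc l}. n i \<in> Z0 \<and> n' i \<in> Z0"
    using seq lk by (auto simp: is_seq_def)
  note p = q_parent[of k n r, OF k]
  have s: "Suc l \<le> Suc (k - 1)" "l \<le> k - 1" using lk by auto
  show ?R if ?L
  proof (rule ccontr)
    assume "\<not> ?R"
    then have "\<not> (\<forall>i\<in>{1..<Suc l}. n i = n' i)" by auto
    from separated(1)[OF this s(1) order_refl Z] p that show False by linarith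
  qed
  show ?L if ?R
    using lo_cong[OF that] hi_cong[OF that] nested_le[OF s(2), of n] p by linarith
qed

text \<open>Reduces the later case analysis to what lies inside the two pieces adjoining
  \<open>lo k n\<close>.\<close>

lemma q_near:
  assumes k: "1 \<le> k" "n k \<in> Z0" and kl: "k \<le> l" and Z: "\<forall>i\<in>{1..k}. n i \<in> Z0 \<and> n' i \<in> Z0"
    and m: "qlo k n r \<le> hi l n'" "lo l n' \<le> qhi k n r"
  shows "(\<forall>i\<in>{1..<k}. n i = n' i) \<and> n' k \<in> {pr (n k), n k}"
proof -
  note p = q_parent[of k n r, OF k]
  have Z': "\<forall>i\<in>{1..<k}. n i \<in> Z0 \<and> n' i \<in> Z0" "n' k \<in> Z0" using Z k by auto
  have ag: "\<forall>i\<in>{1..<k}. n i = n' i"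
  proof (rule ccontr)
    assume "\<not> ?thesis"
    from separated(1)[OF this _ _ Z'(1), of "k - 1" l] p m kl k show False by fastforce
  qed
  then have ag': "\<forall>i\<in>{1..<k}. n' i = n i" by auto
  have "n' k \<in> {pr (n k), n k}"
  proof (rule ccontr)
    assume "\<not> ?thesis"
    then have "hi l n' \<le> lo k (left k n) \<or> hi k n \<le> lo l n'"
      using q_far[of k l n' n, OF k(1) kl ag' k(2) Z'(2)] by auto
    then show False using qlo_bounds(1)[of k n r, OF k] qhi_bounds(2)[of k n r] m by linarith
  qed
  then show ?thesis using ag by blast
qed

lemma agree_right:
  assumes "\<forall>i\<in>{1..<k}. n i = n' i" "n' k = n k"
  shows "\<forall>i\<in>{1..k::nat}. n' i = (n i :: int)"
  using assms by (metis atLeastAtMost_iff atLeastLessThan_iff le_neq_implies_less)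

lemma agree_left:
  assumes "\<forall>i\<in>{1..<k}. n i = n' i" "n' k = pr (n k)"
  shows "\<forall>i\<in>{1..k}. n' i = left k n i"
  using assms by (auto simp: left_def)

lemma qb_le_iff:
  assumes seq: "is_seq k n" "is_seq l n'" and r: "0 < r" and kl: "k \<le> l"
  shows "qlo k n r \<le> hi l n' \<and> lo l n' \<le> qhi k n r \<longleftrightarrow>
    (\<forall>i\<in>{1..<k}. n i = n' i) \<and> (l = k \<longrightarrow> n' k \<in> {pr (n k), n k}) \<and>
    (l = k + 1 \<longrightarrow> (n' (k + 1) \<ge> r \<and> n' k = pr (n k)) \<or> (n' (k + 1) \<le> - r \<and> n' k = n k)) \<and>
    (l > k + 1 \<longrightarrow> (n' (k + 1) > r \<and> n' k = pr (n k)) \<or> (n' (k + 1) < - r \<and> n' k = n k))"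
    (is "?L \<longleftrightarrow> ?R")
proof
  have k: "1 \<le> k" "n k \<in> Z0" and Z: "\<forall>i\<in>{1..k}. n i \<in> Z0 \<and> n' i \<in> Z0"
    using seq kl by (auto simp: is_seq_def)
  have Z1: "n' (Suc k) \<in> Z0" if "k < l" using seq that by (auto simp: is_seq_def)
  note b = qlo_bounds[of k n r, OF k] qhi_bounds[of k n r] lo_hi[of l n']
  {
    assume L: ?L
    have near: "(\<forall>i\<in>{1..<k}. n i = n' i) \<and> n' k \<in> {pr (n k), n k}"
      using L by (intro q_near[where l = l and r = r] k kl Z) auto
    have R: "n' (Suc k) < - r \<or> l = Suc k \<and> n' (Suc k) = - r" if "n' k = n k" "k < l"
    proof (rule ccontr)
      assume no: "\<not> ?thesis"
      have ag: "\<forall>i\<in>{1..k}. n' i = n i" using agree_right near that(1) by blast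
      have "qhi k n r < lo l n'"
        by (rule q_right(4)[of k l n' n r, OF that(2) ag r Z1[OF that(2)]]) (use no that in auto)
      then show False using L by linarith
    qed
    have Lf: "r < n' (Suc k) \<or> l = Suc k \<and> n' (Suc k) = r" if "n' k = pr (n k)" "k < l"
    proof (rule ccontr)
      assume no: "\<not> ?thesis"
      have ag: "\<forall>i\<in>{1..k}. n' i = left k n i" using agree_left near that(1) by blast
      have "hi l n' < qlo k n r"
        by (rule q_left(4)[of k l n' n r, OF k(1) that(2) ag r Z1[OF that(2)] k(2)]) (use no that in auto)
      then show False using L by linarith
    qed
    have c: "n' k = n k \<and> (n' (Suc k) < - r \<or> l = Suc k \<and> n' (Suc k) = - r) \<or>
        n' k = pr (n k) \<and> (r < n' (Suc k) \<or> l = Suc k \<and> n' (Suc k) = r)" if "k < l"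
      using near R[OF _ that] Lf[OF _ that] by blast
    show ?R
    proof (intro conjI impI)
      show "\<forall>i\<in>{1..<k}. n i = n' i" "n' k \<in> {pr (n k), n k}" using near by simp_all
      show "n' (k + 1) \<ge> r \<and> n' k = pr (n k) \<or> n' (k + 1) \<le> - r \<and> n' k = n k" if "l = k + 1"
        using c that by auto
      show "n' (k + 1) > r \<and> n' k = pr (n k) \<or> n' (k + 1) < - r \<and> n' k = n k" if "l > k + 1"
        using c that by auto
    qed
  }
  assume R: ?R
  then have ag: "\<forall>i\<in>{1..<k}. n i = n' i" by blast
  consider "l = k" "n' k = n k" | "l = k" "n' k = pr (n k)"
    | "k < l" "n' k = n k" "n' (Suc k) < - r \<or> l = Suc k \<and> n' (Suc k) = - r"
    | "k < l" "n' k = pr (n k)" "r < n' (Suc k) \<or> l = Suc k \<and> n' (Suc k) = r"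
  proof -
    consider "l = k" | "l = k + 1" | "l > k + 1" using kl by linarith
    then show thesis
    proof cases
      case 1
      then show thesis using R that(1,2) by blast
    next
      case 2
      then have "(n' (k + 1) \<ge> r \<and> n' k = pr (n k)) \<or> (n' (k + 1) \<le> - r \<and> n' k = n k)" using R by blast
      then show thesis using that(3,4) 2 by fastforce
    next
      case 3
      then have "(n' (k + 1) > r \<and> n' k = pr (n k)) \<or> (n' (k + 1) < - r \<and> n' k = n k)" using R by blast
      then show thesis using that(3,4) 3 by fastforce
    qed
  qed
  then show ?L
  proof cases
    case 1
    then show ?thesis using lo_cong[OF agree_right[OF ag 1(2)]] b by simp
  next
    case 2
    then have "hi l n' = lo k n" using hi_cong[OF agree_left[OF ag 2(2)]] hi_left[of k n, OF k] by simp
    then show ?thesis using b by linarith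
  next
    case 3
    note q = q_right[OF 3(1) agree_right[OF ag 3(2)] r Z1[OF 3(1)]]
    show ?thesis using 3(3) q(1) q(3) q(5) b by linarith
  next
    case 4
    note q = q_left[OF k(1) 4(1) agree_left[OF ag 4(2)] r Z1[OF 4(1)] k(2)]
    show ?thesis using 4(3) q(1) q(3) q(5) b by linarith
  qed
qed

text \<open>For adjacent pieces both intervals reach into piece \<open>n\<close>: one only up to the
  left end of subpiece \<open>- r\<close>, the other only from the right end of subpiece
  \<open>r'\<close>. Positivity of \<open>r\<close> and \<open>r'\<close> keeps them apart.\<close>

lemma q_siblings:
  assumes k: "1 \<le> k" "n k \<in> Z0" "n' k \<in> Z0" and ag: "\<forall>i\<in>{1..<k}. n i = n' i"
    and r: "0 < r" "0 < r'" and less: "pos (n k) < pos (n' k)"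
  shows "qhi k n r < qlo k n' r'"
proof -
  let ?m = "(left k n')(Suc k := r')"
  have q: "qlo k n' r' = hi (Suc k) ?m" by (simp add: qlo_def)
  have agm: "\<forall>i\<in>{1..<k}. n i = ?m i" using ag by (auto simp: left_def)
  show ?thesis
  proof (cases "pos (n k) < pos (pr (n' k))")
    case True
    then have "hi k n \<le> lo (Suc k) ?m"
      by (intro cmp(1)[OF agm k(1)]) (auto simp: left_def)
    then show ?thesis using qhi_bounds(2)[of k n r] lo_hi[of "Suc k" ?m] q by linarith
  next
    case False
    then have "pos (pr (n' k)) = pos (n k)" using less pos_pr[OF k(3)] by linarith
    then have "pr (n' k) = n k" using pos_inj pr_Z0 k by blast
    then have "?m k = n k" by (simp add: left_def)
    from agree_right[OF agm this] have "qhi k n r \<le> lo (Suc k) ?m"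
      using r by (intro q_right(2)) (auto simp: Z0_def)
    then show ?thesis using lo_hi[of "Suc k" ?m] q by linarith
  qed
qed

lemma qq_iff:
  assumes seq: "is_seq k n" "is_seq l n'" and r: "0 < r" "0 < r'" and kl: "k \<le> l"
  shows "qlo k n r \<le> qhi l n' r' \<and> qlo l n' r' \<le> qhi k n r \<longleftrightarrow>
    (\<forall>i\<in>{1..<k}. n i = n' i) \<and> (l = k \<longrightarrow> n' k = n k) \<and>
    (l = k + 1 \<longrightarrow> (n' k = n k \<and> n' (k + 1) \<le> - r) \<or> (n' k = pr (n k) \<and> n' (k + 1) > r)) \<and>
    (l > k + 1 \<longrightarrow> (n' k = n k \<and> n' (k + 1) < - r) \<or> (n' k = pr (n k) \<and> n' (k + 1) > r))"
    (is "?L \<longleftrightarrow> ?R")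
proof
  have k: "1 \<le> k" "n k \<in> Z0" and l: "1 \<le> l" "n' l \<in> Z0" and Z: "\<forall>i\<in>{1..k}. n i \<in> Z0 \<and> n' i \<in> Z0"
    using seq kl by (auto simp: is_seq_def)
  have Z1: "n' (Suc k) \<in> Z0" if "k < l" using seq that by (auto simp: is_seq_def)
  have Z': "\<forall>i\<in>{1..<k}. n i \<in> Z0 \<and> n' i \<in> Z0" "n' k \<in> Z0" using Z k by auto
  note b = qlo_bounds[of k n r, OF k] qhi_bounds[of k n r] qlo_bounds[of l n' r', OF l] qhi_bounds[of l n' r']
  note p = q_parent[of k n r, OF k] q_parent[of l n' r', OF l]
  {
    assume L: ?L
    have ag: "\<forall>i\<in>{1..<k}. n i = n' i"
    proof (rule ccontr)
      assume "\<not> ?thesis"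
      from separated(1)[OF this _ _ Z'(1), of "k - 1" "l - 1"] p L kl k l show False by fastforce
    qed
    then have ag': "\<forall>i\<in>{1..<k}. n' i = n i" by auto
    have same: "n' k = n k" if "l = k"
    proof (rule ccontr)
      assume "n' k \<noteq> n k"
      then have "pos (n k) < pos (n' k) \<or> pos (n' k) < pos (n k)" using pos_inj k Z' by fastforce
      then show False
        using q_siblings[OF k Z'(2) ag r] q_siblings[OF k(1) Z'(2) k(2) ag' r(2,1)] L that by fastforce
    qed
    have near: "n' k \<in> {pr (n k), n k}" if "k < l"
    proof (rule ccontr)
      assume "\<not> ?thesis"
      then have "hi (l - 1) n' \<le> lo k (left k n) \<or> hi k n \<le> lo (l - 1) n'"
        using q_far[of k "l - 1" n' n, OF k(1) _ ag' k(2) Z'(2)] that by auto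
      then show False using b p L by linarith
    qed
    have R: "n' (Suc k) < - r \<or> l = Suc k \<and> n' (Suc k) = - r" if "n' k = n k" "k < l"
    proof (rule ccontr)
      assume no: "\<not> ?thesis"
      show False
      proof (cases "l = Suc k")
        case True
        \<comment> \<open>The second interval reaches into the left neighbour of its piece, so the
          comparison is with \<open>pr (n' (Suc k))\<close>; this is still at least
          \<open>- r\<close>, also across the missing 0.\<close>
        then have "- r \<le> pr (n' (Suc k))" using no r by (auto simp: pr_def)
        moreover have "\<forall>i\<in>{1..k}. left l n' i = n i"
          using agree_right[OF ag that(1)] True by (auto simp: left_def)
        ultimately have "qhi k n r \<le> lo l (left l n')"
          using True r pr_Z0[OF Z1[OF that(2)]] by (intro q_right(2)) (auto simp: left_def)
        then show False using b L by linarith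
      next
        case False
        then have "qhi k n r \<le> lo (l - 1) n'"
          using that no agree_right[OF ag that(1)] r Z1[OF that(2)] by (intro q_right(2)) auto
        then show False using p L by linarith
      qed
    qed
    \<comment> \<open>Strict on this side even for \<open>l = k + 1\<close>: the second interval
      ends before \<open>hi l n'\<close>, which for index \<open>r\<close> is exactly
      \<open>qlo k n r\<close>.\<close>
    have Lf: "r < n' (Suc k)" if "n' k = pr (n k)" "k < l"
    proof (rule ccontr)
      assume no: "\<not> ?thesis"
      show False
      proof (cases "l = Suc k")
        case True
        have "hi l n' \<le> qlo k n r"
          using that no agree_left[OF ag that(1)] r Z1[OF that(2)] k by (intro q_left(2)) auto
        then show False using b L by linarith
      next
        case False
        then have "hi (l - 1) n' \<le> qlo k n r"
          using that no agree_left[OF ag that(1)] r Z1[OF that(2)] k by (intro q_left(2)) auto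
        then show False using p L by linarith
      qed
    qed
    have c: "n' k = n k \<and> (n' (Suc k) < - r \<or> l = Suc k \<and> n' (Suc k) = - r) \<or>
        n' k = pr (n k) \<and> r < n' (Suc k)" if "k < l"
      using near[OF that] R[OF _ that] Lf[OF _ that] by blast
    show ?R
    proof (intro conjI impI)
      show "n' k = n k" if "l = k" using same that by simp
      show "n' k = n k \<and> n' (k + 1) \<le> - r \<or> n' k = pr (n k) \<and> r < n' (k + 1)" if "l = k + 1"
        using c that by auto
      show "n' k = n k \<and> n' (k + 1) < - r \<or> n' k = pr (n k) \<and> r < n' (k + 1)" if "l > k + 1"
        using c that by auto
    qed (rule ag)
  }
  assume R: ?R
  then have ag: "\<forall>i\<in>{1..<k}. n i = n' i" by blast
  consider "l = k" "n' k = n k"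
    | "k < l" "n' k = n k" "n' (Suc k) < - r \<or> l = Suc k \<and> n' (Suc k) = - r"
    | "k < l" "n' k = pr (n k)" "r < n' (Suc k)"
  proof -
    consider "l = k" | "l = k + 1" | "l > k + 1" using kl by linarith
    then show thesis
    proof cases
      case 1
      then show thesis using R that(1) by blast
    next
      case 2
      then have "(n' k = n k \<and> n' (k + 1) \<le> - r) \<or> (n' k = pr (n k) \<and> n' (k + 1) > r)" using R by blast
      then show thesis using that(2,3) 2 by fastforce
    next
      case 3
      then have "(n' k = n k \<and> n' (k + 1) < - r) \<or> (n' k = pr (n k) \<and> n' (k + 1) > r)" using R by blast
      then show thesis using that(2,3) 3 by fastforce
    qed
  qed
  then show ?L
  proof cases
    case 1
    then show ?thesis using lo_cong[OF agree_right[OF ag 1(2)]] b by simp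
  next
    case 2
    note q = q_right[OF 2(1) agree_right[OF ag 2(2)] r(1) Z1[OF 2(1)]]
    show ?thesis using 2(3) q(1) q(3) q(5) b lo_hi[of l n'] by linarith
  next
    case 3
    note q = q_left[OF k(1) 3(1) agree_left[OF ag 3(2)] r(1) Z1[OF 3(1)] k(2)]
    show ?thesis using 3(3) q(1) q(5) b lo_hi[of l n'] by linarith
  qed
qed

text \<open>Together with \<open>q_outside\<close>: every piece of level beyond \<open>k\<close>
  lies in the interval or misses its interior. This dichotomy is what \<open>match_eqI\<close> asks
  for.\<close>

lemma q_inside:
  assumes k: "1 \<le> k" "n k \<in> Z0" and kl: "k < l" and r: "0 < r" and Z: "n' (Suc k) \<in> Z0"
    and c: "(\<forall>i\<in>{1..k}. n' i = n i) \<and> n' (Suc k) < - r \<or> (\<forall>i\<in>{1..k}. n' i = left k n i) \<and> r < n' (Suc k)"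
  shows "qlo k n r \<le> lo l n' \<and> hi l n' \<le> qhi k n r"
  using c
proof (elim disjE conjE)
  assume "\<forall>i\<in>{1..k}. n' i = n i" "n' (Suc k) < - r"
  then show ?thesis
    using q_right(1,5)[of k l n' n r, OF kl _ r Z] qlo_bounds[of k n r, OF k] by fastforce
next
  assume "\<forall>i\<in>{1..k}. n' i = left k n i" "r < n' (Suc k)"
  then show ?thesis
    using q_left(1,5)[of k l n' n r, OF k(1) kl _ r Z k(2)] qhi_bounds[of k n r] by fastforce
qed

lemma q_outside:
  assumes k: "1 \<le> k" and kl: "k < l" and r: "0 < r" and Z: "\<And>i. n i \<in> Z0" "\<And>i. n' i \<in> Z0"
    and c: "\<not> ((\<forall>i\<in>{1..k}. n' i = n i) \<and> n' (Suc k) < - r)"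
      "\<not> ((\<forall>i\<in>{1..k}. n' i = left k n i) \<and> r < n' (Suc k))"
  shows "hi l n' \<le> qlo k n r \<or> qhi k n r \<le> lo l n'"
proof (rule ccontr)
  assume no: "\<not> ?thesis"
  then have near: "(\<forall>i\<in>{1..<k}. n i = n' i) \<and> n' k \<in> {pr (n k), n k}"
    using Z by (intro q_near[of k n l n' r, OF k Z(1)]) (use kl in auto)
  show False
  proof (cases "n' k = n k")
    case True
    then have ag: "\<forall>i\<in>{1..k}. n' i = n i" using agree_right[OF conjunct1[OF near]] by simp
    have "\<not> n' (Suc k) < - r" using c(1) ag by simp
    then show False using q_right(2)[of k l n' n r, OF kl ag r Z(2)] no by simp
  next
    case False
    then have ag: "\<forall>i\<in>{1..k}. n' i = left k n i" using agree_left[OF conjunct1[OF near]] near by simp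
    have "\<not> r < n' (Suc k)" using c(2) ag by simp
    then show False using q_left(2)[of k l n' n r, OF k kl ag r Z(2,1)] no by simp
  qed
qed

section \<open>Arcs of the circle\<close>

definition circ :: "complex topology" where
  "circ = top_of_set (sphere 0 1)"

definition ecirc :: "real \<Rightarrow> complex" where
  "ecirc t = cis (2 * pi * t)"

text \<open>The angle as a fraction of a full turn, in \<open>[0, 1)\<close>. It jumps at the point
  1, so neighbourhoods of arbitrary points are pulled back along \<open>ecirc\<close>.\<close>

definition th :: "complex \<Rightarrow> real" where
  "th z = Arg2pi z / (2 * pi)"

definition carc :: "real \<Rightarrow> real \<Rightarrow> complex set" where
  "carc a b = {z \<in> sphere 0 1. a \<le> th z \<and> th z \<le> b}"

definition oarc :: "real \<Rightarrow> real \<Rightarrow> complex set" where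
  "oarc a b = {z \<in> sphere 0 1. a < th z \<and> th z < b}"

lemma topspace_circ [simp]: "topspace circ = sphere 0 1"
  by (simp add: circ_def)

lemma open_circ [simp]: "openin circ (sphere 0 1)"
  using openin_topspace[of circ] by simp

lemma circ_compact: "compact_space circ" and circ_Hausdorff: "Hausdorff_space circ"
  by (simp_all add: circ_def compact_space_subtopology Hausdorff_space_subtopology)

lemma th_range: "0 \<le> th z" "th z < 1"
  using Arg2pi_ge_0[of z] Arg2pi_lt_2pi[of z] by (simp_all add: th_def divide_simps)

lemma norm_ecirc [simp]: "norm (ecirc t) = 1"
  by (simp add: ecirc_def)

lemma ecirc_sphere [simp]: "ecirc t \<in> sphere 0 1"
  by (simp add: ecirc_def)

lemma th_ecirc: "\<lbrakk>0 \<le> t; t < 1\<rbrakk> \<Longrightarrow> th (ecirc t) = t"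
  using Arg2pi_unique[of 1 "2 * pi * t" "ecirc t"]
  by (simp add: th_def ecirc_def cis_conv_exp mult.commute)

lemma ecirc_th: "z \<in> sphere 0 1 \<Longrightarrow> ecirc (th z) = z"
  using Arg2pi_eq[of z] by (simp add: ecirc_def th_def cis_conv_exp mult.commute)

lemma ecirc_0: "ecirc 0 = 1"
  by (simp add: ecirc_def)

lemma th_pos: "\<lbrakk>z \<in> sphere 0 1; z \<noteq> 1\<rbrakk> \<Longrightarrow> 0 < th z"
  using ecirc_th[of z] ecirc_0 th_range(1)[of z] by (metis less_eq_real_def)

lemma th_1: "th 1 = 0"
  using th_ecirc[of 0] ecirc_0 by simp

lemma continuous_ecirc: "continuous_on UNIV ecirc"
  unfolding ecirc_def by (intro continuous_intros)

lemma oarc_open: "\<lbrakk>0 \<le> a; b \<le> 1\<rbrakk> \<Longrightarrow> openin circ (oarc a b)"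
proof -
  assume ab: "0 \<le> a" "b \<le> 1"
  have "oarc a b = sphere 0 1 \<inter> ({y. 2 * pi * a < Arg2pi y} \<inter> {y. Arg2pi y < 2 * pi * b})"
    by (auto simp: oarc_def th_def field_simps)
  moreover have "open ({y. 2 * pi * a < Arg2pi y} \<inter> {y. Arg2pi y < 2 * pi * b})"
    using ab by (intro open_Arg2pi2pi_less_Int) auto
  ultimately show ?thesis unfolding circ_def by (simp add: openin_open_Int)
qed

lemma carc_image:
  assumes "0 \<le> a" "b < 1"
  shows "carc a b = ecirc ` {a..b}"
proof
  show "carc a b \<subseteq> ecirc ` {a..b}"
  proof
    fix z assume "z \<in> carc a b"
    then show "z \<in> ecirc ` {a..b}"
      using ecirc_th[of z] by (intro image_eqI[of _ _ "th z"]) (auto simp: carc_def)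
  qed
  show "ecirc ` {a..b} \<subseteq> carc a b"
  proof
    fix z assume "z \<in> ecirc ` {a..b}"
    then obtain t where "z = ecirc t" "a \<le> t" "t \<le> b" by auto
    then show "z \<in> carc a b" using th_ecirc[of t] ecirc_sphere[of t] assms by (simp add: carc_def)
  qed
qed

lemma carc_closed: "\<lbrakk>0 \<le> a; b < 1\<rbrakk> \<Longrightarrow> closedin circ (carc a b)"
proof -
  assume ab: "0 \<le> a" "b < 1"
  have "compact (carc a b)"
    unfolding carc_image[OF ab] using continuous_ecirc
    by (intro compact_continuous_image) (auto intro: continuous_on_subset)
  then show ?thesis unfolding circ_def
    by (intro closed_subset compact_imp_closed) (auto simp: carc_def)
qed

text \<open>\<open>ecirc\<close> is continuous on the whole line; as \<open>s\<close> ranges over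
  all reals, the point 1 is covered as well.\<close>

lemma openin_circ_ball:
  assumes U: "openin circ U" and z: "z \<in> U"
  shows "\<exists>e>0. \<forall>s. \<bar>s - th z\<bar> < e \<longrightarrow> ecirc s \<in> U"
proof -
  obtain W where W: "open W" "U = sphere 0 1 \<inter> W" using U by (auto simp: circ_def openin_open)
  have "open (ecirc -` W)" using continuous_ecirc W(1) by (simp add: continuous_on_open_vimage)
  moreover have "th z \<in> ecirc -` W" using ecirc_th z W by auto
  ultimately obtain e where e: "e > 0" "\<And>s. dist s (th z) < e \<Longrightarrow> s \<in> ecirc -` W"
    by (meson open_dist)
  then show ?thesis using W by (intro exI[of _ e]) (auto simp: dist_real_def)
qed

lemma closure_oarc:
  assumes ab: "0 \<le> a" "a < b" "b < 1"
  shows "circ closure_of oarc a b = carc a b"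
proof
  show "circ closure_of oarc a b \<subseteq> carc a b"
    using ab carc_closed by (intro closure_of_minimal) (auto simp: carc_def oarc_def)
  show "carc a b \<subseteq> circ closure_of oarc a b"
  proof
    fix z assume z: "z \<in> carc a b"
    then have zs: "z \<in> sphere 0 1" by (auto simp: carc_def)
    have "\<exists>y. y \<in> oarc a b \<and> y \<in> U" if U: "z \<in> U" "openin circ U" for U
    proof -
      obtain e where e: "e > 0" "\<forall>s. \<bar>s - th z\<bar> < e \<longrightarrow> ecirc s \<in> U"
        using openin_circ_ball[OF U(2,1)] by blast
      have "\<exists>s. \<bar>s - th z\<bar> < e \<and> a < s \<and> s < b"
      proof (cases "th z = b")
        case True
        obtain s where "max a (b - e) < s" "s < b" using dense[of "max a (b - e)" b] ab e by auto
        then show ?thesis using True by (intro exI[of _ s]) auto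
      next
        case False
        then have "a \<le> th z" "th z < b" using z by (auto simp: carc_def)
        moreover obtain s where "th z < s" "s < min b (th z + e)"
          using dense[of "th z" "min b (th z + e)"] calculation e by auto
        ultimately show ?thesis by (intro exI[of _ s]) auto
      qed
      then obtain s where s: "\<bar>s - th z\<bar> < e" "a < s" "s < b" by blast
      then have "ecirc s \<in> oarc a b" using ab th_ecirc[of s] by (auto simp: oarc_def)
      then show ?thesis using e s by blast
    qed
    then show "z \<in> circ closure_of oarc a b" using zs by (auto simp: in_closure_of)
  qed
qed

lemma interior_arc:
  assumes ab: "0 < a" "a < b" "b < 1"
  shows "circ interior_of carc a b = oarc a b"
proof
  show "oarc a b \<subseteq> circ interior_of carc a b"
    using ab oarc_open by (intro interior_of_maximal) (auto simp: oarc_def carc_def)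
  show "circ interior_of carc a b \<subseteq> oarc a b"
  proof
    fix z assume z: "z \<in> circ interior_of carc a b"
    then have za: "z \<in> carc a b" using interior_of_subset by fastforce
    obtain e where e: "e > 0" "\<forall>s. \<bar>s - th z\<bar> < e \<longrightarrow> ecirc s \<in> circ interior_of carc a b"
      using openin_circ_ball[OF openin_interior_of z] by blast
    have in_arc: "a \<le> s \<and> s \<le> b" if "\<bar>s - th z\<bar> < e" "0 \<le> s" "s < 1" for s
    proof -
      have "ecirc s \<in> carc a b" using e that interior_of_subset by fastforce
      then show ?thesis using th_ecirc that by (auto simp: carc_def)
    qed
    have t: "a \<le> th z" "th z \<le> b" using za by (auto simp: carc_def)
    have "a \<noteq> th z"
    proof
      assume az: "a = th z"
      obtain s where "max 0 (a - e) < s" "s < a" using dense[of "max 0 (a - e)" a] ab e by auto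
      then show False using in_arc[of s] az ab by auto
    qed
    moreover have "th z \<noteq> b"
    proof
      assume bz: "th z = b"
      obtain s where "b < s" "s < min 1 (b + e)" using dense[of b "min 1 (b + e)"] ab e by auto
      then show False using in_arc[of s] bz ab by auto
    qed
    moreover note t
    ultimately show "z \<in> oarc a b" using za by (auto simp: carc_def oarc_def less_le)
  qed
qed

lemma carc_RC: "\<lbrakk>0 < a; a < b; b < 1\<rbrakk> \<Longrightarrow> carc a b \<in> carrier (RC circ)"
  using closure_oarc[of a b] RC_closure_open[OF oarc_open[of a b]] by simp

lemma carc_mono: "\<lbrakk>c \<le> a; b \<le> d\<rbrakk> \<Longrightarrow> carc a b \<subseteq> carc c d"
  by (auto simp: carc_def)

lemma carc_meets:
  assumes "0 \<le> a" "a \<le> b" "b < 1" "0 \<le> c" "c \<le> d" "d < 1"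
  shows "carc a b \<inter> carc c d \<noteq> {} \<longleftrightarrow> a \<le> d \<and> c \<le> b"
proof
  assume "a \<le> d \<and> c \<le> b"
  then have "ecirc (max a c) \<in> carc a b \<inter> carc c d"
    using assms th_ecirc[of "max a c"] by (auto simp: carc_def)
  then show "carc a b \<inter> carc c d \<noteq> {}" by blast
qed (auto simp: carc_def)

lemma one_notin_arc: "0 < a \<Longrightarrow> 1 \<notin> carc a b"
  by (simp add: carc_def th_1)

lemma carc_inside:
  assumes U: "openin circ U" and z: "z \<in> U" "z \<noteq> 1"
  shows "\<exists>e>0. \<forall>a b. th z - e < a \<longrightarrow> b < th z + e \<longrightarrow> carc a b \<subseteq> U"
proof -
  obtain e where e: "e > 0" "\<forall>s. \<bar>s - th z\<bar> < e \<longrightarrow> ecirc s \<in> U"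
    using openin_circ_ball[OF U z(1)] by blast
  have "carc a b \<subseteq> U" if "th z - e < a" "b < th z + e" for a b
  proof
    fix w assume w: "w \<in> carc a b"
    then have "\<bar>th w - th z\<bar> < e" using that by (auto simp: carc_def)
    then have "ecirc (th w) \<in> U" using e by blast
    then show "w \<in> U" using ecirc_th w by (auto simp: carc_def)
  qed
  then show ?thesis using e by blast
qed

text \<open>Shows that 1 is not isolated and supplies auxiliary points in open sets.\<close>

lemma circ_points:
  assumes U: "openin circ U" and z: "z \<in> U"
  shows "\<exists>u\<in>U. \<exists>v\<in>U. u \<noteq> v \<and> u \<noteq> 1 \<and> v \<noteq> 1"
proof -
  obtain e where e: "e > 0" "\<forall>s. \<bar>s - th z\<bar> < e \<longrightarrow> ecirc s \<in> U"
    using openin_circ_ball[OF U z] by blast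
  \<comment> \<open>Only angles above \<open>th z\<close> and below 1 are used, which avoids the
    point 1.\<close>
  define c where "c = min e (1 - th z)"
  have c: "0 < c" "c \<le> e" "th z + c \<le> 1" using e th_range[of z] by (auto simp: c_def)
  define s where "s = th z + c / 2"
  define t where "t = th z + c / 3"
  have st: "0 < s" "s < 1" "0 < t" "t < 1" "s \<noteq> t" "\<bar>s - th z\<bar> < e" "\<bar>t - th z\<bar> < e"
    using c th_range[of z] by (auto simp: s_def t_def)
  then have "th (ecirc s) = s" "th (ecirc t) = t" by (auto intro: th_ecirc)
  then have "ecirc s \<noteq> ecirc t" "ecirc s \<noteq> 1" "ecirc t \<noteq> 1" using st th_1 by auto
  then show ?thesis using e st by blast
qed

lemma (in complete_lattice) finite_sup_in_ideal:
  assumes I: "bool_ideal L I" and F: "finite F" "F \<subseteq> I"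
  shows "\<Squnion>F \<in> I"
  using F
proof (induction F rule: finite_induct)
  case empty
  then show ?case using I weak_sup_empty eq_is_equal by (simp add: bool_ideal_def)
next
  case (insert a F)
  have "insert a F \<subseteq> carrier L" using insert.prems I by (auto simp: bool_ideal_def)
  then have "\<Squnion>insert a F = a \<squnion> \<Squnion>F" using weak_sup_insert[of a F] eq_is_equal by simp
  then show ?case using insert I by (auto simp: bool_ideal_def)
qed

section \<open>Realizing the completed free product on the circle\<close>

text \<open>Each piece has many codes, differing beyond \<open>k\<close>. Totality of the sequence
  lets a code be reused unchanged at a deeper level.\<close>

definition pieces :: "(nat \<times> (nat \<Rightarrow> int)) set" where
  "pieces = {(k, n). 1 \<le> k \<and> (\<forall>i. n i \<in> Z0)}"

definition piece :: "nat \<times> (nat \<Rightarrow> int) \<Rightarrow> complex set" where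
  "piece = (\<lambda>(k, n). carc (lo k n) (hi k n))"

lemma piece_RC: "1 \<le> k \<Longrightarrow> carc (lo k n) (hi k n) \<in> carrier (RC circ)"
  using unit_bounds[of k n] lo_hi[of k n] by (intro carc_RC) auto

lemma piece_interior: "1 \<le> k \<Longrightarrow> circ interior_of carc (lo k n) (hi k n) = oarc (lo k n) (hi k n)"
  using unit_bounds[of k n] lo_hi[of k n] by (intro interior_arc) auto

lemma generators_inside:
  assumes U: "openin circ U" and z: "z \<in> U" "z \<noteq> 1"
  shows "(\<exists>k n. 1 \<le> k \<and> (\<forall>i. n i \<in> Z0) \<and> z \<in> oarc (lo k n) (hi k n) \<and> carc (lo k n) (hi k n) \<subseteq> U) \<or>
    (\<exists>k n r. 1 \<le> k \<and> (\<forall>i. n i \<in> Z0) \<and> 0 < r \<and> z \<in> oarc (qlo k n r) (qhi k n r) \<and>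
       carc (qlo k n r) (qhi k n r) \<subseteq> U)"
proof -
  have zs: "z \<in> sphere 0 1" using U z openin_subset by fastforce
  obtain e where e: "e > 0" "\<forall>a b. th z - e < a \<longrightarrow> b < th z + e \<longrightarrow> carc a b \<subseteq> U"
    using carc_inside[OF U z] by blast
  have t: "0 < th z" "th z < 1" using th_pos[OF zs z(2)] th_range by auto
  from small_generators[OF t e(1)] show ?thesis
  proof
    assume "\<exists>k n. 1 \<le> k \<and> (\<forall>i. n i \<in> Z0) \<and> th z - e < lo k n \<and> lo k n < th z \<and> th z < hi k n \<and> hi k n < th z + e"
    then obtain k n where "1 \<le> k" "\<forall>i. n i \<in> Z0" "th z - e < lo k n" "lo k n < th z" "th z < hi k n" "hi k n < th z + e"
      by blast
    then show ?thesis using e(2) zs by (intro disjI1 exI[of _ k] exI[of _ n]) (simp add: oarc_def)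
  next
    assume "\<exists>k n r. 1 \<le> k \<and> (\<forall>i. n i \<in> Z0) \<and> 0 < r \<and> th z - e < qlo k n r \<and> qlo k n r < th z \<and>
       th z < qhi k n r \<and> qhi k n r < th z + e"
    then obtain k n r where "1 \<le> k" "\<forall>i. n i \<in> Z0" "0 < r" "th z - e < qlo k n r" "qlo k n r < th z"
       "th z < qhi k n r" "qhi k n r < th z + e"
      by blast
    then show ?thesis using e(2) zs by (intro disjI2 exI[of _ k] exI[of _ n] exI[of _ r]) (simp add: oarc_def)
  qed
qed

lemma pieces_dense:
  assumes F: "F \<in> carrier (RC circ)" "F \<noteq> {}"
  shows "\<exists>s\<in>pieces. piece s \<subseteq> F"
proof -
  have "circ interior_of F \<noteq> {}" using F RC_iff[of F circ] by auto
  then obtain z where z: "z \<in> circ interior_of F" "z \<noteq> 1"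
    using circ_points[OF openin_interior_of] by blast
  have sub: "circ interior_of F \<subseteq> F" by (rule interior_of_subset)
  from generators_inside[OF openin_interior_of z] show ?thesis
  proof (elim disjE exE conjE)
    fix k n assume "1 \<le> k" "\<forall>i. n i \<in> Z0" "carc (lo k n) (hi k n) \<subseteq> circ interior_of F"
    then show ?thesis using sub by (intro bexI[of _ "(k, n)"]) (auto simp: piece_def pieces_def)
  next
    fix k n r assume k: "1 \<le> k" and n: "\<forall>i. n i \<in> Z0" and r: "0 < (r::int)"
      and U: "carc (qlo k n r) (qhi k n r) \<subseteq> circ interior_of F"
    \<comment> \<open>\<open>- r - 1\<close> is the first index below the excluded
      \<open>- r\<close>, so this subpiece lies in the interval.\<close>
    define n' where "n' = n(Suc k := - r - 1)"
    have n': "\<forall>i. n' i \<in> Z0" using n r by (auto simp: n'_def Z0_def)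
    have "qlo k n r \<le> lo (Suc k) n' \<and> hi (Suc k) n' \<le> qhi k n r"
    proof (rule q_inside[OF k _ _ r])
      show "n k \<in> Z0" "n' (Suc k) \<in> Z0" using n n' by blast+
      show "(\<forall>i\<in>{1..k}. n' i = n i) \<and> n' (Suc k) < - r \<or>
        (\<forall>i\<in>{1..k}. n' i = left k n i) \<and> r < n' (Suc k)" by (simp add: n'_def)
    qed simp
    then have "piece (Suc k, n') \<subseteq> carc (qlo k n r) (qhi k n r)"
      unfolding piece_def using carc_mono by simp
    then show ?thesis using U sub n' by (intro bexI[of _ "(Suc k, n')"]) (auto simp: pieces_def)
  qed
qed

lemma agree_dec: "(\<forall>i\<in>{1..min k l}. n i = (n' i::int)) \<or> (\<exists>i. 1 \<le> i \<and> i \<le> k \<and> i \<le> (l::nat) \<and> n i \<noteq> n' i)"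
  by auto

text \<open>Counterpart of \<open>b_meet\<close>; that the two criteria coincide is the
  compatibility required by \<open>dense_match\<close>.\<close>

lemma piece_meet:
  assumes "(k, n) \<in> pieces" "(l, n') \<in> pieces"
  shows "piece (k, n) \<sqinter>\<^bsub>RC circ\<^esub> piece (l, n') = {} \<longleftrightarrow> (\<exists>i. 1 \<le> i \<and> i \<le> k \<and> i \<le> l \<and> n i \<noteq> n' i)"
proof -
  have k: "1 \<le> k" "1 \<le> l" and Z: "\<forall>i. n i \<in> Z0" "\<forall>i. n' i \<in> Z0" using assms by (auto simp: pieces_def)
  have sub: "oarc a b \<subseteq> sphere 0 1" for a b by (auto simp: oarc_def)
  have "piece (k, n) \<sqinter>\<^bsub>RC circ\<^esub> piece (l, n') = circ closure_of (oarc (lo k n) (hi k n) \<inter> oarc (lo l n') (hi l n'))"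
    using k by (simp add: piece_def RC_meet piece_RC interior_of_Int piece_interior)
  also have "\<dots> = {} \<longleftrightarrow> oarc (lo k n) (hi k n) \<inter> oarc (lo l n') (hi l n') = {}"
    using sub by (intro closure_of_eq_empty) auto
  also have "\<dots> \<longleftrightarrow> (\<exists>i. 1 \<le> i \<and> i \<le> k \<and> i \<le> l \<and> n i \<noteq> n' i)"
  proof
    assume emp: "oarc (lo k n) (hi k n) \<inter> oarc (lo l n') (hi l n') = {}"
    show "\<exists>i. 1 \<le> i \<and> i \<le> k \<and> i \<le> l \<and> n i \<noteq> n' i"
    proof (rule ccontr)
      assume "\<not> ?thesis"
      then have ag: "\<forall>i\<in>{1..min k l}. n i = n' i" using agree_dec[of k l n n'] by blast
      define a where "a = max (lo k n) (lo l n')"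
      define b where "b = min (hi k n) (hi l n')"
      have "a < b"
      proof (cases "k \<le> l")
        case True
        then have "\<forall>i\<in>{1..k}. n i = n' i" using ag by simp
        then show ?thesis
          using lo_cong[of k n n'] hi_cong[of k n n'] nested_le[OF True, of n'] lo_hi[of l n']
          by (auto simp: a_def b_def)
      next
        case False
        then have "\<forall>i\<in>{1..l}. n i = n' i" using ag by simp
        then show ?thesis
          using lo_cong[of l n n'] hi_cong[of l n n'] nested_le[of l k n] lo_hi[of k n] False
          by (auto simp: a_def b_def)
      qed
      then obtain t where t: "a < t" "t < b" using dense by blast
      then have "0 < t" "t < 1" using unit_bounds[OF k(1), of n] by (auto simp: a_def b_def)
      then have "ecirc t \<in> oarc (lo k n) (hi k n) \<inter> oarc (lo l n') (hi l n')"
        using t th_ecirc[of t] by (auto simp: oarc_def a_def b_def)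
      then show False using emp by blast
    qed
  next
    assume "\<exists>i. 1 \<le> i \<and> i \<le> k \<and> i \<le> l \<and> n i \<noteq> n' i"
    then obtain i where i: "1 \<le> i" "i \<le> k" "i \<le> l" "n i \<noteq> n' i" by blast
    then have "\<not> (\<forall>j\<in>{1..<Suc i}. n j = n' j)" by auto
    from separated(1)[OF this, of k l] i Z have "hi k n \<le> lo l n' \<or> hi l n' \<le> lo k n" by auto
    then show "oarc (lo k n) (hi k n) \<inter> oarc (lo l n') (hi l n') = {}" by (auto simp: oarc_def)
  qed
  finally show ?thesis .
qed

section \<open>The tree of \<open>B0\<close> elements matched with the pieces of the circle\<close>

context free_completion
begin

lemma b_closed_A: "\<lbrakk>1 \<le> k; \<And>i. n i \<in> Z0\<rbrakk> \<Longrightarrow> b_elem At \<phi> k n \<in> carrier A"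
  using b_elem_rect[of k n] rect_closed[of "\<lambda>i. {n i}" k] by simp

lemma b_ultra:
  assumes "1 \<le> k" "\<And>i. n i \<in> Z0" "u \<in> ultrafilters A"
  shows "b_elem At \<phi> k n \<in> u \<longleftrightarrow> (\<forall>i\<in>{1..k}. \<phi> i {n i} \<in> u)"
  using b_elem_rect[of k n] rect_ultra[of "\<lambda>i. {n i}" u k] assms by simp

lemma singletons_ultra:
  assumes "u \<in> ultrafilters A" "1 \<le> i" "p \<in> Z0" "x \<subseteq> Z0" "\<phi> i {p} \<in> u"
  shows "\<phi> i x \<in> u \<longleftrightarrow> p \<in> x"
proof
  assume "\<phi> i x \<in> u"
  then have "\<phi> i ({p} \<inter> x) \<in> u" using phi_ultra(3)[of u i "{p}" x] assms by simp
  then show "p \<in> x" using phi_ultra(1)[OF assms(1,2)] by (cases "p \<in> x") auto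
next
  assume "p \<in> x"
  then show "\<phi> i x \<in> u" using phi_ultra_mono[of u i "{p}" x] assms by simp
qed

lemma b_mono:
  assumes kl: "1 \<le> k" "k \<le> l" and Z: "\<And>i. n i \<in> Z0" "\<And>i. n' i \<in> Z0" and ag: "\<forall>i\<in>{1..k}. n i = n' i"
  shows "b_elem At \<phi> l n' \<sqsubseteq>\<^bsub>At\<^esub> b_elem At \<phi> k n"
proof -
  have l: "1 \<le> l" using kl by simp
  note c = b_closed_A[OF l Z(2)] b_closed_A[OF kl(1) Z(1)]
  have "b_elem At \<phi> l n' \<sqsubseteq>\<^bsub>A\<^esub> b_elem At \<phi> k n"
    unfolding A.le_iff_ultra[OF c]
  proof (intro ballI impI)
    fix u assume u: "u \<in> ultrafilters A" and b: "b_elem At \<phi> l n' \<in> u"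
    then have "\<forall>i\<in>{1..l}. \<phi> i {n' i} \<in> u" using b_ultra[OF l Z(2) u] by simp
    then show "b_elem At \<phi> k n \<in> u" using b_ultra[OF kl(1) Z(1) u] ag kl by simp
  qed
  then show ?thesis using le_At[OF c] by simp
qed

lemma b_nonzero:
  assumes "1 \<le> k" "\<And>i. n i \<in> Z0"
  shows "b_elem At \<phi> k n \<noteq> \<bottom>\<^bsub>At\<^esub>"
  using b_elem_rect[OF assms] rect_nonzero[of "\<lambda>i. {n i}" k n] assms by (simp add: At_bottom)

lemma b_meet:
  assumes k: "1 \<le> k" "1 \<le> l" and Z: "\<And>i. n i \<in> Z0" "\<And>i. n' i \<in> Z0"
  shows "b_elem At \<phi> k n \<sqinter>\<^bsub>At\<^esub> b_elem At \<phi> l n' = \<bottom>\<^bsub>At\<^esub> \<longleftrightarrow>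
    (\<exists>i. 1 \<le> i \<and> i \<le> k \<and> i \<le> l \<and> n i \<noteq> n' i)"
proof
  note c = b_closed_A[OF k(1) Z(1)] b_closed_A[OF k(2) Z(2)]
  note cAt = c[THEN carrier_At]
  {
    assume "\<exists>i. 1 \<le> i \<and> i \<le> k \<and> i \<le> l \<and> n i \<noteq> n' i"
    then obtain i where i: "1 \<le> i" "i \<le> k" "i \<le> l" "n i \<noteq> n' i" by blast
    have "\<not> (b_elem At \<phi> k n \<in> u \<and> b_elem At \<phi> l n' \<in> u)" if u: "u \<in> ultrafilters A" for u
    proof
      assume b: "b_elem At \<phi> k n \<in> u \<and> b_elem At \<phi> l n' \<in> u"
      have "\<phi> i {n i} \<in> u" "\<phi> i {n' i} \<in> u"
        using b b_ultra[OF k(1) Z(1) u] b_ultra[OF k(2) Z(2) u] i by auto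
      then show False using singletons_ultra[of u i "n i" "{n' i}", OF u i(1) Z(1)] Z(2)[of i] i(4) by simp
    qed
    then have "b_elem At \<phi> k n \<sqinter>\<^bsub>A\<^esub> b_elem At \<phi> l n' = \<bottom>\<^bsub>A\<^esub>"
      using c by (simp add: A.eq_iff_ultra ultra_simps)
    then show "b_elem At \<phi> k n \<sqinter>\<^bsub>At\<^esub> b_elem At \<phi> l n' = \<bottom>\<^bsub>At\<^esub>" by (simp add: At_meet c At_bottom)
  }
  assume bot: "b_elem At \<phi> k n \<sqinter>\<^bsub>At\<^esub> b_elem At \<phi> l n' = \<bottom>\<^bsub>At\<^esub>"
  show "\<exists>i. 1 \<le> i \<and> i \<le> k \<and> i \<le> l \<and> n i \<noteq> n' i"
  proof (rule ccontr)
    assume "\<not> ?thesis"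
    then have ag: "\<forall>i\<in>{1..min k l}. n i = n' i" using agree_dec[of k l n n'] by blast
    show False
    proof (cases "k \<le> l")
      case True
      then have "b_elem At \<phi> l n' \<sqsubseteq>\<^bsub>At\<^esub> b_elem At \<phi> k n" using ag by (intro b_mono k Z) auto
      then have "b_elem At \<phi> l n' = \<bottom>\<^bsub>At\<^esub>"
        using bot At.le_iff_join[OF cAt(2,1)] meet_comm[of At "b_elem At \<phi> k n"] by simp
      then show False using b_nonzero[OF k(2) Z(2)] by simp
    next
      case False
      then have "b_elem At \<phi> k n \<sqsubseteq>\<^bsub>At\<^esub> b_elem At \<phi> l n'" using ag by (intro b_mono k Z) auto
      then have "b_elem At \<phi> k n = \<bottom>\<^bsub>At\<^esub>" using bot At.le_iff_join[OF cAt] by simp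
      then show False using b_nonzero[OF k(1) Z(1)] by simp
    qed
  qed
qed

sublocale m: dense_match At "RC circ" pieces "\<lambda>(k, n). b_elem At \<phi> k n" piece
proof (intro dense_match.intro dense_family.intro dense_family_axioms.intro dense_match_axioms.intro)
  show "boolean_alg At" "complete_lattice At" by unfold_locales
  show "boolean_alg (RC circ)" "complete_lattice (RC circ)" by (rule RC_boolean_alg RC_complete)+
  fix s assume s: "s \<in> pieces"
  then obtain k n where kn: "s = (k, n)" "1 \<le> k" "\<And>i. n i \<in> Z0" by (auto simp: pieces_def)
  show "(case s of (k, n) \<Rightarrow> b_elem At \<phi> k n) \<in> carrier At"
    using kn b_closed_A carrier_At by simp
  show "(case s of (k, n) \<Rightarrow> b_elem At \<phi> k n) \<noteq> \<bottom>\<^bsub>At\<^esub>"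
    using kn b_nonzero by simp
  show "piece s \<in> carrier (RC circ)" using kn piece_RC by (simp add: piece_def)
  have "ecirc (lo k n) \<in> piece s"
    using unit_bounds[OF kn(2), of n] lo_hi[of k n] th_ecirc[of "lo k n"] by (simp add: kn(1) piece_def carc_def)
  then show "piece s \<noteq> \<bottom>\<^bsub>RC circ\<^esub>" unfolding RC_bottom by blast
  fix t assume t: "t \<in> pieces"
  then obtain l n' where ln: "t = (l, n')" "1 \<le> l" "\<And>i. n' i \<in> Z0" by (auto simp: pieces_def)
  show "((case s of (k, n) \<Rightarrow> b_elem At \<phi> k n) \<sqinter>\<^bsub>At\<^esub> (case t of (k, n) \<Rightarrow> b_elem At \<phi> k n) = \<bottom>\<^bsub>At\<^esub>) =
    (piece s \<sqinter>\<^bsub>RC circ\<^esub> piece t = \<bottom>\<^bsub>RC circ\<^esub>)"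
    using b_meet[OF kn(2) ln(2) kn(3) ln(3)] piece_meet[of k n l n'] s t kn(1) ln(1) by (simp add: RC_bottom)
next
  fix x assume "x \<in> carrier At" "x \<noteq> \<bottom>\<^bsub>At\<^esub>"
  then obtain k n where "1 \<le> k" "\<forall>i. n i \<in> Z0" "b_elem At \<phi> k n \<sqsubseteq>\<^bsub>At\<^esub> x" using b_dense by blast
  then show "\<exists>s\<in>pieces. (case s of (k, n) \<Rightarrow> b_elem At \<phi> k n) \<sqsubseteq>\<^bsub>At\<^esub> x"
    by (intro bexI[of _ "(k, n)"]) (auto simp: pieces_def)
next
  fix F assume "F \<in> carrier (RC circ)" "F \<noteq> \<bottom>\<^bsub>RC circ\<^esub>"
  then show "\<exists>s\<in>pieces. piece s \<sqsubseteq>\<^bsub>RC circ\<^esub> F" using pieces_dense[of F] by (simp add: RC_bottom RC_le)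
qed

abbreviation "ev \<equiv> m.match"

lemma b_elem_cong:
  assumes "\<forall>i\<in>{1..k}. n i = n' i"
  shows "b_elem At \<phi> k n = b_elem At \<phi> k n'"
proof -
  have "{\<phi> i {n i} |i. i \<in> {1..k}} = {\<phi> i {n' i} |i. i \<in> {1..k}}"
    using assms by (intro Collect_cong) metis
  then show ?thesis by (simp add: b_elem_def)
qed

text \<open>\<open>is_seq\<close> constrains values only on \<open>{1..k}\<close>; the default 1
  turns such a sequence into a code in \<open>pieces\<close> without changing the element.\<close>

definition norm_seq :: "nat \<Rightarrow> (nat \<Rightarrow> int) \<Rightarrow> nat \<Rightarrow> int" where
  "norm_seq k n i = (if i \<in> {1..k} then n i else 1)"

lemma norm_seq: "is_seq k n \<Longrightarrow> 1 \<le> k \<and> (\<forall>i. norm_seq k n i \<in> Z0) \<and> (\<forall>i\<in>{1..k}. n i = norm_seq k n i)"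
  by (auto simp: is_seq_def norm_seq_def Z0_def)

lemma ev_b:
  assumes "is_seq k n"
  shows "ev (b_elem At \<phi> k n) = carc (lo k n) (hi k n)" "b_elem At \<phi> k n \<in> carrier At"
proof -
  note n = norm_seq[OF assms]
  have ag: "\<forall>i\<in>{1..k}. n i = norm_seq k n i" using n by blast
  have "(k, norm_seq k n) \<in> pieces" using n by (simp add: pieces_def)
  from m.match_e[OF this] show "ev (b_elem At \<phi> k n) = carc (lo k n) (hi k n)"
    unfolding b_elem_cong[OF ag] lo_cong[OF ag] hi_cong[OF ag] by (simp add: piece_def)
  show "b_elem At \<phi> k n \<in> carrier At"
    unfolding b_elem_cong[OF ag] using n b_closed_A carrier_At by simp
qed

lemma At_compl: assumes "x \<in> carrier A" shows "compl At x = compl A x"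
  using assms by (intro At.compl_eqI)
    (simp_all add: carrier_At At_meet At_join A.meet_compl A.join_compl At_bottom At_top)

lemma ev_q_total:
  assumes k: "1 \<le> k" and n: "\<And>i. n i \<in> Z0" and r: "0 < r"
  shows "ev (q_elem At \<phi> k n r) = carc (qlo k n r) (qhi k n r)" "q_elem At \<phi> k n r \<in> carrier A"
proof -
  let ?q = "q_elem At \<phi> k n r" and ?F = "carc (qlo k n r) (qhi k n r)"
  let ?s = "succ_set r" and ?p = "pred_set (- r)"
  have nl: "\<And>i. left k n i \<in> Z0" using n pr_Z0 by (simp add: left_def)
  have sp: "?s \<subseteq> Z0" "?p \<subseteq> Z0" by (auto simp: succ_set_def pred_set_def)
  note c = b_closed_A[OF k nl] b_closed_A[OF k n]
  have cp: "\<phi> (Suc k) ?s \<in> carrier A" "\<phi> (Suc k) ?p \<in> carrier A" using sp by simp_all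
  have q: "?q = (b_elem At \<phi> k (left k n) \<sqinter>\<^bsub>A\<^esub> \<phi> (Suc k) ?s) \<squnion>\<^bsub>A\<^esub> (b_elem At \<phi> k n \<sqinter>\<^bsub>A\<^esub> \<phi> (Suc k) ?p)"
    unfolding q_elem_def left_def[symmetric] using c cp by (simp add: At_meet At_join)
  show qA: "?q \<in> carrier A" unfolding q using c cp by simp
  have qu: "?q \<in> u \<longleftrightarrow> (b_elem At \<phi> k (left k n) \<in> u \<and> \<phi> (Suc k) ?s \<in> u) \<or>
      (b_elem At \<phi> k n \<in> u \<and> \<phi> (Suc k) ?p \<in> u)" if "u \<in> ultrafilters A" for u
    unfolding q using c cp ultra_simps[OF that] by simp
  have qb: "0 < qlo k n r" "qlo k n r < qhi k n r" "qhi k n r < 1"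
    using q_parent[of k n r, OF k n] by auto
  have F: "?F \<in> carrier (RC circ)" using qb by (rule carc_RC)
  show "ev ?q = ?F"
  proof (rule m.match_eqI[OF carrier_At[OF qA] F])
    fix s assume "s \<in> pieces"
    then obtain m n' where s: "s = (m, n')" "1 \<le> m" "\<And>i. n' i \<in> Z0" by (auto simp: pieces_def)
    \<comment> \<open>Pieces of level at least \<open>k + 1\<close> decide \<open>?q\<close>, so the
      given piece is refined to such a level along its own code.\<close>
    define l where "l = max m (Suc k)"
    have l: "1 \<le> l" "k < l" "Suc k \<le> l" "m \<le> l" by (auto simp: l_def)
    have t: "(l, n') \<in> pieces" using l s by (simp add: pieces_def)
    have bt: "b_elem At \<phi> l n' \<in> carrier A" by (rule b_closed_A[OF l(1) s(3)])
    have ts: "b_elem At \<phi> l n' \<sqsubseteq>\<^bsub>At\<^esub> b_elem At \<phi> m n'" by (rule b_mono[OF s(2) l(4) s(3) s(3)]) simp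
    have bu: "\<phi> i x \<in> u \<longleftrightarrow> n' i \<in> x"
      if "u \<in> ultrafilters A" "b_elem At \<phi> l n' \<in> u" "i \<in> {1..l}" "x \<subseteq> Z0" for u i x
      using that b_ultra[OF l(1) s(3) that(1)] s(3) by (intro singletons_ultra) auto
    have bk: "b_elem At \<phi> k m \<in> u \<longleftrightarrow> (\<forall>i\<in>{1..k}. n' i = m i)"
      if "u \<in> ultrafilters A" "b_elem At \<phi> l n' \<in> u" "\<And>i. m i \<in> Z0" for u m
      unfolding b_ultra[OF k that(3) that(1)] using bu[OF that(1,2)] that(3) l by auto
    have mem: "n' (Suc k) \<in> ?s \<longleftrightarrow> r < n' (Suc k)" "n' (Suc k) \<in> ?p \<longleftrightarrow> n' (Suc k) < - r"
      using s(3) by (auto simp: succ_set_def pred_set_def)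
    let ?in = "(\<forall>i\<in>{1..k}. n' i = n i) \<and> n' (Suc k) < - r \<or> (\<forall>i\<in>{1..k}. n' i = left k n i) \<and> r < n' (Suc k)"
    have qin: "?q \<in> u \<longleftrightarrow> ?in" if "u \<in> ultrafilters A" "b_elem At \<phi> l n' \<in> u" for u
    proof -
      have "Suc k \<in> {1..l}" using l by auto
      from bu[OF that this sp(1)] bu[OF that this sp(2)] bk[OF that, of n, OF n] bk[OF that, of "left k n", OF nl]
      show ?thesis unfolding qu[OF that(1)] mem by blast
    qed
    have "(b_elem At \<phi> l n' \<sqsubseteq>\<^bsub>At\<^esub> ?q \<and> piece (l, n') \<sqsubseteq>\<^bsub>RC circ\<^esub> ?F) \<or>
      (b_elem At \<phi> l n' \<sqsubseteq>\<^bsub>At\<^esub> compl At ?q \<and> piece (l, n') \<sqsubseteq>\<^bsub>RC circ\<^esub> compl (RC circ) ?F)"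
    proof (cases ?in)
      case True
      have "b_elem At \<phi> l n' \<sqsubseteq>\<^bsub>A\<^esub> ?q"
        unfolding A.le_iff_ultra[OF bt qA] using qin True by blast
      moreover have "qlo k n r \<le> lo l n' \<and> hi l n' \<le> qhi k n r"
        using True by (intro q_inside k n l(2) r s(3)) blast
      ultimately show ?thesis using le_At[OF bt qA] carc_mono by (simp add: RC_le piece_def)
    next
      case False
      have "b_elem At \<phi> l n' \<sqsubseteq>\<^bsub>A\<^esub> compl A ?q"
        unfolding A.le_iff_ultra[OF bt A.compl_closed[OF qA]]
        using qin False ultra_simps(3)[OF _ qA] by blast
      then have 1: "b_elem At \<phi> l n' \<sqsubseteq>\<^bsub>At\<^esub> compl At ?q"
        using le_At[OF bt A.compl_closed[OF qA]] At_compl[OF qA] by simp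
      have "hi l n' \<le> qlo k n r \<or> qhi k n r \<le> lo l n'"
        using False by (intro q_outside k n l(2) r s(3)) blast+
      \<comment> \<open>The closed arcs may share an end point, so disjointness is stated for the
        open arc; its closure lies in the Boolean complement.\<close>
      then have "oarc (lo l n') (hi l n') \<subseteq> topspace circ - ?F" by (auto simp: oarc_def carc_def)
      then have "circ closure_of oarc (lo l n') (hi l n') \<subseteq> compl (RC circ) ?F"
        unfolding RC_compl[OF F] by (rule closure_of_mono)
      then have "piece (l, n') \<subseteq> compl (RC circ) ?F"
        using closure_oarc[of "lo l n'" "hi l n'"] unit_bounds[OF l(1), of n'] lo_hi[of l n']
        by (simp add: piece_def)
      then show ?thesis using 1 by (simp add: RC_le)
    qed
    then show "\<exists>t\<in>pieces. (case t of (k, n) \<Rightarrow> b_elem At \<phi> k n) \<sqsubseteq>\<^bsub>At\<^esub> (case s of (k, n) \<Rightarrow> b_elem At \<phi> k n) \<and>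
      ((case t of (k, n) \<Rightarrow> b_elem At \<phi> k n) \<sqsubseteq>\<^bsub>At\<^esub> ?q \<and> piece t \<sqsubseteq>\<^bsub>RC circ\<^esub> ?F \<or>
       (case t of (k, n) \<Rightarrow> b_elem At \<phi> k n) \<sqsubseteq>\<^bsub>At\<^esub> compl At ?q \<and> piece t \<sqsubseteq>\<^bsub>RC circ\<^esub> compl (RC circ) ?F)"
      using t ts s(1) by (intro bexI[of _ "(l, n')"]) auto
  qed
qed

lemma ev_q:
  assumes seq: "is_seq k n" and r: "0 < r"
  shows "ev (q_elem At \<phi> k n r) = carc (qlo k n r) (qhi k n r)" "q_elem At \<phi> k n r \<in> carrier At"
proof -
  let ?n = "norm_seq k n"
  have n: "1 \<le> k" "\<And>i. ?n i \<in> Z0" "\<forall>i\<in>{1..k}. n i = ?n i" using norm_seq[OF seq] by auto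
  have ag: "\<forall>i\<in>{1..k}. (n(k := pr (n k))) i = (?n(k := pr (?n k))) i" using n by auto
  have q: "q_elem At \<phi> k n r = q_elem At \<phi> k ?n r"
    unfolding q_elem_def b_elem_cong[OF ag] b_elem_cong[OF n(3)] ..
  have "\<forall>i\<in>{1..Suc k}. ((left k n)(Suc k := r)) i = ((left k ?n)(Suc k := r)) i"
    "\<forall>i\<in>{1..Suc k}. (n(Suc k := - r)) i = (?n(Suc k := - r)) i"
    using n by (auto simp: left_def)
  from hi_cong[OF this(1)] lo_cong[OF this(2)]
  have "qlo k n r = qlo k ?n r" "qhi k n r = qhi k ?n r" unfolding qlo_def qhi_def .
  then show "ev (q_elem At \<phi> k n r) = carc (qlo k n r) (qhi k n r)"
    using ev_q_total(1)[OF n(1,2) r] q by simp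
  show "q_elem At \<phi> k n r \<in> carrier At"
    unfolding q by (rule carrier_At[OF ev_q_total(2)[OF n(1,2) r]])
qed

section \<open>Contact between generators\<close>

abbreviation gens where
  "gens \<equiv> B0 At \<phi> \<union> B1 At \<phi>"

lemma gens_cases:
  assumes "g \<in> gens"
  obtains k n where "g = b_elem At \<phi> k n" "is_seq k n"
  | k n r where "g = q_elem At \<phi> k n r" "is_seq k n" "0 < r"
  using assms unfolding B0_def B1_def by blast

lemma seq_bounds:
  assumes "is_seq k n"
  shows "0 < lo k n" "lo k n \<le> hi k n" "hi k n < 1"
    "0 < qlo k n r" "qlo k n r \<le> qhi k n r" "qhi k n r < 1" "0 \<le> lo k n" "0 \<le> qlo k n r"
proof -
  have k: "1 \<le> k" "n k \<in> Z0" using assms by (auto simp: is_seq_def)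
  show "0 < lo k n" "lo k n \<le> hi k n" "hi k n < 1" "0 \<le> lo k n"
    using unit_bounds[OF k(1), of n] lo_hi[of k n] by auto
  show "0 < qlo k n r" "qlo k n r \<le> qhi k n r" "qhi k n r < 1" "0 \<le> qlo k n r"
    using q_parent[of k n r, OF k] by auto
qed

lemma ev_gen:
  assumes "g \<in> gens"
  shows "g \<in> carrier At" "1 \<notin> ev g" "closedin circ (ev g)"
proof -
  show "g \<in> carrier At"
    using assms by (cases rule: gens_cases) (simp_all add: ev_b(2) ev_q(2))
  show "1 \<notin> ev g"
    using assms by (cases rule: gens_cases) (simp_all add: ev_b(1) ev_q(1) one_notin_arc seq_bounds)
  show "closedin circ (ev g)" by (rule RC_closedin) (rule m.match_closed)
qed

text \<open>Each rule, read for the codes it mentions, yields meeting arcs; since \<open>ev\<close>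
  depends on the element alone, the choice of codes has no influence on the conclusion.\<close>

lemma sigma_gen_meets:
  assumes "sigma_gen At \<phi> x y"
  shows "ev x \<inter> ev y \<noteq> {}"
  using assms
proof induction
  case (sym x y)
  then show ?case by (simp add: Int_commute)
next
  case (bb k n l n')
  note s = bb(1,2)
  show ?case
    unfolding ev_b(1)[OF s(1)] ev_b(1)[OF s(2)]
    using carc_meets[of "lo k n" "hi k n" "lo l n'" "hi l n'"] bb_iff[OF s bb(3)] bb(4-)
      seq_bounds[OF s(1)] seq_bounds[OF s(2)] by simp
next
  case (qq k n l n' r r')
  note s = qq(1,2)
  show ?case
    unfolding ev_q(1)[OF s(1) qq(3)] ev_q(1)[OF s(2) qq(4)]
    using carc_meets[of "qlo k n r" "qhi k n r" "qlo l n' r'" "qhi l n' r'"] qq_iff[OF s qq(3-5)] qq(6-)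
      seq_bounds[OF s(1)] seq_bounds[OF s(2)] by simp
next
  case (qb_gt k n l n' r)
  note s = qb_gt(1,2)
  show ?case
    unfolding ev_q(1)[OF s(1) qb_gt(3)] ev_b(1)[OF s(2)]
    using carc_meets[of "qlo k n r" "qhi k n r" "lo l n'" "hi l n'"] qb_gt_iff[OF s qb_gt(4), of r] qb_gt(5)
      seq_bounds[OF s(1)] seq_bounds[OF s(2)] by simp
next
  case (qb_le k n l n' r)
  note s = qb_le(1,2)
  show ?case
    unfolding ev_q(1)[OF s(1) qb_le(3)] ev_b(1)[OF s(2)]
    using carc_meets[of "qlo k n r" "qhi k n r" "lo l n'" "hi l n'"] qb_le_iff[OF s qb_le(3,4)] qb_le(5-)
      seq_bounds[OF s(1)] seq_bounds[OF s(2)] by simp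
qed

lemma meets_bb:
  assumes s: "is_seq k n" "is_seq l n'" and m: "ev (b_elem At \<phi> k n) \<inter> ev (b_elem At \<phi> l n') \<noteq> {}"
    and kl: "k \<le> l"
  shows "sigma_gen At \<phi> (b_elem At \<phi> k n) (b_elem At \<phi> l n')"
proof -
  have "lo k n \<le> hi l n' \<and> lo l n' \<le> hi k n"
    using m[unfolded ev_b(1)[OF s(1)] ev_b(1)[OF s(2)]]
      carc_meets[of "lo k n" "hi k n" "lo l n'" "hi l n'"] seq_bounds[OF s(1)] seq_bounds[OF s(2)] by simp
  then show ?thesis
    unfolding bb_iff[OF s kl] by (intro sigma_gen.bb[OF s kl]) blast+
qed

lemma meets_qq:
  assumes s: "is_seq k n" "is_seq l n'" and r: "0 < r" "0 < r'"
    and m: "ev (q_elem At \<phi> k n r) \<inter> ev (q_elem At \<phi> l n' r') \<noteq> {}" and kl: "k \<le> l"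
  shows "sigma_gen At \<phi> (q_elem At \<phi> k n r) (q_elem At \<phi> l n' r')"
proof -
  have "qlo k n r \<le> qhi l n' r' \<and> qlo l n' r' \<le> qhi k n r"
    using m[unfolded ev_q(1)[OF s(1) r(1)] ev_q(1)[OF s(2) r(2)]]
      carc_meets[of "qlo k n r" "qhi k n r" "qlo l n' r'" "qhi l n' r'"]
      seq_bounds[OF s(1)] seq_bounds[OF s(2)] by simp
  then show ?thesis
    unfolding qq_iff[OF s r kl] by (intro sigma_gen.qq[OF s r kl]) blast+
qed

lemma meets_qb:
  assumes s: "is_seq k n" "is_seq l n'" and r: "0 < r"
    and m: "ev (q_elem At \<phi> k n r) \<inter> ev (b_elem At \<phi> l n') \<noteq> {}"
  shows "sigma_gen At \<phi> (q_elem At \<phi> k n r) (b_elem At \<phi> l n')"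
proof -
  have c: "qlo k n r \<le> hi l n' \<and> lo l n' \<le> qhi k n r"
    using m[unfolded ev_q(1)[OF s(1) r] ev_b(1)[OF s(2)]]
      carc_meets[of "qlo k n r" "qhi k n r" "lo l n'" "hi l n'"]
      seq_bounds[OF s(1)] seq_bounds[OF s(2)] by simp
  show ?thesis
  proof (cases "k \<le> l")
    case True
    show ?thesis
      using c unfolding qb_le_iff[OF s r True] by (intro sigma_gen.qb_le[OF s r True]) blast+
  next
    case False
    then have lk: "l < k" by simp
    show ?thesis using c unfolding qb_gt_iff[OF s lk] by (intro sigma_gen.qb_gt[OF s r lk])
  qed
qed

lemma sigma_gen_iff:
  assumes "x \<in> gens" "y \<in> gens"
  shows "sigma_gen At \<phi> x y \<longleftrightarrow> ev x \<inter> ev y \<noteq> {}"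
proof
  assume m: "ev x \<inter> ev y \<noteq> {}"
  then have m': "ev y \<inter> ev x \<noteq> {}" by (simp add: Int_commute)
  show "sigma_gen At \<phi> x y"
    using assms(1)
  proof (cases rule: gens_cases)
    case x: (1 k n)
    show ?thesis
      using assms(2)
    proof (cases rule: gens_cases)
      case y: (1 l n')
      show ?thesis
        using meets_bb[OF x(2) y(2)] meets_bb[OF y(2) x(2)] m m' x(1) y(1) sigma_gen.sym linear[of k l] by metis
    next
      case y: (2 l n' r)
      show ?thesis
        using meets_qb[OF y(2) x(2) y(3)] m' x(1) y(1) sigma_gen.sym by metis
    qed
  next
    case x: (2 k n r)
    show ?thesis
      using assms(2)
    proof (cases rule: gens_cases)
      case y: (1 l n')
      show ?thesis using meets_qb[OF x(2) y(2) x(3)] m x(1) y(1) by metis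
    next
      case y: (2 l n' r')
      show ?thesis
        using meets_qq[OF x(2) y(2) x(3) y(3)] meets_qq[OF y(2) x(2) y(3) x(3)] m m' x(1) y(1)
          sigma_gen.sym linear[of k l] by metis
    qed
  qed
qed (rule sigma_gen_meets)

section \<open>From generators to all elements by compactness\<close>

lemma gens_inside:
  assumes U: "openin circ U" "z \<in> U" "z \<noteq> 1"
  shows "\<exists>g\<in>gens. z \<in> circ interior_of ev g \<and> ev g \<subseteq> U"
  using generators_inside[OF U]
proof (elim disjE exE conjE)
  fix k n assume k: "1 \<le> k" and n: "\<forall>i. n i \<in> Z0" and z: "z \<in> oarc (lo k n) (hi k n)"
    "carc (lo k n) (hi k n) \<subseteq> U"
  have s: "is_seq k n" using k n by (simp add: is_seq_def)
  have "b_elem At \<phi> k n \<in> gens" using s by (auto simp: B0_def)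
  then show ?thesis
    using z by (intro bexI[of _ "b_elem At \<phi> k n"]) (simp_all add: ev_b(1)[OF s] piece_interior[OF k])
next
  fix k n r assume k: "1 \<le> k" and n: "\<forall>i. n i \<in> Z0" and r: "0 < (r::int)"
    and z: "z \<in> oarc (qlo k n r) (qhi k n r)" "carc (qlo k n r) (qhi k n r) \<subseteq> U"
  have s: "is_seq k n" using k n by (simp add: is_seq_def)
  have "q_elem At \<phi> k n r \<in> gens" using s r by (auto simp: B1_def)
  moreover have "circ interior_of carc (qlo k n r) (qhi k n r) = oarc (qlo k n r) (qhi k n r)"
    using q_parent[of k n r] k n by (intro interior_arc) auto
  ultimately show ?thesis
    using z by (intro bexI[of _ "q_elem At \<phi> k n r"]) (simp_all add: ev_q(1)[OF s r])
qed

text \<open>By \<open>gens_inside\<close>, interiors of generators contain arbitrarily small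
  neighbourhoods of every point other than 1; compactness of \<open>C\<close> leaves finitely
  many.\<close>

lemma gens_cover:
  assumes C: "closedin circ C" "1 \<notin> C" and U: "openin circ U" "C \<subseteq> U"
  shows "\<exists>F. finite F \<and> F \<subseteq> gens \<and> C \<subseteq> \<Union>(ev ` F) \<and> \<Union>(ev ` F) \<subseteq> U"
proof -
  define S where "S = {g \<in> gens. ev g \<subseteq> U}"
  have "compactin circ C" using C(1) circ_compact closedin_compact_space by blast
  moreover have "\<forall>V\<in>(\<lambda>g. circ interior_of ev g) ` S. openin circ V" by auto
  moreover have "C \<subseteq> \<Union>((\<lambda>g. circ interior_of ev g) ` S)"
  proof
    fix z assume z: "z \<in> C"
    then have "z \<in> U" "z \<noteq> 1" using C U by auto
    from gens_inside[OF U(1) this] show "z \<in> \<Union>((\<lambda>g. circ interior_of ev g) ` S)"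
      by (auto simp: S_def)
  qed
  ultimately obtain \<F> where "finite \<F>" "\<F> \<subseteq> (\<lambda>g. circ interior_of ev g) ` S" "C \<subseteq> \<Union>\<F>"
    unfolding compactin_def by meson
  moreover from finite_subset_image[OF this(1,2)]
  obtain F where "F \<subseteq> S" "finite F" "\<F> = (\<lambda>g. circ interior_of ev g) ` F" by blast
  ultimately have F: "finite F" "F \<subseteq> S" "C \<subseteq> \<Union>((\<lambda>g. circ interior_of ev g) ` F)" by simp_all
  have "\<Union>((\<lambda>g. circ interior_of ev g) ` F) \<subseteq> \<Union>(ev ` F)"
    by (intro UN_mono order_refl interior_of_subset)
  then show ?thesis using F by (intro exI[of _ F]) (auto simp: S_def)
qed

lemma ev_iso: "ev \<in> bool_iso At (RC circ)"
  using order_iso_bool_iso[OF At.boolean_alg_axioms RC_boolean_alg m.match_bij m.match_le] by blast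

lemma ev_le: "\<lbrakk>x \<in> carrier At; y \<in> carrier At\<rbrakk> \<Longrightarrow> x \<sqsubseteq>\<^bsub>At\<^esub> y \<longleftrightarrow> ev x \<subseteq> ev y"
  using m.match_le by (simp add: RC_le)

lemma ev_closed: "closedin circ (ev x)"
  by (rule RC_closedin) (rule m.match_closed)

lemma ev_finite_sup:
  assumes "finite F" "F \<subseteq> carrier At"
  shows "ev (\<Squnion>\<^bsub>At\<^esub> F) = \<Union>(ev ` F)"
proof -
  have "ev (\<Squnion>\<^bsub>At\<^esub> F) = \<Squnion>\<^bsub>RC circ\<^esub> (ev ` F)"
    by (rule order_iso_sup[OF At.complete_lattice_axioms RC_complete m.match_bij m.match_le assms(2)])
  also have "\<dots> = circ closure_of \<Union>(ev ` F)" using m.match_closed by (intro RC_sup) auto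
  also have "\<dots> = \<Union>(ev ` F)" using assms ev_closed by (intro closure_of_closedin closedin_Union) auto
  finally show ?thesis .
qed

text \<open>Generators miss the point 1, and the elements missing 1 form an ideal; conversely, a
  closed set missing 1 is covered by finitely many generators.\<close>

lemma Bt_iff: "x \<in> Bt At \<phi> \<longleftrightarrow> x \<in> carrier At \<and> 1 \<notin> ev x"
proof
  define J where "J = {x \<in> carrier At. 1 \<notin> ev x}"
  have hom: "ev \<bottom>\<^bsub>At\<^esub> = {}" "\<And>x y. x \<in> carrier At \<Longrightarrow> y \<in> carrier At \<Longrightarrow> ev (x \<squnion>\<^bsub>At\<^esub> y) = ev x \<union> ev y"
    using ev_iso RC_join[OF m.match_closed m.match_closed] by (simp_all add: bool_iso_def bool_hom_def RC_bottom)
  have "bool_ideal At J"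
    unfolding bool_ideal_def J_def using hom ev_le by auto
  moreover have "gens \<subseteq> J" using ev_gen by (auto simp: J_def)
  ultimately have "Bt At \<phi> \<subseteq> J" unfolding Bt_def ideal_gen_def by blast
  then show "x \<in> carrier At \<and> 1 \<notin> ev x" if "x \<in> Bt At \<phi>" using that by (auto simp: J_def)
  assume x: "x \<in> carrier At \<and> 1 \<notin> ev x"
  have "openin circ (topspace circ)" "ev x \<subseteq> topspace circ"
    by (simp, rule closedin_subset[OF ev_closed])
  then obtain F where F: "finite F" "F \<subseteq> gens" "ev x \<subseteq> \<Union>(ev ` F)"
    using gens_cover[OF ev_closed] x by meson
  have Fc: "F \<subseteq> carrier At" using F(2) ev_gen(1) by auto
  have le: "x \<sqsubseteq>\<^bsub>At\<^esub> \<Squnion>\<^bsub>At\<^esub> F"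
    using F(3) x At.sup_closed[OF Fc] by (simp add: ev_le ev_finite_sup[OF F(1) Fc])
  have "x \<in> I" if I: "bool_ideal At I" "gens \<subseteq> I" for I
  proof -
    have "\<Squnion>\<^bsub>At\<^esub> F \<in> I" using At.finite_sup_in_ideal[OF I(1) F(1)] F(2) I(2) by blast
    then show ?thesis using I(1) le x unfolding bool_ideal_def by blast
  qed
  then show "x \<in> Bt At \<phi>" unfolding Bt_def ideal_gen_def by blast
qed

text \<open>The families in the definition are finite covers by generators with disjoint arcs.
  Between disjoint closed sets missing 1 such covers exist by normality and
  \<open>gens_cover\<close>.\<close>

lemma sigma_bounded_iff:
  assumes c: "c \<in> Bt At \<phi>" and d: "d \<in> Bt At \<phi>"
  shows "sigma_bounded At \<phi> c d \<longleftrightarrow> ev c \<inter> ev d \<noteq> {}"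
proof -
  have cd: "c \<in> carrier At" "d \<in> carrier At" "1 \<notin> ev c" "1 \<notin> ev d" using c d Bt_iff by auto
  have "(\<exists>F G. finite F \<and> F \<noteq> {} \<and> F \<subseteq> gens \<and> finite G \<and> G \<noteq> {} \<and> G \<subseteq> gens \<and>
     c \<sqsubseteq>\<^bsub>At\<^esub> \<Squnion>\<^bsub>At\<^esub> F \<and> d \<sqsubseteq>\<^bsub>At\<^esub> \<Squnion>\<^bsub>At\<^esub> G \<and> (\<forall>x\<in>F. \<forall>y\<in>G. \<not> sigma_gen At \<phi> x y)) \<longleftrightarrow>
     ev c \<inter> ev d = {}" (is "?E \<longleftrightarrow> _")
  proof
    assume ?E
    then obtain F G where F: "finite F" "F \<subseteq> gens" "c \<sqsubseteq>\<^bsub>At\<^esub> \<Squnion>\<^bsub>At\<^esub> F"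
      and G: "finite G" "G \<subseteq> gens" "d \<sqsubseteq>\<^bsub>At\<^esub> \<Squnion>\<^bsub>At\<^esub> G"
      and FG: "\<forall>x\<in>F. \<forall>y\<in>G. \<not> sigma_gen At \<phi> x y" by blast
    have Fc: "F \<subseteq> carrier At" and Gc: "G \<subseteq> carrier At" using F(2) G(2) ev_gen(1) by auto
    have "ev c \<subseteq> \<Union>(ev ` F)" "ev d \<subseteq> \<Union>(ev ` G)"
      using F(3) G(3) cd(1,2) At.sup_closed[OF Fc] At.sup_closed[OF Gc]
      by (simp_all add: ev_le ev_finite_sup[OF F(1) Fc] ev_finite_sup[OF G(1) Gc])
    moreover have "ev x \<inter> ev y = {}" if "x \<in> F" "y \<in> G" for x y
    proof -
      have "x \<in> gens" "y \<in> gens" using that F(2) G(2) by blast+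
      from sigma_gen_iff[OF this] show ?thesis using FG that by blast
    qed
    then have "\<Union>(ev ` F) \<inter> \<Union>(ev ` G) = {}" by blast
    ultimately show "ev c \<inter> ev d = {}" by blast
  next
    assume disj: "ev c \<inter> ev d = {}"
    let ?V = "topspace circ - (ev c \<union> ev d)"
    have V: "openin circ ?V" by (intro openin_diff closedin_Un ev_closed) simp
    have "1 \<in> ?V" using cd(3,4) by simp
    \<comment> \<open>the extra points only serve to make the finite families nonempty\<close>
    then obtain u v where uv: "u \<in> ?V" "v \<in> ?V" "u \<noteq> v" "u \<noteq> 1" "v \<noteq> 1"
      using circ_points[OF V] by blast
    define C where "C = insert u (ev c)"
    define D where "D = insert v (ev d)"
    have sing: "closedin circ {w}" if "w \<in> topspace circ" for w
      using that circ_Hausdorff by (simp add: closedin_Hausdorff_sing_eq)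
    have C: "closedin circ C" "1 \<notin> C" and D: "closedin circ D" "1 \<notin> D"
      using closedin_Un[OF sing[of u] ev_closed[of c]] closedin_Un[OF sing[of v] ev_closed[of d]] uv cd
      by (auto simp: C_def D_def)
    have CD: "disjnt C D" using disj uv by (auto simp: C_def D_def disjnt_iff)
    have "normal_space circ"
      using circ_compact circ_Hausdorff by (simp add: compact_Hausdorff_or_regular_imp_normal_space)
    then obtain M N where M: "openin circ M" "C \<subseteq> M" and N: "openin circ N" "D \<subseteq> N" and MN: "disjnt M N"
      using C(1) D(1) CD unfolding normal_space_def by meson
    obtain F where F: "finite F" "F \<subseteq> gens" "C \<subseteq> \<Union>(ev ` F)" "\<Union>(ev ` F) \<subseteq> M"
      using gens_cover[OF C M] by blast
    obtain G where G: "finite G" "G \<subseteq> gens" "D \<subseteq> \<Union>(ev ` G)" "\<Union>(ev ` G) \<subseteq> N"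
      using gens_cover[OF D N] by blast
    have Fc: "F \<subseteq> carrier At" and Gc: "G \<subseteq> carrier At" using F(2) G(2) ev_gen(1) by auto
    have "F \<noteq> {}" "G \<noteq> {}" using F(3) G(3) by (auto simp: C_def D_def)
    moreover have "c \<sqsubseteq>\<^bsub>At\<^esub> \<Squnion>\<^bsub>At\<^esub> F"
      unfolding ev_le[OF cd(1) At.sup_closed[OF Fc]] ev_finite_sup[OF F(1) Fc] using F(3) by (simp add: C_def)
    moreover have "d \<sqsubseteq>\<^bsub>At\<^esub> \<Squnion>\<^bsub>At\<^esub> G"
      unfolding ev_le[OF cd(2) At.sup_closed[OF Gc]] ev_finite_sup[OF G(1) Gc] using G(3) by (simp add: D_def)
    moreover have "\<forall>x\<in>F. \<forall>y\<in>G. \<not> sigma_gen At \<phi> x y"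
    proof (intro ballI)
      fix x y assume xy: "x \<in> F" "y \<in> G"
      have "ev x \<subseteq> M" "ev y \<subseteq> N" using xy F(4) G(4) by blast+
      then have "ev x \<inter> ev y = {}" using MN by (auto simp: disjnt_iff)
      then show "\<not> sigma_gen At \<phi> x y" using sigma_gen_meets by blast
    qed
    ultimately show ?E using F(1,2) G(1,2) by blast
  qed
  then show ?thesis unfolding sigma_bounded_def by blast
qed

text \<open>\<open>sigma\<close> tests contact on bounded parts, so only common points other than 1
  count. A bounded regular closed neighbourhood of such a point cuts suitable parts out of
  \<open>a\<close> and \<open>b\<close>.\<close>

lemma sigma_iff:
  assumes ab: "a \<in> carrier At" "b \<in> carrier At"
  shows "sigma At \<phi> a b \<longleftrightarrow> ev a \<inter> ev b - {1} \<noteq> {}"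
proof
  assume "sigma At \<phi> a b"
  then obtain c d where cd: "c \<in> Bt At \<phi>" "d \<in> Bt At \<phi>" "c \<sqsubseteq>\<^bsub>At\<^esub> a" "d \<sqsubseteq>\<^bsub>At\<^esub> b" "sigma_bounded At \<phi> c d"
    unfolding sigma_def by blast
  then have "ev c \<inter> ev d \<noteq> {}" using sigma_bounded_iff by blast
  moreover have "c \<in> carrier At" "d \<in> carrier At" "1 \<notin> ev c" "1 \<notin> ev d" using cd Bt_iff by auto
  moreover have "ev c \<subseteq> ev a" "ev d \<subseteq> ev b" using cd(3,4) ab calculation by (simp_all add: ev_le)
  ultimately show "ev a \<inter> ev b - {1} \<noteq> {}" by blast
next
  assume "ev a \<inter> ev b - {1} \<noteq> {}"
  then obtain x where x: "x \<in> ev a" "x \<in> ev b" "x \<noteq> 1" by blast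
  interpret C: realization "RC circ" circ "\<lambda>F. F"
    using circ_compact circ_Hausdorff by (rule RC_realization)
  have xs: "x \<in> topspace circ" using x(1) ev_closed[of a] closedin_subset by blast
  have "openin circ (topspace circ - {1})"
    using circ_Hausdorff by (intro openin_diff) (simp_all add: closedin_Hausdorff_sing_eq)
  then obtain N where N: "N \<in> carrier (RC circ)" "x \<in> C.op N" "N \<subseteq> topspace circ - {1}"
    using C.regular_interpolate[of "topspace circ - {1}" x] x xs by auto
  have part: "\<exists>c\<in>Bt At \<phi>. c \<sqsubseteq>\<^bsub>At\<^esub> y \<and> x \<in> ev c" if y: "y \<in> carrier At" "x \<in> ev y" for y
  proof -
    let ?G = "N \<sqinter>\<^bsub>RC circ\<^esub> ev y"
    have G: "?G \<in> carrier (RC circ)" using m.B.meet_closed[OF N(1) m.match_closed] .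
    then have "?G \<in> ev ` carrier At" using bij_betw_imp_surj_on[OF m.match_bij] by simp
    then obtain c where c: "c \<in> carrier At" "ev c = ?G" by force
    have "?G \<subseteq> N" "?G \<subseteq> ev y"
      using m.B.meet_left[OF N(1) m.match_closed] m.B.meet_right[OF N(1) m.match_closed] by (simp_all add: RC_le)
    \<comment> \<open>\<open>x\<close> is a limit of interior points of \<open>ev y\<close>, and
      near \<open>x\<close> these are interior to \<open>N\<close>; so \<open>x\<close> survives in
      the Boolean meet.\<close>
    moreover have "x \<in> ?G"
    proof -
      have "x \<in> C.op N \<inter> circ closure_of C.op (ev y)"
        using N(2) y C.closure_op[OF m.match_closed, of y] by simp
      also have "\<dots> \<subseteq> circ closure_of (C.op N \<inter> C.op (ev y))"
        by (rule openin_Int_closure_of_subset) simp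
      also have "\<dots> = ?G" using C.closure_op[OF G] C.op_meet[OF N(1) m.match_closed] by simp
      finally show ?thesis .
    qed
    ultimately show ?thesis
      using c y N(3) by (intro bexI[of _ c]) (auto simp: Bt_iff ev_le)
  qed
  obtain c where c: "c \<in> Bt At \<phi>" "c \<sqsubseteq>\<^bsub>At\<^esub> a" "x \<in> ev c" using part[OF ab(1) x(1)] by blast
  obtain d where d: "d \<in> Bt At \<phi>" "d \<sqsubseteq>\<^bsub>At\<^esub> b" "x \<in> ev d" using part[OF ab(2) x(2)] by blast
  have "sigma_bounded At \<phi> c d" using sigma_bounded_iff[OF c(1) d(1)] c(3) d(3) by blast
  then show "sigma At \<phi> a b" unfolding sigma_def using c d by blast
qed

text \<open>The Alexandroff extension adds contact between unbounded elements, that is, between sets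
  containing 1; this restores exactly the point left out in \<open>sigma_iff\<close>.\<close>

lemma tilde_realization: "realization (alexandroff_ext (tilde_LCA At \<phi>)) circ ev"
proof -
  let ?K = "alexandroff_ext (tilde_LCA At \<phi>)"
  interpret o: same_order At ?K by unfold_locales (simp_all add: alexandroff_ext_def tilde_LCA_def)
  show ?thesis
  proof (rule realization.intro)
    show "boolean_alg ?K" by (rule o.boolean_alg[OF At.boolean_alg_axioms])
    show "complete_lattice ?K" by (rule o.complete_lattice[OF At.complete_lattice_axioms])
    show "bij_betw ev (carrier ?K) (carrier (RC circ))" unfolding o.carrier_eq by (rule m.match_bij)
    fix a b assume "a \<in> carrier ?K" "b \<in> carrier ?K"
    then have ab: "a \<in> carrier At" "b \<in> carrier At" by (simp_all add: o.carrier_eq)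
    show "a \<sqsubseteq>\<^bsub>?K\<^esub> b \<longleftrightarrow> ev a \<subseteq> ev b" using ev_le[OF ab] by (simp add: o.le_eq)
    show "contact ?K a b \<longleftrightarrow> ev a \<inter> ev b \<noteq> {}"
      using sigma_iff[OF ab] ab by (auto simp: alexandroff_ext_def tilde_LCA_def Bt_iff)
  qed (rule circ_compact circ_Hausdorff)+
qed

lemma tilde_CLCA: "CLCA (tilde_LCA At \<phi>)"
proof (rule pointed_CLCA[OF tilde_realization])
  show "(1::complex) \<in> topspace circ" by simp
  show "\<not> openin circ {1}" using circ_points[of "{1}" 1] by auto
  show "contact (tilde_LCA At \<phi>) a b \<longleftrightarrow> ev a \<inter> ev b - {1} \<noteq> {}"
    if "a \<in> carrier (tilde_LCA At \<phi>)" "b \<in> carrier (tilde_LCA At \<phi>)" for a b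
    using that sigma_iff by (simp add: tilde_LCA_def)
  show "bounded_elems (tilde_LCA At \<phi>) = {a \<in> carrier (tilde_LCA At \<phi>). 1 \<notin> ev a}"
    by (auto simp: tilde_LCA_def Bt_iff)
qed

end

theorem theorem5p2:
  fixes I :: "'i set"
    and A At :: "'a gorder"
    and \<phi> :: "nat \<Rightarrow> int set \<Rightarrow> 'a"
  assumes "bool_sum TYPE('a) {1..} (\<lambda>_. pow_alg Z0) A \<phi>"
    and "\<forall>i\<in>{1..}. inj_on (\<phi> i) (Pow Z0)"
    and "macneille_completion A At"
  shows "CLCA (tilde_LCA At \<phi>) \<and>
    (\<exists>(S :: ('i \<Rightarrow> complex) set contact_alg) \<iota>.
       DHC_sum TYPE(('i \<Rightarrow> complex) set) I (\<lambda>_. alexandroff_ext (tilde_LCA At \<phi>)) S \<iota> \<and>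
       DHC_sum TYPE('t) I (\<lambda>_. alexandroff_ext (tilde_LCA At \<phi>)) S \<iota> \<and>
       CA_isomorphic (RC (torus I)) S) \<and>
    (\<forall>(S :: 's contact_alg) \<iota>.
       DHC_sum TYPE(('i \<Rightarrow> complex) set) I (\<lambda>_. alexandroff_ext (tilde_LCA At \<phi>)) S \<iota> \<longrightarrow>
       CA_isomorphic (RC (torus I)) S \<and>
       (\<forall>Y :: 'y topology. compact_space Y \<and> Hausdorff_space Y \<and> CA_isomorphic (RC Y) S \<longrightarrow>
          Y homeomorphic_space torus I))"
proof -
  interpret free_completion A At \<phi> using assms by (rule free_completion.intro)
  have T: "torus I = product_topology (\<lambda>_. circ) I" by (simp add: torus_def circ_def)
  from sum_power(2)[OF tilde_realization T]
  have "\<forall>(S :: 's contact_alg) \<iota>.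
       DHC_sum TYPE(('i \<Rightarrow> complex) set) I (\<lambda>_. alexandroff_ext (tilde_LCA At \<phi>)) S \<iota> \<longrightarrow>
       CA_isomorphic (RC (torus I)) S \<and>
       (\<forall>Y :: 'y topology. compact_space Y \<and> Hausdorff_space Y \<and> CA_isomorphic (RC Y) S \<longrightarrow>
          Y homeomorphic_space torus I)"
    by (intro allI impI)
  then show ?thesis by (intro conjI tilde_CLCA sum_power(1)[OF tilde_realization T])
qed

end
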